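(* Let $\mathcal{H}$ be a Hilbert space, $\mathcal{C}$ a von Neumann algebra, and let $J:\mathcal{B}(\mathcal{H})\to\mathcal{B}(\mathcal{H})\otimes\mathcal{C}$ be a transition. If there exists a faithful normal state $\varphi$ on $\mathcal{B}(\mathcal{H})$ such that all vector states on $\mathcal{B}(\mathcal{H})$ are $J$-preparable from $\varphi$ by (mutually) compatible preparing sequences, then all normal states on $\mathcal{B}(\mathcal{H})$ are universally $J$-preparable with (mutually) compatible universally preparing sequences.
   Context: Hilbert spaces and preduals of von Neumann algebras are assumed separable; tensor products are von Neumann algebra tensor products; $\mathbb{N}=\{1,2,\dots\}$. A vector state is $\omega_\xi=\langle\xi,\cdot\,\xi\rangle$ with $\xi\in\mathcal{H}$ a unit vector. A transition is an injective unital normal $*$-homomorphism $J:\mathcal{A}\to\mathcal{A}\otimes\mathcal{C}$ ($\mathcal{A},\mathcal{C}$ von Neumann algebras). Put $\mathcal{C}_n:=\bigotimes_{j=1}^n\mathcal{C}_{(j)}$ with $\mathcal{C}_{(j)}$ copies of $\mathcal{C}$, and define $J_n:\mathcal{A}\to\mathcal{A}\otimes\mathcal{C}_n$ by $J_1=J$, $J_{n+1}=(J_n\otimes\mathrm{id}_{\mathcal{C}_{(n+1)}})\circ J_{(n+1)}$, where $J_{(n+1)}:\mathcal{A}\to\mathcal{A}\otimes\mathcal{C}_{(n+1)}$ is the copy of $J$. A normal state $\rho$ on $\mathcal{A}$ is $J$-preparable from a normal state $\sigma$ if there is a sequence $(\theta_k)_{k\in\mathbb{N}}$, each $\theta_k$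 a normal state on some $\mathcal{C}_{n_k}$ ($n_k\in\mathbb{N}$), such that $(\sigma\otimes\theta_k)J_{n_k}$ converges weakly to $\rho$ (i.e. pointwise on $\mathcal{A}$); $(\theta_k)$ is called a preparing sequence (from $\sigma$ to $\rho$). $\rho$ is universally $J$-preparable if one such sequence $(\theta_k)$ works simultaneously for all normal states $\sigma$ on $\mathcal{A}$; then $(\theta_k)$ is called a universally preparing sequence for $\rho$. Two preparing sequences $(\theta_k)$, $(\theta'_k)$, with $\theta_k$ a state on $\mathcal{C}_{n_k}$ and $\theta'_k$ a state on $\mathcal{C}_{n'_k}$, are compatible if $n_k=n'_k$ for all $k$. *)

theory Defs
  imports "HOL-Analysis.Analysis"
begin

section \<open>Complex Hilbert spaces\<close>

text \<open>The inner product is linear in the second variable.\<close>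

class complex_inner = real_normed_vector +
  fixes scaleC :: "complex \<Rightarrow> 'a \<Rightarrow> 'a" (infixr \<open>*\<^sub>C\<close> 75)
    and cinner :: "'a \<Rightarrow> 'a \<Rightarrow> complex"
  assumes scaleC_add_right: "c *\<^sub>C (x + y) = c *\<^sub>C x + c *\<^sub>C y"
    and scaleC_add_left: "(c + d) *\<^sub>C x = c *\<^sub>C x + d *\<^sub>C x"
    and scaleC_scaleC: "c *\<^sub>C d *\<^sub>C x = (c * d) *\<^sub>C x"
    and scaleR_scaleC: "r *\<^sub>R x = of_real r *\<^sub>C x"
    and cinner_commute: "cinner x y = cnj (cinner y x)"
    and cinner_add_right: "cinner x (y + z) = cinner x y + cinner x z"
    and cinner_scaleC_right: "cinner x (c *\<^sub>C y) = c * cinner x y"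
    and cinner_same: "cinner x x = of_real ((norm x)\<^sup>2)"

class hilbert_space = complex_inner + complete_space

lemma cinner_add_left: "cinner (x + y) z = cinner x z + cinner y z"
  by (metis cinner_add_right cinner_commute complex_cnj_add)

lemma cinner_scaleC_left: "cinner (c *\<^sub>C x) y = cnj c * cinner x y"
  by (metis cinner_scaleC_right cinner_commute complex_cnj_mult)

lemma scaleC_one [simp]: "1 *\<^sub>C x = (x :: 'a::complex_inner)"
  by (metis of_real_1 scaleR_one scaleR_scaleC)

lemma scaleC_minus1: "(-1) *\<^sub>C x = - (x :: 'a::complex_inner)"
  by (metis of_real_1 of_real_minus scaleR_minus1_left scaleR_scaleC)

lemma cinner_zero_right [simp]: "cinner x 0 = 0"
  by (metis add_cancel_right_right cinner_add_right)

lemma cinner_zero_left [simp]: "cinner 0 x = 0"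
  by (metis add_cancel_right_right cinner_add_left)

lemma cinner_minus_right: "cinner x (- y) = - cinner x y"
  by (metis add.right_inverse add_eq_0_iff cinner_add_right cinner_zero_right)

lemma cinner_diff_right: "cinner x (y - z) = cinner x y - cinner x z"
  by (metis cinner_add_right cinner_minus_right diff_conv_add_uminus)

lemma cinner_diff_left: "cinner (x - y) z = cinner x z - cinner y z"
  by (metis cinner_diff_right cinner_commute complex_cnj_diff)

lemma cinner_sum_right: "cinner x (\<Sum>i\<in>A. f i) = (\<Sum>i\<in>A. cinner x (f i))"
  by (induction A rule: infinite_finite_induct) (auto simp: cinner_add_right)

lemma cinner_sum_left: "cinner (\<Sum>i\<in>A. f i) x = (\<Sum>i\<in>A. cinner (f i) x)"
  by (induction A rule: infinite_finite_induct) (auto simp: cinner_add_left)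

definition orthonormal :: "'a::complex_inner set \<Rightarrow> bool" where
  "orthonormal B \<longleftrightarrow> (\<forall>x\<in>B. \<forall>y\<in>B. cinner x y = (if x = y then 1 else 0))"

definition orthonormal_basis :: "'a::complex_inner set \<Rightarrow> bool" where
  "orthonormal_basis B \<longleftrightarrow> orthonormal B \<and> (\<forall>x. (\<forall>b\<in>B. cinner b x = 0) \<longrightarrow> x = 0)"

lemma ex_orthonormal_basis: "\<exists>B::'a::complex_inner set. orthonormal_basis B"
proof -
  have "\<exists>M\<in>{B::'a set. orthonormal B}. \<forall>X\<in>{B. orthonormal B}. M \<subseteq> X \<longrightarrow> X = M"
  proof (rule subset_Zorn)
    fix \<C> :: "'a set set" assume "subset.chain {B. orthonormal B} \<C>"
    then have on: "\<And>B. B \<in> \<C> \<Longrightarrow> orthonormal B"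
      and ch: "\<And>X Y. X \<in> \<C> \<Longrightarrow> Y \<in> \<C> \<Longrightarrow> X \<subseteq> Y \<or> Y \<subseteq> X"
      by (auto simp: subset.chain_def)
    have "orthonormal (\<Union>\<C>)"
      unfolding orthonormal_def
    proof safe
      fix x y X Y assume "x \<in> X" "X \<in> \<C>" "y \<in> Y" "Y \<in> \<C>"
      then obtain Z where "Z \<in> \<C>" "x \<in> Z" "y \<in> Z" using ch by blast
      then show "cinner x y = (if x = y then 1 else 0)"
        using on unfolding orthonormal_def by blast
    qed
    then show "\<exists>U\<in>{B. orthonormal B}. \<forall>X\<in>\<C>. X \<subseteq> U" by blast
  qed
  then obtain B :: "'a set" where B: "orthonormal B"
    and mx: "\<And>X. orthonormal X \<Longrightarrow> B \<subseteq> X \<Longrightarrow> X = B" by blast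
  have "x = 0" if x: "\<forall>b\<in>B. cinner b x = 0" for x
  proof (rule ccontr)
    assume "x \<noteq> 0"
    define u where "u = of_real (inverse (norm x)) *\<^sub>C x"
    have u1: "cinner u u = 1"
      unfolding u_def cinner_scaleC_left cinner_scaleC_right cinner_same[of x]
      using \<open>x \<noteq> 0\<close> by (simp add: power2_eq_square field_simps)
    have bu: "cinner b u = 0" if "b \<in> B" for b
      using x that by (simp add: u_def cinner_scaleC_right)
    have ub: "cinner u b = 0" if "b \<in> B" for b
      using bu[OF that] cinner_commute[of u b] by simp
    have "orthonormal (insert u B)"
      using B u1 bu ub unfolding orthonormal_def by (metis insert_iff zero_neq_one)
    with mx have "u \<in> B" by blast
    with bu u1 show False by fastforce
  qed
  with B show ?thesis unfolding orthonormal_basis_def by blast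
qed

text \<open>Tensor products of Hilbert spaces are coordinatised by this basis; a different choice only
  changes them by a unitary.\<close>

definition basis :: "'a::complex_inner set" where
  "basis = (SOME B. orthonormal_basis B)"

lemma orthonormal_basis_basis: "orthonormal_basis (basis :: 'a::complex_inner set)"
  unfolding basis_def by (rule someI_ex) (rule ex_orthonormal_basis)

definition coord :: "'a::complex_inner \<Rightarrow> 'a \<Rightarrow> complex" where
  "coord x b = (if b \<in> basis then cinner b x else 0)"

lemma Bessel_finite:
  assumes F: "finite F" and on: "orthonormal F"
  shows "(\<Sum>b\<in>F. (cmod (cinner b x))\<^sup>2) \<le> (norm x)\<^sup>2"
proof -
  define s where "s = (\<Sum>b\<in>F. cinner b x *\<^sub>C b)"
  let ?S = "\<Sum>b\<in>F. (cmod (cinner b x))\<^sup>2"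
  have bs: "cinner b s = cinner b x" if "b \<in> F" for b
  proof -
    have "cinner b s = (\<Sum>c\<in>F. cinner c x * cinner b c)"
      by (simp add: s_def cinner_sum_right cinner_scaleC_right)
    also have "\<dots> = (\<Sum>c\<in>F. if c = b then cinner c x else 0)"
      using on that unfolding orthonormal_def by (intro sum.cong) auto
    also have "\<dots> = cinner b x" using F that by simp
    finally show ?thesis .
  qed
  have ss: "cinner s y = (\<Sum>b\<in>F. cnj (cinner b x) * cinner b y)" for y
    by (simp add: s_def cinner_sum_left cinner_scaleC_left)
  have sx: "cinner s x = of_real ?S"
    by (simp add: ss mult.commute flip: complex_norm_square)
  have s2: "cinner s s = of_real ?S"
    using bs by (simp add: ss mult.commute flip: complex_norm_square)
  have xs: "cinner x s = of_real ?S"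
    using sx cinner_commute[of x s] by simp
  have "of_real ((norm (x - s))\<^sup>2) = cinner (x - s) (x - s)" by (simp add: cinner_same)
  also have "\<dots> = of_real ((norm x)\<^sup>2 - ?S)"
    unfolding cinner_diff_left cinner_diff_right sx s2 xs cinner_same[of x] by simp
  finally have "(norm (x - s))\<^sup>2 = (norm x)\<^sup>2 - ?S" by (simp only: of_real_eq_iff)
  then show ?thesis by (metis diff_ge_0_iff_ge zero_le_power2)
qed

lemma coord_summable: "(\<lambda>b. (cmod (coord x b))\<^sup>2) summable_on UNIV"
proof (rule nonneg_bounded_partial_sums_imp_summable_on)
  show "\<forall>\<^sub>F F in finite_subsets_at_top UNIV. (\<Sum>b\<in>F. (cmod (coord x b))\<^sup>2) \<le> (norm x)\<^sup>2"
  proof (rule eventually_finite_subsets_at_top_weakI)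
    fix F :: "'a set" assume F: "finite F"
    have on: "orthonormal (F \<inter> basis)"
      using orthonormal_basis_basis unfolding orthonormal_basis_def orthonormal_def by blast
    have "(\<Sum>b\<in>F. (cmod (coord x b))\<^sup>2) = (\<Sum>b\<in>F \<inter> basis. (cmod (cinner b x))\<^sup>2)"
      unfolding sum.inter_restrict[OF F] by (intro sum.cong) (auto simp: coord_def)
    then show "(\<Sum>b\<in>F. (cmod (coord x b))\<^sup>2) \<le> (norm x)\<^sup>2"
      using Bessel_finite[OF _ on] F by simp
  qed
qed simp


section \<open>The Hilbert space of square-summable functions\<close>

typedef 'i ell2 = "{f :: 'i \<Rightarrow> complex. (\<lambda>i. (cmod (f i))\<^sup>2) summable_on UNIV}"
  by (rule exI[of _ "\<lambda>_. 0"]) simp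

setup_lifting type_definition_ell2

lemma square_summable_add:
  fixes f g :: "'i \<Rightarrow> complex"
  assumes "(\<lambda>i. (cmod (f i))\<^sup>2) summable_on UNIV" "(\<lambda>i. (cmod (g i))\<^sup>2) summable_on UNIV"
  shows "(\<lambda>i. (cmod (f i + g i))\<^sup>2) summable_on UNIV"
proof (rule summable_on_comparison_test)
  show "(\<lambda>i. 2 * (cmod (f i))\<^sup>2 + 2 * (cmod (g i))\<^sup>2) summable_on UNIV"
    using assms by (intro summable_on_add summable_on_cmult_right)
  fix i
  have "(cmod (f i + g i))\<^sup>2 \<le> (cmod (f i) + cmod (g i))\<^sup>2"
    by (intro power_mono norm_triangle_ineq) auto
  also have "\<dots> \<le> 2 * (cmod (f i))\<^sup>2 + 2 * (cmod (g i))\<^sup>2"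
    using sum_squares_bound[of "cmod (f i)" "cmod (g i)"] by (simp add: power2_sum)
  finally show "(cmod (f i + g i))\<^sup>2 \<le> 2 * (cmod (f i))\<^sup>2 + 2 * (cmod (g i))\<^sup>2" .
qed auto

lemma square_summable_mult:
  fixes f :: "'i \<Rightarrow> complex"
  assumes "(\<lambda>i. (cmod (f i))\<^sup>2) summable_on UNIV"
  shows "(\<lambda>i. (cmod (c * f i))\<^sup>2) summable_on UNIV"
  using summable_on_cmult_right[OF assms, of "(cmod c)\<^sup>2"] by (simp add: norm_mult power_mult_distrib)

lemma square_summable_product:
  fixes f g :: "'i \<Rightarrow> complex"
  assumes "(\<lambda>i. (cmod (f i))\<^sup>2) summable_on UNIV" "(\<lambda>i. (cmod (g i))\<^sup>2) summable_on UNIV"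
  shows "(\<lambda>i. cnj (f i) * g i) summable_on UNIV"
proof (rule abs_summable_summable, rule summable_on_comparison_test)
  show "(\<lambda>i. (cmod (f i))\<^sup>2 + (cmod (g i))\<^sup>2) summable_on UNIV"
    using assms by (rule summable_on_add)
  fix i
  show "cmod (cnj (f i) * g i) \<le> (cmod (f i))\<^sup>2 + (cmod (g i))\<^sup>2"
    using sum_squares_bound[of "cmod (f i)" "cmod (g i)"]
      mult_nonneg_nonneg[OF norm_ge_zero norm_ge_zero, of "f i" "g i"]
    unfolding norm_mult complex_mod_cnj by linarith
qed auto

instantiation ell2 :: (type) complex_inner
begin

lift_definition zero_ell2 :: "'a ell2" is "\<lambda>_. 0" by simp
lift_definition uminus_ell2 :: "'a ell2 \<Rightarrow> 'a ell2" is "\<lambda>f i. - f i" by simp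
lift_definition plus_ell2 :: "'a ell2 \<Rightarrow> 'a ell2 \<Rightarrow> 'a ell2" is "\<lambda>f g i. f i + g i"
  by (rule square_summable_add)
lift_definition minus_ell2 :: "'a ell2 \<Rightarrow> 'a ell2 \<Rightarrow> 'a ell2" is "\<lambda>f g i. f i - g i"
  subgoal for f g using square_summable_add[of f "\<lambda>i. - g i"] by simp
  done
lift_definition scaleC_ell2 :: "complex \<Rightarrow> 'a ell2 \<Rightarrow> 'a ell2" is "\<lambda>c f i. c * f i"
  by (rule square_summable_mult)
lift_definition scaleR_ell2 :: "real \<Rightarrow> 'a ell2 \<Rightarrow> 'a ell2" is "\<lambda>r f i. of_real r * f i"
  by (rule square_summable_mult)
lift_definition cinner_ell2 :: "'a ell2 \<Rightarrow> 'a ell2 \<Rightarrow> complex" is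
  "\<lambda>f g. \<Sum>\<^sub>\<infinity>i. cnj (f i) * g i" .
lift_definition norm_ell2 :: "'a ell2 \<Rightarrow> real" is "\<lambda>f. sqrt (\<Sum>\<^sub>\<infinity>i. (cmod (f i))\<^sup>2)" .
definition dist_ell2 :: "'a ell2 \<Rightarrow> 'a ell2 \<Rightarrow> real" where "dist_ell2 x y = norm (x - y)"
definition sgn_ell2 :: "'a ell2 \<Rightarrow> 'a ell2" where "sgn_ell2 x = scaleR (inverse (norm x)) x"
definition uniformity_ell2 :: "('a ell2 \<times> 'a ell2) filter" where
  "uniformity_ell2 = (INF e\<in>{0<..}. principal {(x, y). dist x y < e})"
definition open_ell2 :: "'a ell2 set \<Rightarrow> bool" where
  "open_ell2 U \<longleftrightarrow> (\<forall>x\<in>U. \<forall>\<^sub>F (x', y) in uniformity. x' = x \<longrightarrow> y \<in> U)"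

lemma L2_le_norm_ell2:
  assumes "finite F"
  shows "L2_set (\<lambda>i. cmod (Rep_ell2 x i)) F \<le> norm (x :: 'a ell2)"
proof -
  have "(\<Sum>i\<in>F. (cmod (Rep_ell2 x i))\<^sup>2) \<le> (\<Sum>\<^sub>\<infinity>i. (cmod (Rep_ell2 x i))\<^sup>2)"
    using Rep_ell2[of x] assms by (intro finite_sum_le_infsum) auto
  then show ?thesis by (simp add: L2_set_def norm_ell2.rep_eq)
qed

lemma norm_ell2_leI:
  assumes "\<And>F. finite F \<Longrightarrow> L2_set (\<lambda>i. cmod (Rep_ell2 x i)) F \<le> c"
  shows "norm (x :: 'a ell2) \<le> c"
proof -
  have c: "0 \<le> c" using assms[of "{}"] by simp
  have "(\<Sum>\<^sub>\<infinity>i. (cmod (Rep_ell2 x i))\<^sup>2) \<le> c\<^sup>2"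
  proof (rule infsum_le_finite_sums)
    show "(\<lambda>i. (cmod (Rep_ell2 x i))\<^sup>2) summable_on UNIV" using Rep_ell2[of x] by simp
    fix F :: "'a set" assume "finite F"
    then show "(\<Sum>i\<in>F. (cmod (Rep_ell2 x i))\<^sup>2) \<le> c\<^sup>2"
      using assms[of F] unfolding L2_set_def
      by (metis sqrt_le_D)
  qed
  then show ?thesis using c by (simp add: norm_ell2.rep_eq real_le_lsqrt infsum_nonneg)
qed

instance
proof
  fix x y z :: "'a ell2" and r s :: real and c d :: complex
  show "x + y + z = x + (y + z)" by transfer (simp add: add.assoc)
  show "x + y = y + x" by transfer (simp add: add.commute)
  show "0 + x = x" by transfer simp
  show "- x + x = 0" by transfer simp
  show "x - y = x + - y" by transfer simp
  show "r *\<^sub>R (x + y) = r *\<^sub>R x + r *\<^sub>R y" by transfer (simp add: algebra_simps)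
  show "(r + s) *\<^sub>R x = r *\<^sub>R x + s *\<^sub>R x" by transfer (simp add: algebra_simps)
  show "r *\<^sub>R s *\<^sub>R x = (r * s) *\<^sub>R x" by transfer (simp add: algebra_simps)
  show "1 *\<^sub>R x = x" by transfer simp
  show "dist x y = norm (x - y)" by (rule dist_ell2_def)
  show "sgn x = scaleR (inverse (norm x)) x" by (rule sgn_ell2_def)
  show "uniformity = (INF e\<in>{0<..}. principal {(x :: 'a ell2, y). dist x y < e})"
    by (rule uniformity_ell2_def)
  show "open U \<longleftrightarrow> (\<forall>x\<in>U. \<forall>\<^sub>F (x', y) in uniformity. x' = x \<longrightarrow> y \<in> U)" for U :: "'a ell2 set"
    by (rule open_ell2_def)
  show "(norm x = 0) = (x = 0)"
  proof
    assume "norm x = 0"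
    then have "cmod (Rep_ell2 x i) \<le> 0" for i
      using L2_le_norm_ell2[of "{i}" x] by (simp add: L2_set_def)
    then show "x = 0" by transfer auto
  qed (transfer, simp)
  show "norm (x + y) \<le> norm x + norm y"
  proof (rule norm_ell2_leI)
    fix F :: "'a set" assume F: "finite F"
    have "L2_set (\<lambda>i. cmod (Rep_ell2 (x + y) i)) F
        \<le> L2_set (\<lambda>i. cmod (Rep_ell2 x i) + cmod (Rep_ell2 y i)) F"
      by (rule L2_set_mono) (auto simp: plus_ell2.rep_eq norm_triangle_ineq)
    also have "\<dots> \<le> L2_set (\<lambda>i. cmod (Rep_ell2 x i)) F + L2_set (\<lambda>i. cmod (Rep_ell2 y i)) F"
      by (rule L2_set_triangle_ineq)
    also have "\<dots> \<le> norm x + norm y" by (intro add_mono L2_le_norm_ell2 F)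
    finally show "L2_set (\<lambda>i. cmod (Rep_ell2 (x + y) i)) F \<le> norm x + norm y" .
  qed
  show "norm (r *\<^sub>R x) = \<bar>r\<bar> * norm x"
    by transfer (simp add: norm_mult power_mult_distrib infsum_cmult_right' real_sqrt_mult)
  show "c *\<^sub>C (x + y) = c *\<^sub>C x + c *\<^sub>C y" by transfer (simp add: algebra_simps)
  show "(c + d) *\<^sub>C x = c *\<^sub>C x + d *\<^sub>C x" by transfer (simp add: algebra_simps)
  show "c *\<^sub>C d *\<^sub>C x = (c * d) *\<^sub>C x" by transfer (simp add: algebra_simps)
  show "r *\<^sub>R x = of_real r *\<^sub>C x" by transfer simp
  show "cinner x y = cnj (cinner y x)" by transfer (simp flip: infsum_cnj add: mult.commute)
  show "cinner x (y + z) = cinner x y + cinner x z"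
  proof transfer
    fix x y z :: "'a \<Rightarrow> complex"
    assume "(\<lambda>i. (cmod (x i))\<^sup>2) summable_on UNIV" "(\<lambda>i. (cmod (y i))\<^sup>2) summable_on UNIV"
      "(\<lambda>i. (cmod (z i))\<^sup>2) summable_on UNIV"
    then show "(\<Sum>\<^sub>\<infinity>i. cnj (x i) * (y i + z i)) =
        (\<Sum>\<^sub>\<infinity>i. cnj (x i) * y i) + (\<Sum>\<^sub>\<infinity>i. cnj (x i) * z i)"
      by (simp add: distrib_left infsum_add square_summable_product)
  qed
  show "cinner x (c *\<^sub>C y) = c * cinner x y"
    by transfer (simp flip: infsum_cmult_right' add: mult.left_commute)
  show "cinner x x = of_real ((norm x)\<^sup>2)"
  proof transfer
    fix x :: "'a \<Rightarrow> complex" assume x: "(\<lambda>i. (cmod (x i))\<^sup>2) summable_on UNIV"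
    have "(\<Sum>\<^sub>\<infinity>i. cnj (x i) * x i) = (\<Sum>\<^sub>\<infinity>i. of_real ((cmod (x i))\<^sup>2))"
      by (simp only: complex_norm_square mult.commute)
    also have "\<dots> = of_real (\<Sum>\<^sub>\<infinity>i. (cmod (x i))\<^sup>2)" 
      using x by (intro infsumI has_sum_of_real has_sum_infsum)
    finally show "(\<Sum>\<^sub>\<infinity>i. cnj (x i) * x i) = of_real ((sqrt (\<Sum>\<^sub>\<infinity>i. (cmod (x i))\<^sup>2))\<^sup>2)"
      by (simp add: infsum_nonneg)
  qed
qed

end

lemma cmod_Rep_ell2_le: "cmod (Rep_ell2 x i) \<le> norm x"
  using L2_le_norm_ell2[of "{i}" x] by (simp add: L2_set_def)

instance ell2 :: (type) hilbert_space
proof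
  fix X :: "nat \<Rightarrow> 'a ell2" assume X: "Cauchy X"
  have "Cauchy (\<lambda>n. Rep_ell2 (X n) i)" for i
  proof (rule metric_CauchyI)
    fix e :: real assume "0 < e"
    obtain M where M: "\<forall>m\<ge>M. \<forall>n\<ge>M. norm (X m - X n) < e"
      using CauchyD[OF X \<open>0 < e\<close>] ..
    show "\<exists>M. \<forall>m\<ge>M. \<forall>n\<ge>M. dist (Rep_ell2 (X m) i) (Rep_ell2 (X n) i) < e"
    proof (intro exI allI impI)
      fix m n assume "m \<ge> M" "n \<ge> M"
      then have "cmod (Rep_ell2 (X m - X n) i) < e"
        by (intro le_less_trans[OF cmod_Rep_ell2_le]) (simp add: M)
      then show "dist (Rep_ell2 (X m) i) (Rep_ell2 (X n) i) < e"
        by (simp add: dist_norm minus_ell2.rep_eq)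
    qed
  qed
  then have "\<forall>i. \<exists>l. (\<lambda>n. Rep_ell2 (X n) i) \<longlonglongrightarrow> l"
    by (simp add: Cauchy_convergent_iff convergent_def)
  then obtain f where f: "\<And>i. (\<lambda>n. Rep_ell2 (X n) i) \<longlonglongrightarrow> f i" by metis
  have tail: "\<exists>M. \<forall>m\<ge>M. \<forall>F. finite F \<longrightarrow> L2_set (\<lambda>i. cmod (Rep_ell2 (X m) i - f i)) F \<le> e"
    if e: "e > 0" for e
  proof -
    obtain M where M: "\<forall>m\<ge>M. \<forall>n\<ge>M. norm (X m - X n) < e"
      using CauchyD[OF X e] ..
    show ?thesis
    proof (intro exI allI impI)
      fix m and F :: "'a set" assume m: "m \<ge> M" and F: "finite F"
      have "(\<lambda>n. L2_set (\<lambda>i. cmod (Rep_ell2 (X m) i - Rep_ell2 (X n) i)) F)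
          \<longlonglongrightarrow> L2_set (\<lambda>i. cmod (Rep_ell2 (X m) i - f i)) F"
        unfolding L2_set_def by (intro tendsto_intros f)
      moreover have "L2_set (\<lambda>i. cmod (Rep_ell2 (X m) i - Rep_ell2 (X n) i)) F \<le> e" if "n \<ge> M" for n
        using L2_le_norm_ell2[OF F, of "X m - X n"] M m that
        by (force simp: minus_ell2.rep_eq)
      ultimately show "L2_set (\<lambda>i. cmod (Rep_ell2 (X m) i - f i)) F \<le> e"
        by (intro Lim_bounded) auto
    qed
  qed
  obtain M where M: "\<And>F. finite F \<Longrightarrow> L2_set (\<lambda>i. cmod (Rep_ell2 (X M) i - f i)) F \<le> 1"
    using tail[of 1] by auto
  have d: "(\<lambda>i. (cmod (f i - Rep_ell2 (X M) i))\<^sup>2) summable_on UNIV"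
  proof (rule nonneg_bounded_partial_sums_imp_summable_on)
    show "\<forall>\<^sub>F F in finite_subsets_at_top UNIV. (\<Sum>i\<in>F. (cmod (f i - Rep_ell2 (X M) i))\<^sup>2) \<le> 1"
    proof (rule eventually_finite_subsets_at_top_weakI)
      fix F :: "'a set" assume "finite F"
      then have "sqrt (\<Sum>i\<in>F. (cmod (f i - Rep_ell2 (X M) i))\<^sup>2) \<le> 1"
        using M[of F] by (simp add: L2_set_def norm_minus_commute)
      then show "(\<Sum>i\<in>F. (cmod (f i - Rep_ell2 (X M) i))\<^sup>2) \<le> 1" by simp
    qed
  qed simp
  have "(\<lambda>i. (cmod (f i))\<^sup>2) summable_on UNIV"
    using square_summable_add[OF d, of "Rep_ell2 (X M)"] Rep_ell2[of "X M"] by simp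
  then have Rf: "Rep_ell2 (Abs_ell2 f) = f" by (simp add: Abs_ell2_inverse)
  have "X \<longlonglongrightarrow> Abs_ell2 f"
  proof (rule LIMSEQ_I)
    fix e :: real assume "0 < e"
    then obtain N where "\<And>m F. m \<ge> N \<Longrightarrow> finite F \<Longrightarrow>
        L2_set (\<lambda>i. cmod (Rep_ell2 (X m) i - f i)) F \<le> e / 2"
      using tail[of "e / 2"] by auto
    then have le: "norm (X m - Abs_ell2 f) \<le> e / 2" if "m \<ge> N" for m
      using that by (intro norm_ell2_leI) (simp add: minus_ell2.rep_eq Rf)
    show "\<exists>N. \<forall>n\<ge>N. norm (X n - Abs_ell2 f) < e"
    proof (intro exI allI impI)
      fix m assume "m \<ge> N"
      then have "norm (X m - Abs_ell2 f) \<le> e / 2" by (rule le)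
      with \<open>0 < e\<close> show "norm (X m - Abs_ell2 f) < e" by linarith
    qed
  qed
  then show "convergent X" unfolding convergent_def by blast
qed


section \<open>Tensor powers of Hilbert spaces\<close>

text \<open>With basis \<open>B\<close> of \<open>H\<close> and \<open>D\<close> of \<open>K\<close>, the \<open>n\<close>-fold tensor power of \<open>K\<close> is realised as
  the square-summable functions on \<open>D\<^sup>n\<close> and its tensor product with \<open>H\<close> as those on \<open>B \<times> D\<^sup>n\<close>;
  words of length \<open>n\<close> stand for elements of \<open>D\<^sup>n\<close>. All these spaces, for varying \<open>n\<close>, are
  closed subspaces of one space of square-summable functions.\<close>

definition powspace :: "nat \<Rightarrow> 'k::complex_inner list ell2 set" where
  "powspace n = {w. \<forall>bs. Rep_ell2 w bs \<noteq> 0 \<longrightarrow> length bs = n \<and> set bs \<subseteq> basis}"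

definition syspowspace :: "nat \<Rightarrow> ('h::complex_inner \<times> 'k::complex_inner list) ell2 set" where
  "syspowspace n = {v. \<forall>b bs. Rep_ell2 v (b, bs) \<noteq> 0 \<longrightarrow>
     b \<in> basis \<and> length bs = n \<and> set bs \<subseteq> basis}"

lemma square_summable_tensor:
  fixes f :: "'i \<Rightarrow> complex" and g :: "'j \<Rightarrow> complex" and p :: "'l \<Rightarrow> 'i \<times> 'j"
  assumes "(\<lambda>i. (cmod (f i))\<^sup>2) summable_on UNIV" "(\<lambda>j. (cmod (g j))\<^sup>2) summable_on UNIV"
    and "inj_on p A"
  shows "(\<lambda>l. (cmod (if l \<in> A then f (fst (p l)) * g (snd (p l)) else 0))\<^sup>2) summable_on UNIV"
proof -
  have "(\<lambda>(i, j). (cmod (f i))\<^sup>2 * (cmod (g j))\<^sup>2) summable_on UNIV \<times> UNIV"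
    by (rule summable_on_SigmaI[where g = "\<lambda>i. (cmod (f i))\<^sup>2 * (\<Sum>\<^sub>\<infinity>j. (cmod (g j))\<^sup>2)"])
      (auto intro!: has_sum_cmult_right summable_on_cmult_left assms has_sum_infsum)
  then have "(\<lambda>(i, j). (cmod (f i))\<^sup>2 * (cmod (g j))\<^sup>2) summable_on p ` A"
    by (rule summable_on_subset_banach) auto
  then have "((\<lambda>(i, j). (cmod (f i))\<^sup>2 * (cmod (g j))\<^sup>2) \<circ> p) summable_on A"
    using assms(3) by (simp add: summable_on_reindex)
  then have "(\<lambda>l. (cmod (f (fst (p l))))\<^sup>2 * (cmod (g (snd (p l))))\<^sup>2) summable_on A"
    by (simp add: comp_def case_prod_unfold)
  also have "?this \<longleftrightarrow> ?thesis"
    by (rule summable_on_cong_neutral) (auto simp: norm_mult power_mult_distrib)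
  finally show ?thesis .
qed

lemma inj_on_butlast_last: "inj_on (\<lambda>bs. (butlast bs, last bs)) (- {[]})"
  by (rule inj_onI) (metis ComplD Pair_inject append_butlast_last_id singletonI)

lemma inj_on_butlast_last': "inj_on (\<lambda>(b, bs). ((b, butlast bs), last bs)) (UNIV \<times> - {[]})"
  using inj_on_butlast_last unfolding inj_on_def by auto

text \<open>The canonical bilinear maps \<open>H \<times> K\<^sup>\<otimes>\<^sup>n \<rightarrow> H \<otimes> K\<^sup>\<otimes>\<^sup>n\<close>,
  \<open>K\<^sup>\<otimes>\<^sup>n \<times> K \<rightarrow> K\<^sup>\<otimes>\<^sup>n\<^sup>+\<^sup>1\<close> and \<open>(H \<otimes> K\<^sup>\<otimes>\<^sup>n) \<times> K \<rightarrow> H \<otimes> K\<^sup>\<otimes>\<^sup>n\<^sup>+\<^sup>1\<close>.\<close>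

lift_definition tensor_sys ::
  "'h::complex_inner \<Rightarrow> 'k::complex_inner list ell2 \<Rightarrow> ('h \<times> 'k list) ell2"
  is "\<lambda>x w (b, bs). coord x b * w bs"
  subgoal for x w
    using square_summable_tensor[OF coord_summable[of x], of w id UNIV]
    by (simp add: case_prod_unfold)
  done

lift_definition tensor_pow ::
  "'k::complex_inner list ell2 \<Rightarrow> 'k \<Rightarrow> 'k list ell2"
  is "\<lambda>w y bs. if bs \<noteq> [] then w (butlast bs) * coord y (last bs) else 0"
  subgoal for w y
    using square_summable_tensor[OF _ coord_summable[of y] inj_on_butlast_last, of w]
    by (simp cong: if_cong)
  done

lift_definition tensor_syspow ::
  "('h::complex_inner \<times> 'k::complex_inner list) ell2 \<Rightarrow> 'k \<Rightarrow> ('h \<times> 'k list) ell2"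
  is "\<lambda>v y (b, bs). if bs \<noteq> [] then v (b, butlast bs) * coord y (last bs) else 0"
  subgoal for v y
    using square_summable_tensor[OF _ coord_summable[of y] inj_on_butlast_last', of v]
    by (simp add: case_prod_unfold mem_Times_iff cong: if_cong)
  done

lemma tensor_assoc: "tensor_sys x (tensor_pow w y) = tensor_syspow (tensor_sys x w) y"
  by transfer (auto simp: fun_eq_iff)


section \<open>Von Neumann algebras\<close>

text \<open>The algebra of bounded operators on a closed subspace \<open>S\<close>. An operator on \<open>S\<close> is
  represented by a function that vanishes outside \<open>S\<close>, so that equality of functions is equality
  of operators; \<open>S = UNIV\<close> gives the bounded operators on the whole type.\<close>

definition bop :: "'a::complex_inner set \<Rightarrow> ('a \<Rightarrow> 'a) set" where
  "bop S = {a. (\<forall>x\<in>S. a x \<in> S) \<and> (\<forall>x. x \<notin> S \<longrightarrow> a x = 0)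
     \<and> (\<forall>x\<in>S. \<forall>y\<in>S. a (x + y) = a x + a y) \<and> (\<forall>c. \<forall>x\<in>S. a (c *\<^sub>C x) = c *\<^sub>C a x)
     \<and> (\<exists>M. \<forall>x\<in>S. norm (a x) \<le> M * norm x)}"

definition idop :: "'a::complex_inner set \<Rightarrow> 'a \<Rightarrow> 'a" where
  "idop S = (\<lambda>x. if x \<in> S then x else 0)"

definition adj :: "'a::complex_inner set \<Rightarrow> ('a \<Rightarrow> 'a) \<Rightarrow> 'a \<Rightarrow> 'a" where
  "adj S a = (THE b. b \<in> bop S \<and> (\<forall>x\<in>S. \<forall>y\<in>S. cinner (b x) y = cinner x (a y)))"

definition commutant :: "'a::complex_inner set \<Rightarrow> ('a \<Rightarrow> 'a) set \<Rightarrow> ('a \<Rightarrow> 'a) set" where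
  "commutant S M = {b \<in> bop S. \<forall>a\<in>M. a \<circ> b = b \<circ> a}"

definition von_neumann_algebra :: "'a::complex_inner set \<Rightarrow> ('a \<Rightarrow> 'a) set \<Rightarrow> bool" where
  "von_neumann_algebra S M \<longleftrightarrow>
     M \<subseteq> bop S \<and> (\<forall>a\<in>M. adj S a \<in> M) \<and> commutant S (commutant S M) = M"

definition ultraweak :: "'a::complex_inner set \<Rightarrow> ('a \<Rightarrow> 'a) topology" where
  "ultraweak S = topology_generated_by
     {{a \<in> bop S. (\<Sum>i. cinner (x i) (a (y i))) \<in> U} | x y U.
        (\<forall>i::nat. x i \<in> S \<and> y i \<in> S) \<and> summable (\<lambda>i. (norm (x i))\<^sup>2)
        \<and> summable (\<lambda>i. (norm (y i))\<^sup>2) \<and> open U}"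

text \<open>For the following notions \<open>M\<close> and \<open>N\<close> are von Neumann algebras on \<open>S\<close> and \<open>T\<close>. Functionals
  on \<open>M\<close> and maps out of \<open>M\<close> are functions whose values outside \<open>M\<close> are irrelevant.\<close>

definition normal_star_hom ::
  "'a::complex_inner set \<Rightarrow> ('a \<Rightarrow> 'a) set \<Rightarrow> 'b::complex_inner set \<Rightarrow> ('b \<Rightarrow> 'b) set
    \<Rightarrow> (('a \<Rightarrow> 'a) \<Rightarrow> ('b \<Rightarrow> 'b)) \<Rightarrow> bool" where
  "normal_star_hom S M T N \<Phi> \<longleftrightarrow>
     \<Phi> ` M \<subseteq> N
     \<and> (\<forall>a\<in>M. \<forall>b\<in>M. \<Phi> (\<lambda>x. a x + b x) = (\<lambda>x. \<Phi> a x + \<Phi> b x))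
     \<and> (\<forall>c. \<forall>a\<in>M. \<Phi> (\<lambda>x. c *\<^sub>C a x) = (\<lambda>x. c *\<^sub>C \<Phi> a x))
     \<and> (\<forall>a\<in>M. \<forall>b\<in>M. \<Phi> (a \<circ> b) = \<Phi> a \<circ> \<Phi> b)
     \<and> (\<forall>a\<in>M. \<Phi> (adj S a) = adj T (\<Phi> a))
     \<and> continuous_map (subtopology (ultraweak S) M) (subtopology (ultraweak T) N) \<Phi>"

definition normal_state ::
  "'a::complex_inner set \<Rightarrow> ('a \<Rightarrow> 'a) set \<Rightarrow> (('a \<Rightarrow> 'a) \<Rightarrow> complex) \<Rightarrow> bool" where
  "normal_state S M \<omega> \<longleftrightarrow>
     (\<forall>a\<in>M. \<forall>b\<in>M. \<omega> (\<lambda>x. a x + b x) = \<omega> a + \<omega> b)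
     \<and> (\<forall>c. \<forall>a\<in>M. \<omega> (\<lambda>x. c *\<^sub>C a x) = c * \<omega> a)
     \<and> (\<forall>a\<in>M. \<omega> (adj S a \<circ> a) \<in> \<real>\<^sub>\<ge>\<^sub>0)
     \<and> \<omega> (idop S) = 1
     \<and> continuous_map (subtopology (ultraweak S) M) euclidean \<omega>"

definition faithful ::
  "'a::complex_inner set \<Rightarrow> ('a \<Rightarrow> 'a) set \<Rightarrow> (('a \<Rightarrow> 'a) \<Rightarrow> complex) \<Rightarrow> bool" where
  "faithful S M \<omega> \<longleftrightarrow> (\<forall>a\<in>M. \<omega> (adj S a \<circ> a) = 0 \<longrightarrow> a = (\<lambda>x. 0))"

definition vector_state :: "'a::complex_inner \<Rightarrow> ('a \<Rightarrow> 'a) \<Rightarrow> complex" where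
  "vector_state \<xi> a = cinner \<xi> (a \<xi>)"

text \<open>In the next two definitions \<open>\<tau> : R \<times> S \<rightarrow> T\<close> is the canonical bilinear map of a Hilbert space
  tensor product.\<close>

definition op_tensor ::
  "('a \<Rightarrow> 'b \<Rightarrow> 'c) \<Rightarrow> 'a::complex_inner set \<Rightarrow> 'b::complex_inner set \<Rightarrow> 'c::complex_inner set
    \<Rightarrow> ('a \<Rightarrow> 'a) \<Rightarrow> ('b \<Rightarrow> 'b) \<Rightarrow> 'c \<Rightarrow> 'c" where
  "op_tensor \<tau> R S T a b = (THE z. z \<in> bop T \<and> (\<forall>x\<in>R. \<forall>y\<in>S. z (\<tau> x y) = \<tau> (a x) (b y)))"

definition vn_tensor ::
  "('a \<Rightarrow> 'b \<Rightarrow> 'c) \<Rightarrow> 'a::complex_inner set \<Rightarrow> 'b::complex_inner set \<Rightarrow> 'c::complex_inner set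
    \<Rightarrow> ('a \<Rightarrow> 'a) set \<Rightarrow> ('b \<Rightarrow> 'b) set \<Rightarrow> ('c \<Rightarrow> 'c) set" where
  "vn_tensor \<tau> R S T M N =
     commutant T (commutant T {op_tensor \<tau> R S T a b | a b. a \<in> M \<and> b \<in> N})"


section \<open>Iterated transitions and preparability\<close>

text \<open>Throughout, \<open>A\<close> and \<open>C\<close> are von Neumann algebras on the Hilbert spaces \<open>'h\<close> and \<open>'k\<close>.
  The recursion for the tensor powers of \<open>C\<close> starts with the scalars on the one-dimensional space
  \<open>powspace 0\<close>, so that the first tensor power is the copy \<open>1 \<otimes> C\<close> of \<open>C\<close>.\<close>

primrec alg_pow ::
  "('k::complex_inner \<Rightarrow> 'k) set \<Rightarrow> nat \<Rightarrow> ('k list ell2 \<Rightarrow> 'k list ell2) set" where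
  "alg_pow C 0 = bop (powspace 0)"
| "alg_pow C (Suc n) = vn_tensor tensor_pow (powspace n) UNIV (powspace (Suc n)) (alg_pow C n) C"

definition first_copy :: "('k::complex_inner \<Rightarrow> 'k) \<Rightarrow> 'k list ell2 \<Rightarrow> 'k list ell2" where
  "first_copy c = op_tensor tensor_pow (powspace 0) UNIV (powspace 1) (idop (powspace 0)) c"

definition sys_alg ::
  "('h::complex_inner \<Rightarrow> 'h) set \<Rightarrow> ('k::complex_inner \<Rightarrow> 'k) set \<Rightarrow> nat
    \<Rightarrow> (('h \<times> 'k list) ell2 \<Rightarrow> ('h \<times> 'k list) ell2) set" where
  "sys_alg A C n = vn_tensor tensor_sys UNIV (powspace n) (syspowspace n) A (alg_pow C n)"

definition sys_tensor ::
  "nat \<Rightarrow> ('h::complex_inner \<Rightarrow> 'h) \<Rightarrow> ('k::complex_inner list ell2 \<Rightarrow> 'k list ell2)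
    \<Rightarrow> ('h \<times> 'k list) ell2 \<Rightarrow> ('h \<times> 'k list) ell2" where
  "sys_tensor n a d = op_tensor tensor_sys UNIV (powspace n) (syspowspace n) a d"

definition transition ::
  "('h::complex_inner \<Rightarrow> 'h) set \<Rightarrow> ('k::complex_inner \<Rightarrow> 'k) set
    \<Rightarrow> (('h \<Rightarrow> 'h) \<Rightarrow> ('h \<times> 'k list) ell2 \<Rightarrow> ('h \<times> 'k list) ell2) \<Rightarrow> bool" where
  "transition A C J \<longleftrightarrow> normal_star_hom UNIV A (syspowspace 1) (sys_alg A C 1) J
     \<and> inj_on J A \<and> J (idop UNIV) = idop (syspowspace 1)"

text \<open>The map \<open>\<Phi> \<otimes> id\<close> for a normal star-homomorphism \<open>\<Phi> : A \<rightarrow> A \<otimes> C\<^sub>n\<close>; the choice operator only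
  selects the irrelevant values outside \<open>A \<otimes> C\<close>.\<close>

definition tensor_id ::
  "('h::complex_inner \<Rightarrow> 'h) set \<Rightarrow> ('k::complex_inner \<Rightarrow> 'k) set \<Rightarrow> nat
    \<Rightarrow> (('h \<Rightarrow> 'h) \<Rightarrow> ('h \<times> 'k list) ell2 \<Rightarrow> ('h \<times> 'k list) ell2)
    \<Rightarrow> (('h \<times> 'k list) ell2 \<Rightarrow> ('h \<times> 'k list) ell2) \<Rightarrow> ('h \<times> 'k list) ell2 \<Rightarrow> ('h \<times> 'k list) ell2"
  where
  "tensor_id A C n \<Phi> = (SOME \<Psi>.
     normal_star_hom (syspowspace 1) (sys_alg A C 1) (syspowspace (Suc n)) (sys_alg A C (Suc n)) \<Psi>
     \<and> (\<forall>a\<in>A. \<forall>c\<in>C. \<Psi> (sys_tensor 1 a (first_copy c)) =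
          op_tensor tensor_syspow (syspowspace n) UNIV (syspowspace (Suc n)) (\<Phi> a) c))"

fun iterate ::
  "('h::complex_inner \<Rightarrow> 'h) set \<Rightarrow> ('k::complex_inner \<Rightarrow> 'k) set
    \<Rightarrow> (('h \<Rightarrow> 'h) \<Rightarrow> ('h \<times> 'k list) ell2 \<Rightarrow> ('h \<times> 'k list) ell2) \<Rightarrow> nat
    \<Rightarrow> ('h \<Rightarrow> 'h) \<Rightarrow> ('h \<times> 'k list) ell2 \<Rightarrow> ('h \<times> 'k list) ell2" where
  "iterate A C J 0 = undefined"
| "iterate A C J (Suc 0) = J"
| "iterate A C J (Suc (Suc n)) = tensor_id A C (Suc n) (iterate A C J (Suc n)) \<circ> J"

text \<open>The product state on \<open>A \<otimes> C\<^sub>n\<close>, with irrelevant values outside of this algebra.\<close>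

definition product_state ::
  "('h::complex_inner \<Rightarrow> 'h) set \<Rightarrow> ('k::complex_inner \<Rightarrow> 'k) set \<Rightarrow> nat
    \<Rightarrow> (('h \<Rightarrow> 'h) \<Rightarrow> complex) \<Rightarrow> (('k list ell2 \<Rightarrow> 'k list ell2) \<Rightarrow> complex)
    \<Rightarrow> (('h \<times> 'k list) ell2 \<Rightarrow> ('h \<times> 'k list) ell2) \<Rightarrow> complex" where
  "product_state A C n \<sigma> \<theta> = (SOME \<omega>. normal_state (syspowspace n) (sys_alg A C n) \<omega>
     \<and> (\<forall>a\<in>A. \<forall>d\<in>alg_pow C n. \<omega> (sys_tensor n a d) = \<sigma> a * \<theta> d))"

text \<open>A sequence \<open>(\<theta>\<^sub>k)\<close> of functionals \<open>\<theta>\<^sub>k\<close> on \<open>C\<^sub>n\<close>, \<open>n = n\<^sub>k\<close>, is recorded as the pair of the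
  sequences \<open>(n\<^sub>k)\<close> and \<open>(\<theta>\<^sub>k)\<close>.\<close>

type_synonym 'k prep_seq = "(nat \<Rightarrow> nat) \<times> (nat \<Rightarrow> ('k list ell2 \<Rightarrow> 'k list ell2) \<Rightarrow> complex)"

definition preparing ::
  "('h::complex_inner \<Rightarrow> 'h) set \<Rightarrow> ('k::complex_inner \<Rightarrow> 'k) set
    \<Rightarrow> (('h \<Rightarrow> 'h) \<Rightarrow> ('h \<times> 'k list) ell2 \<Rightarrow> ('h \<times> 'k list) ell2)
    \<Rightarrow> (('h \<Rightarrow> 'h) \<Rightarrow> complex) \<Rightarrow> (('h \<Rightarrow> 'h) \<Rightarrow> complex) \<Rightarrow> 'k prep_seq \<Rightarrow> bool" where
  "preparing A C J \<sigma> \<rho> s \<longleftrightarrow>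
     (\<forall>k. fst s k \<ge> 1 \<and> normal_state (powspace (fst s k)) (alg_pow C (fst s k)) (snd s k))
     \<and> (\<forall>a\<in>A. (\<lambda>k. product_state A C (fst s k) \<sigma> (snd s k) (iterate A C J (fst s k) a))
          \<longlonglongrightarrow> \<rho> a)"

definition universally_preparing ::
  "('h::complex_inner \<Rightarrow> 'h) set \<Rightarrow> ('k::complex_inner \<Rightarrow> 'k) set
    \<Rightarrow> (('h \<Rightarrow> 'h) \<Rightarrow> ('h \<times> 'k list) ell2 \<Rightarrow> ('h \<times> 'k list) ell2)
    \<Rightarrow> (('h \<Rightarrow> 'h) \<Rightarrow> complex) \<Rightarrow> 'k prep_seq \<Rightarrow> bool" where
  "universally_preparing A C J \<rho> s \<longleftrightarrow>
     (\<forall>\<sigma>. normal_state UNIV A \<sigma> \<longrightarrow> preparing A C J \<sigma> \<rho> s)"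

definition compatible :: "'k prep_seq \<Rightarrow> 'k prep_seq \<Rightarrow> bool" where
  "compatible s s' \<longleftrightarrow> (\<forall>k. fst s k = fst s' k)"

end

theory Submission
  imports Defs
begin

text \<open>Let \<open>\<theta>\<^sub>k\<close> prepare the vector state of \<open>\<xi>\<close> from the faithful state \<open>\<phi> = \<Sum>\<^sub>m \<omega>\<^sub>z\<^sub>m\<close>, and let
  \<open>p = |\<xi>\<rangle>\<langle>\<xi>|\<close>. Then \<open>(\<phi> \<otimes> \<theta>\<^sub>k) J\<^sub>n (1 - p) \<rightarrow> 0\<close>, so the vectors \<open>u\<close> with
  \<open>(\<omega>\<^sub>u \<otimes> \<theta>\<^sub>k) J\<^sub>n (1 - p) \<rightarrow> 0\<close>, which form a closed subspace, include all \<open>z\<^sub>m\<close>; as \<open>\<phi>\<close> is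
  faithful, these are total, so the limit holds for every \<open>u\<close>. By the Cauchy-Schwarz inequality
  \<open>(\<omega>\<^sub>u \<otimes> \<theta>\<^sub>k) J\<^sub>n\<close> then converges to the vector state of \<open>\<xi>\<close> for every unit vector \<open>u\<close>, and by
  dominated convergence so does \<open>(\<sigma> \<otimes> \<theta>\<^sub>k) J\<^sub>n\<close> for every normal state \<open>\<sigma>\<close>. For a normal state
  \<open>\<rho> = \<Sum>\<^sub>j \<mu>\<^sub>j \<omega>\<^sub>\<xi>\<^sub>j\<close> one mixes the preparing states of the first \<open>k\<close> vectors \<open>\<xi>\<^sub>j\<close> at step \<open>k\<close>; this
  is where compatibility is used, and mixing only finitely many keeps the mixture normal.

  Normal states on \<open>B(H)\<close> are written as sums of vector functionals by a Cholesky decomposition of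
  the form \<open>\<omega> |y\<rangle>\<langle>x|\<close>, which avoids the spectral theorem. Since \<open>A = B(H)\<close>, product states are
  determined by matrix entries, and a normal unital representation \<open>\<Phi>\<close> of \<open>A\<close> is an amplification
  \<open>a \<mapsto> a \<otimes> 1\<close>, which makes \<open>\<Phi> \<otimes> id\<close> one as well.\<close>

section \<open>Hilbert space preliminaries\<close>

text \<open>\<open>product_state\<close> and \<open>tensor_id\<close> are made by choice operators,
  so nothing is known about them before a witness is built. The chosen product state must also be
  identified, because its values occur in the hypothesis; this takes uniqueness on A \<otimes> C_n.
  For \<open>tensor_id\<close> a witness suffices: all that the convergence argument needs to know
  about the iterates is that they are unital normal star-homomorphisms. The vectors u in question
  form a closed subspace because (\<omega>_u \<otimes> \<theta>_k) J_n (1 - p) is a quadratic form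
  in u, bounded by the squared norm of u uniformly in k. Totality of the z_m holds because \<phi>
  would vanish at the positive rank-one operator of a nonzero vector orthogonal to all of them. The
  Cauchy-Schwarz step is an explicit estimate: \<omega> a differs from \<omega> 1 times the vector
  state of \<xi> at a by at most 3 M sqrt (\<omega> 1) sqrt (\<omega> (1 - p)) if M bounds a. A
  finite mixture has total weight below 1 in general; the missing weight, which tends to 0, goes to
  the preparing state of one fixed unit vector.\<close>

lemma norm_scaleC: "norm (c *\<^sub>C x) = cmod c * norm (x :: 'a::complex_inner)"
proof -
  have "complex_of_real ((norm (c *\<^sub>C x))\<^sup>2) = of_real ((cmod c * norm x)\<^sup>2)"
    unfolding cinner_same[symmetric] cinner_scaleC_left cinner_scaleC_right
    by (simp add: cinner_same power_mult_distrib complex_norm_square mult_ac flip: of_real_power)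
  then have "(norm (c *\<^sub>C x))\<^sup>2 = (cmod c * norm x)\<^sup>2" by (simp only: of_real_eq_iff)
  then show ?thesis by (simp add: power2_eq_iff_nonneg)
qed

lemma scaleC_zero_left [simp]: "0 *\<^sub>C x = (0 :: 'a::complex_inner)"
  using norm_scaleC[of 0 x] by simp

lemma scaleC_zero_right [simp]: "c *\<^sub>C (0 :: 'a::complex_inner) = 0"
  using norm_scaleC[of c "0::'a"] by simp

lemma norm_eq_cinner: "(norm x)\<^sup>2 = Re (cinner x (x :: 'a::complex_inner))"
  by (simp add: cinner_same)

lemma cinner_eq_zero_iff: "cinner x x = 0 \<longleftrightarrow> x = (0 :: 'a::complex_inner)"
  by (simp add: cinner_same)

lemma norm_add_sq: "(norm (x + y))\<^sup>2 = (norm x)\<^sup>2 + (norm y)\<^sup>2 + 2 * Re (cinner x (y :: 'a::complex_inner))"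
  using cinner_commute[of y x]
  by (simp add: norm_eq_cinner cinner_add_left cinner_add_right)

lemma norm_diff_sq: "(norm (x - y))\<^sup>2 = (norm x)\<^sup>2 + (norm y)\<^sup>2 - 2 * Re (cinner x (y :: 'a::complex_inner))"
  using cinner_commute[of y x]
  by (simp add: norm_eq_cinner cinner_diff_left cinner_diff_right)

text \<open>Bessel's inequality for the one-element family consisting of the normalised x.\<close>

lemma Cauchy_Schwarz: "cmod (cinner x y) \<le> norm x * norm (y :: 'a::complex_inner)"
proof (cases "x = 0")
  case False
  define u where "u = of_real (inverse (norm x)) *\<^sub>C x"
  have "cinner u u = 1"
    unfolding u_def cinner_scaleC_left cinner_scaleC_right cinner_same[of x]
    using False by (simp add: power2_eq_square field_simps)
  then have "orthonormal {u}" by (simp add: orthonormal_def)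
  from Bessel_finite[OF _ this, of y] have "(cmod (cinner u y))\<^sup>2 \<le> (norm y)\<^sup>2" by simp
  then have "cmod (cinner u y) \<le> norm y" by (simp add: power2_le_iff_abs_le)
  moreover have "cmod (cinner u y) = cmod (cinner x y) / norm x"
    by (simp add: u_def cinner_scaleC_left norm_mult divide_inverse mult.commute norm_inverse)
  ultimately show ?thesis using False by (simp add: field_simps)
qed simp

lemma bounded_bilinear_cinner: "bounded_bilinear (cinner :: 'a::complex_inner \<Rightarrow> 'a \<Rightarrow> complex)"
proof
  show "\<exists>K. \<forall>a b::'a. cmod (cinner a b) \<le> norm a * norm b * K"
    by (intro exI[of _ 1]) (simp add: Cauchy_Schwarz)
qed (auto simp: cinner_add_left cinner_add_right scaleR_scaleC cinner_scaleC_left cinner_scaleC_right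
    scaleR_conv_of_real)

lemmas tendsto_cinner [tendsto_intros] = bounded_bilinear.tendsto[OF bounded_bilinear_cinner]

text \<open>Taking t to be a real multiple s of \<open>cnj b\<close> turns the hypothesis into a
  real quadratic polynomial in s without negative values.\<close>

lemma psd_discriminant:
  fixes b :: complex and A D :: real
  assumes "\<And>t. 0 \<le> A + 2 * Re (t * b) + (cmod t)\<^sup>2 * D" and "0 \<le> A" "0 \<le> D"
  shows "(cmod b)\<^sup>2 \<le> A * D"
proof (cases "b = 0")
  case False
  have *: "0 \<le> A + 2 * s * (cmod b)\<^sup>2 + s\<^sup>2 * (cmod b)\<^sup>2 * D" for s
  proof -
    have "Re (of_real s * cnj b * b) = s * (cmod b)\<^sup>2"
      by (simp only: cmod_power2) (simp add: power2_eq_square algebra_simps)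
    then show ?thesis using assms(1)[of "of_real s * cnj b"]
      by (simp add: norm_mult power_mult_distrib)
  qed
  have b: "(cmod b)\<^sup>2 > 0" using False by simp
  show ?thesis
  proof (cases "D = 0")
    case True
    \<comment> \<open>For D = 0 the polynomial is affine in s, and this s gives it the value - A - 2
      < 0.\<close>
    have "- (A + 1) / (cmod b)\<^sup>2 * (cmod b)\<^sup>2 = - (A + 1)" using b by simp
    then have "A + 2 * (- (A + 1) / (cmod b)\<^sup>2) * (cmod b)\<^sup>2 = - A - 2" by linarith
    with *[of "- (A + 1) / (cmod b)\<^sup>2"] True assms(2) show ?thesis by simp
  next
    case D: False
    \<comment> \<open>s = - 1 / D is the minimum point.\<close>
    have "A + 2 * (- 1 / D) * (cmod b)\<^sup>2 + (- 1 / D)\<^sup>2 * (cmod b)\<^sup>2 * D = A - (cmod b)\<^sup>2 / D"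
      using D by (simp add: power2_eq_square)
    with *[of "- 1 / D"] have "(cmod b)\<^sup>2 / D \<le> A" by linarith
    then show ?thesis using D assms(3) by (simp add: pos_divide_le_eq)
  qed
qed (use assms in simp)

subsection \<open>Closed subspaces and the Riesz theorem\<close>

text \<open>The tensor powers are closed subspaces of a single type and the multiplicity spaces
  depend on a homomorphism, so Hilbert space theory is developed relative to a carrier set instead
  of a type.\<close>

definition hsub :: "'a::complex_inner set \<Rightarrow> bool" where
  "hsub S \<longleftrightarrow> 0 \<in> S \<and> (\<forall>x\<in>S. \<forall>y\<in>S. x + y \<in> S) \<and> (\<forall>c. \<forall>x\<in>S. c *\<^sub>C x \<in> S) \<and> closed S"

lemma hsub_UNIV [simp]: "hsub UNIV"
  by (simp add: hsub_def)

context
  fixes S :: "'a::complex_inner set"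
  assumes S: "hsub S"
begin

lemma hsub_zero: "0 \<in> S" using S by (simp add: hsub_def)
lemma hsub_add: "x \<in> S \<Longrightarrow> y \<in> S \<Longrightarrow> x + y \<in> S" using S by (simp add: hsub_def)
lemma hsub_scale: "x \<in> S \<Longrightarrow> c *\<^sub>C x \<in> S" using S by (simp add: hsub_def)
lemma hsub_minus: "x \<in> S \<Longrightarrow> - x \<in> S" using hsub_scale[of x "-1"] by (simp add: scaleC_minus1)
lemma hsub_diff: "x \<in> S \<Longrightarrow> y \<in> S \<Longrightarrow> x - y \<in> S"
  using hsub_add[of x "- y"] hsub_minus by simp
lemma hsub_lim: "(\<And>n. X n \<in> S) \<Longrightarrow> X \<longlonglongrightarrow> l \<Longrightarrow> l \<in> S"
  using S unfolding hsub_def closed_sequential_limits by blast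

end

text \<open>By the parallelogram law a minimising sequence is Cauchy: the midpoint of two of its
  members has squared norm at least D, so their distance is small. Closure under midpoints replaces
  convexity.\<close>

lemma min_norm_exists:
  fixes C :: "'a::hilbert_space set"
  assumes "C \<noteq> {}" "closed C" and mid: "\<And>x y. x \<in> C \<Longrightarrow> y \<in> C \<Longrightarrow> (1/2) *\<^sub>R (x + y) \<in> C"
  shows "\<exists>x\<in>C. \<forall>y\<in>C. norm x \<le> norm y"
proof -
  define D where "D = (INF x\<in>C. (norm x)\<^sup>2)"
  have bdd: "bdd_below ((\<lambda>x. (norm x)\<^sup>2) ` C)" by (intro bdd_belowI[of _ 0]) auto
  have D: "D \<le> (norm x)\<^sup>2" if "x \<in> C" for x
    unfolding D_def by (rule cINF_lower[OF bdd that])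
  have "\<exists>x\<in>C. (norm x)\<^sup>2 < D + inverse (real (Suc n))" for n
    using cINF_less_iff[OF assms(1) bdd, of "D + inverse (real (Suc n))"] D_def by fastforce
  then obtain X where X: "\<And>n. X n \<in> C" "\<And>n. (norm (X n))\<^sup>2 < D + inverse (real (Suc n))"
    by metis
  have dif: "(norm (X m - X n))\<^sup>2 \<le> 2 * inverse (real (Suc m)) + 2 * inverse (real (Suc n))" for m n
  proof -
    have "D \<le> (norm ((1/2) *\<^sub>R (X m + X n)))\<^sup>2" by (rule D, rule mid) (auto simp: X)
    also have "\<dots> = (norm (X m + X n))\<^sup>2 / 4" by (simp add: power2_eq_square)
    finally have "4 * D \<le> (norm (X m + X n))\<^sup>2" by simp
    then show ?thesis using X(2)[of m] X(2)[of n]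
      unfolding norm_add_sq norm_diff_sq by linarith
  qed
  have "Cauchy X"
  proof (rule CauchyI)
    fix e :: real assume e: "0 < e"
    obtain N where N: "inverse (real (Suc N)) < e\<^sup>2 / 4"
      using reals_Archimedean[of "e\<^sup>2 / 4"] e by auto
    show "\<exists>M. \<forall>m\<ge>M. \<forall>n\<ge>M. norm (X m - X n) < e"
    proof (intro exI allI impI)
      fix m n assume "N \<le> m" "N \<le> n"
      then have "inverse (real (Suc m)) \<le> inverse (real (Suc N))"
          "inverse (real (Suc n)) \<le> inverse (real (Suc N))" by (auto intro!: le_imp_inverse_le)
      with dif[of m n] N have "(norm (X m - X n))\<^sup>2 < e\<^sup>2" by linarith
      then show "norm (X m - X n) < e" using e by (simp add: power_less_imp_less_base)
    qed
  qed
  then obtain l where l: "X \<longlonglongrightarrow> l" by (auto simp: Cauchy_convergent_iff convergent_def)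
  then have lC: "l \<in> C" using assms(2) X(1) unfolding closed_sequential_limits by blast
  have "(norm l)\<^sup>2 \<le> D + 0"
  proof (rule LIMSEQ_le)
    show "(\<lambda>n. (norm (X n))\<^sup>2) \<longlonglongrightarrow> (norm l)\<^sup>2" by (intro tendsto_intros l)
    show "(\<lambda>n. D + inverse (real (Suc n))) \<longlonglongrightarrow> D + 0"
      by (intro tendsto_add tendsto_const LIMSEQ_inverse_real_of_nat)
  qed (use X(2) less_imp_le in blast)
  then have l: "(norm l)\<^sup>2 \<le> D" by simp
  have "norm l \<le> norm y" if "y \<in> C" for y
    by (rule power2_le_imp_le[OF order_trans[OF l D[OF that]]]) auto
  with lC show ?thesis by blast
qed

lemma orthogonal_if_min:
  fixes x y :: "'a::complex_inner"
  assumes "\<And>t. norm x \<le> norm (x + t *\<^sub>C y)"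
  shows "cinner x y = 0"
proof -
  have "(cmod (cinner x y))\<^sup>2 \<le> 0 * (norm y)\<^sup>2"
  proof (rule psd_discriminant)
    fix t
    have "(norm x)\<^sup>2 \<le> (norm (x + t *\<^sub>C y))\<^sup>2" by (rule power_mono[OF assms]) simp
    then show "0 \<le> 0 + 2 * Re (t * cinner x y) + (cmod t)\<^sup>2 * (norm y)\<^sup>2"
      unfolding norm_add_sq by (simp add: cinner_scaleC_right norm_scaleC power_mult_distrib)
  qed auto
  then show ?thesis by simp
qed

text \<open>The vector of least norm in the affine set f = 1 is orthogonal to the kernel of f, hence
  a scalar multiple of it represents f.\<close>

lemma riesz:
  fixes S :: "'a::hilbert_space set"
  assumes S: "hsub S"
    and add: "\<And>x y. x \<in> S \<Longrightarrow> y \<in> S \<Longrightarrow> f (x + y) = f x + f y"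
    and scale: "\<And>c x. x \<in> S \<Longrightarrow> f (c *\<^sub>C x) = c * f x"
    and bound: "\<And>x. x \<in> S \<Longrightarrow> cmod (f x) \<le> M * norm x"
  shows "\<exists>z\<in>S. \<forall>x\<in>S. f x = cinner z x"
proof (cases "\<forall>x\<in>S. f x = 0")
  case True
  then show ?thesis by (intro bexI[of _ 0] hsub_zero S) auto
next
  case False
  then obtain x1 where x1: "x1 \<in> S" "f x1 \<noteq> 0" by blast
  have diff: "f (x - y) = f x - f y" if "x \<in> S" "y \<in> S" for x y
    using add[of x "- y"] scale[of y "-1"] that hsub_minus[OF S] by (simp add: scaleC_minus1)
  define C where "C = {x\<in>S. f x = 1}"
  have "\<exists>x\<in>C. \<forall>y\<in>C. norm x \<le> norm y"
  proof (rule min_norm_exists)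
    have "inverse (f x1) *\<^sub>C x1 \<in> C" using x1 by (simp add: C_def scale hsub_scale[OF S])
    then show "C \<noteq> {}" by blast
    show "closed C" unfolding closed_sequential_limits
    proof safe
      fix X l assume X: "\<forall>n. X n \<in> C" "X \<longlonglongrightarrow> l"
      have XS: "X n \<in> S" for n using X(1) by (simp add: C_def)
      have lS: "l \<in> S" by (rule hsub_lim[OF S XS X(2)])
      have "(\<lambda>n. M * norm (l - X n)) \<longlonglongrightarrow> M * norm (l - l)" by (intro tendsto_intros X)
      then have lim: "(\<lambda>n. M * norm (l - X n)) \<longlonglongrightarrow> 0" by simp
      have "cmod (f l - 1) \<le> M * norm (l - X n)" for n
        using bound[of "l - X n"] diff[OF lS XS] X(1) hsub_diff[OF S lS XS] by (simp add: C_def)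
      then have "cmod (f l - 1) \<le> 0" using lim by (intro LIMSEQ_le_const) auto
      then show "l \<in> C" using lS by (simp add: C_def)
    qed
    fix x y assume "x \<in> C" "y \<in> C"
    then show "(1/2) *\<^sub>R (x + y) \<in> C"
      unfolding C_def scaleR_scaleC by (auto simp: scale add hsub_add[OF S] hsub_scale[OF S])
  qed
  then obtain x0 where x0: "x0 \<in> S" "f x0 = 1" and mn: "\<And>y. y \<in> S \<Longrightarrow> f y = 1 \<Longrightarrow> norm x0 \<le> norm y"
    unfolding C_def by blast
  have orth: "cinner x0 y = 0" if "y \<in> S" "f y = 0" for y
    by (rule orthogonal_if_min, rule mn) (use that x0 S in \<open>auto simp: hsub_add hsub_scale add scale\<close>)
  have nz: "cinner x0 x0 \<noteq> 0"
  proof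
    assume "cinner x0 x0 = 0"
    then have "x0 = 0" by (simp add: cinner_eq_zero_iff)
    with bound[OF x0(1)] x0(2) show False by simp
  qed
  show ?thesis
  proof (intro bexI ballI)
    fix x assume x: "x \<in> S"
    have "cinner x0 (x - f x *\<^sub>C x0) = 0"
      by (rule orth) (use x x0 S in \<open>auto simp: hsub_diff hsub_scale diff scale\<close>)
    then have "cinner x0 x = f x * cinner x0 x0"
      by (simp add: cinner_diff_right cinner_scaleC_right)
    then show "f x = cinner (inverse (cnj (cinner x0 x0)) *\<^sub>C x0) x"
      using nz by (simp add: cinner_scaleC_left)
  qed (rule hsub_scale[OF S x0(1)])
qed

text \<open>The projection theorem by way of Riesz: restricting the functional of y to G gives z in
  G with y - z orthogonal to G.\<close>

lemma hsub_eq_UNIV: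
  fixes G :: "'a::hilbert_space set"
  assumes G: "hsub G" and "\<And>x. (\<And>g. g \<in> G \<Longrightarrow> cinner g x = 0) \<Longrightarrow> x = 0"
  shows "G = UNIV"
proof -
  have "y \<in> G" for y
  proof -
    obtain z where z: "z \<in> G" "\<And>x. x \<in> G \<Longrightarrow> cinner y x = cinner z x"
      using riesz[OF G, of "cinner y" "norm y"]
      by (auto simp: cinner_add_right cinner_scaleC_right Cauchy_Schwarz)
    have "cinner g (y - z) = 0" if "g \<in> G" for g
      using z(2)[OF that] cinner_commute[of g] by (simp add: cinner_diff_right)
    then have "y - z = 0" by (rule assms(2))
    then show ?thesis using z(1) by simp
  qed
  then show ?thesis by blast
qed

subsection \<open>Bounded maps between closed subspaces\<close>

text \<open>Values outside S are left free, in contrast to \<open>bop\<close>, so that maps between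
  different spaces and maps obtained by choice qualify without truncation; \<open>res\<close>
  truncates when an element of \<open>bop S\<close> is wanted.\<close>

definition bmap :: "'a::complex_inner set \<Rightarrow> 'b::complex_inner set \<Rightarrow> ('a \<Rightarrow> 'b) set" where
  "bmap S T = {a. (\<forall>x\<in>S. a x \<in> T)
     \<and> (\<forall>x\<in>S. \<forall>y\<in>S. a (x + y) = a x + a y) \<and> (\<forall>c. \<forall>x\<in>S. a (c *\<^sub>C x) = c *\<^sub>C a x)
     \<and> (\<exists>M. \<forall>x\<in>S. norm (a x) \<le> M * norm x)}"

lemma bmapI:
  assumes "\<And>x. x \<in> S \<Longrightarrow> a x \<in> T" "\<And>x y. x \<in> S \<Longrightarrow> y \<in> S \<Longrightarrow> a (x + y) = a x + a y"
    "\<And>c x. x \<in> S \<Longrightarrow> a (c *\<^sub>C x) = c *\<^sub>C a x" "\<And>x. x \<in> S \<Longrightarrow> norm (a x) \<le> M * norm x"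
  shows "a \<in> bmap S T"
  using assms unfolding bmap_def by blast

lemma
  assumes "a \<in> bmap S T"
  shows bmap_in: "x \<in> S \<Longrightarrow> a x \<in> T"
    and bmap_add: "x \<in> S \<Longrightarrow> y \<in> S \<Longrightarrow> a (x + y) = a x + a y"
    and bmap_scale: "x \<in> S \<Longrightarrow> a (c *\<^sub>C x) = c *\<^sub>C a x"
  using assms unfolding bmap_def by auto

lemma bmap_bound:
  assumes "a \<in> bmap S T"
  obtains M where "M \<ge> 0" "\<And>x. x \<in> S \<Longrightarrow> norm (a x) \<le> M * norm x"
proof -
  obtain M where M: "\<And>x. x \<in> S \<Longrightarrow> norm (a x) \<le> M * norm x"
    using assms unfolding bmap_def by blast
  show ?thesis
  proof (rule that)
    fix x assume "x \<in> S"
    from M[OF this] show "norm (a x) \<le> \<bar>M\<bar> * norm x"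
      by (rule order_trans) (intro mult_right_mono abs_ge_self norm_ge_zero)
  qed simp
qed

lemma bop_bmap: "a \<in> bop S \<Longrightarrow> a \<in> bmap S S"
  unfolding bop_def bmap_def by auto

lemma bop_outside: "a \<in> bop S \<Longrightarrow> x \<notin> S \<Longrightarrow> a x = 0"
  unfolding bop_def by auto

lemmas bop_in = bmap_in[OF bop_bmap]
  and bop_add = bmap_add[OF bop_bmap]
  and bop_scale = bmap_scale[OF bop_bmap]

lemma bop_iff: "a \<in> bop S \<longleftrightarrow> a \<in> bmap S S \<and> (\<forall>x. x \<notin> S \<longrightarrow> a x = 0)"
  unfolding bop_def bmap_def by blast

lemma bop_UNIV_iff: "a \<in> bop UNIV \<longleftrightarrow> a \<in> bmap UNIV UNIV"
  by (simp add: bop_iff)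

definition res :: "'a::complex_inner set \<Rightarrow> ('a \<Rightarrow> 'a) \<Rightarrow> 'a \<Rightarrow> 'a" where
  "res S f = (\<lambda>x. if x \<in> S then f x else 0)"

lemma res_bop: assumes "hsub S" "f \<in> bmap S S" shows "res S f \<in> bop S"
  using assms unfolding bop_def bmap_def res_def hsub_def by auto

lemma res_apply: "x \<in> S \<Longrightarrow> res S f x = f x"
  by (simp add: res_def)

lemma bmap_diff:
  assumes "hsub S" "a \<in> bmap S T" "x \<in> S" "y \<in> S" shows "a (x - y) = a x - a y"
  using bmap_add[OF assms(2) hsub_diff[OF assms(1,3,4)] assms(4)] by simp

lemma bmap_zero: assumes "hsub S" "a \<in> bmap S T" shows "a 0 = 0"
  using bmap_diff[OF assms hsub_zero[OF assms(1)] hsub_zero[OF assms(1)]] by simp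

lemma bmap_comp:
  assumes a: "a \<in> bmap S T" and b: "b \<in> bmap T U" shows "b \<circ> a \<in> bmap S U"
proof -
  obtain M where M: "M \<ge> 0" "\<And>x. x \<in> S \<Longrightarrow> norm (a x) \<le> M * norm x" by (rule bmap_bound[OF a]) blast
  obtain N where N: "N \<ge> 0" "\<And>x. x \<in> T \<Longrightarrow> norm (b x) \<le> N * norm x" by (rule bmap_bound[OF b]) blast
  show ?thesis
  proof (rule bmapI)
    fix x assume x: "x \<in> S"
    have "norm (b (a x)) \<le> N * norm (a x)" by (rule N(2)[OF bmap_in[OF a x]])
    also have "\<dots> \<le> N * (M * norm x)" by (rule mult_left_mono[OF M(2)[OF x] N(1)])
    finally show "norm ((b \<circ> a) x) \<le> (N * M) * norm x" by (simp add: mult.assoc)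
  qed (auto simp: bmap_in[OF a] bmap_add[OF a] bmap_scale[OF a] bmap_in[OF b] bmap_add[OF b] bmap_scale[OF b])
qed

lemma bop_comp: assumes "hsub S" "a \<in> bop S" "b \<in> bop S" shows "a \<circ> b \<in> bop S"
  using bmap_comp[OF bop_bmap[OF assms(3)] bop_bmap[OF assms(2)]] bmap_zero[OF assms(1) bop_bmap[OF assms(2)]]
  by (auto simp: bop_iff bop_outside[OF assms(3)])

lemma bmap_plus:
  assumes T: "hsub T" and a: "a \<in> bmap S T" and b: "b \<in> bmap S T"
  shows "(\<lambda>x. a x + b x) \<in> bmap S T"
proof -
  obtain M where M: "M \<ge> 0" "\<And>x. x \<in> S \<Longrightarrow> norm (a x) \<le> M * norm x" by (rule bmap_bound[OF a]) blast
  obtain N where N: "N \<ge> 0" "\<And>x. x \<in> S \<Longrightarrow> norm (b x) \<le> N * norm x" by (rule bmap_bound[OF b]) blast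
  show ?thesis
  proof (rule bmapI)
    fix x assume x: "x \<in> S"
    show "norm (a x + b x) \<le> (M + N) * norm x"
      using norm_triangle_ineq[of "a x" "b x"] M(2)[OF x] N(2)[OF x] by (simp add: algebra_simps)
  qed (auto simp: bmap_in[OF a] bmap_add[OF a] bmap_scale[OF a] bmap_in[OF b] bmap_add[OF b]
      bmap_scale[OF b] hsub_add[OF T] scaleC_add_right)
qed

lemma bmap_scaled:
  assumes T: "hsub T" and a: "a \<in> bmap S T"
  shows "(\<lambda>x. c *\<^sub>C a x) \<in> bmap S T"
proof -
  obtain M where M: "M \<ge> 0" "\<And>x. x \<in> S \<Longrightarrow> norm (a x) \<le> M * norm x" by (rule bmap_bound[OF a]) blast
  show ?thesis
  proof (rule bmapI)
    fix x assume x: "x \<in> S"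
    show "norm (c *\<^sub>C a x) \<le> (cmod c * M) * norm x"
      using mult_left_mono[OF M(2)[OF x], of "cmod c"] by (simp add: norm_scaleC mult.assoc)
  qed (auto simp: bmap_in[OF a] bmap_add[OF a] bmap_scale[OF a] hsub_scale[OF T]
      scaleC_add_right scaleC_scaleC mult.commute)
qed

lemma bop_plus: "hsub S \<Longrightarrow> a \<in> bop S \<Longrightarrow> b \<in> bop S \<Longrightarrow> (\<lambda>x. a x + b x) \<in> bop S"
  by (auto simp: bop_iff bmap_plus)

lemma bop_scaled: "hsub S \<Longrightarrow> a \<in> bop S \<Longrightarrow> (\<lambda>x. c *\<^sub>C a x) \<in> bop S"
  by (auto simp: bop_iff bmap_scaled)

lemma bop_idop: "hsub S \<Longrightarrow> idop S \<in> bop S"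
  by (auto simp: bop_def idop_def hsub_def intro: exI[of _ 1])

lemma bop_eqI:
  assumes "hsub S" "a \<in> bop S" "b \<in> bop S" "\<And>x y. x \<in> S \<Longrightarrow> y \<in> S \<Longrightarrow> cinner x (a y) = cinner x (b y)"
  shows "a = b"
proof
  fix y
  show "a y = b y"
  proof (cases "y \<in> S")
    case True
    have "a y - b y \<in> S" using True assms by (intro hsub_diff) (auto simp: bop_in)
    from assms(4)[OF this True] have "cinner (a y - b y) (a y - b y) = 0"
      by (simp add: cinner_diff_right)
    then show ?thesis by (simp add: cinner_eq_zero_iff)
  qed (use assms in \<open>simp add: bop_outside\<close>)
qed

text \<open>Riesz applied for every fixed x. Operators without a formula are obtained in this way:
  adjoints, the maps 1 \<otimes> b, and the operator that proves Parseval's identity.\<close>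

lemma form_operator:
  fixes S :: "'a::complex_inner set" and T :: "'b::hilbert_space set"
  assumes T: "hsub T"
    and "\<And>y x x'. y \<in> T \<Longrightarrow> x \<in> S \<Longrightarrow> x' \<in> S \<Longrightarrow> B y (x + x') = B y x + B y x'"
    and "\<And>y x c. y \<in> T \<Longrightarrow> x \<in> S \<Longrightarrow> B y (c *\<^sub>C x) = c * B y x"
    and "\<And>y y' x. y \<in> T \<Longrightarrow> y' \<in> T \<Longrightarrow> x \<in> S \<Longrightarrow> B (y + y') x = B y x + B y' x"
    and "\<And>y x c. y \<in> T \<Longrightarrow> x \<in> S \<Longrightarrow> B (c *\<^sub>C y) x = cnj c * B y x"
    and bound: "\<And>y x. y \<in> T \<Longrightarrow> x \<in> S \<Longrightarrow> cmod (B y x) \<le> M * norm y * norm x"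
    and S: "hsub S"
  shows "\<exists>f\<in>bmap S T. \<forall>y\<in>T. \<forall>x\<in>S. cinner y (f x) = B y x"
proof -
  have "\<exists>z\<in>T. \<forall>y\<in>T. cnj (B y x) = cinner z y" if "x \<in> S" for x
    by (rule riesz[OF T, where M = "M * norm x"]) (use assms that in \<open>auto simp: mult_ac\<close>)
  then obtain f where fT: "\<And>x. x \<in> S \<Longrightarrow> f x \<in> T"
    and "\<And>x y. x \<in> S \<Longrightarrow> y \<in> T \<Longrightarrow> cnj (B y x) = cinner (f x) y" by metis
  then have f: "cinner y (f x) = B y x" if "x \<in> S" "y \<in> T" for x y
    using that by (metis cinner_commute complex_cnj_cnj)
  have eqI: "u = v" if "u \<in> T" "v \<in> T" "\<And>y. y \<in> T \<Longrightarrow> cinner y u = cinner y v" for u v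
  proof -
    have "cinner (u - v) (u - v) = 0"
      using that(3)[OF hsub_diff[OF T that(1,2)]] by (simp add: cinner_diff_right)
    then show ?thesis by (simp add: cinner_eq_zero_iff)
  qed
  have "f \<in> bmap S T"
  proof (rule bmapI)
    fix x x' assume "x \<in> S" "x' \<in> S"
    then show "f (x + x') = f x + f x'"
      using assms S T by (intro eqI) (auto simp: f fT hsub_add cinner_add_right)
  next
    fix x c assume "x \<in> S"
    then show "f (c *\<^sub>C x) = c *\<^sub>C f x"
      using assms S T by (intro eqI) (auto simp: f fT hsub_scale cinner_scaleC_right)
  next
    fix x assume x: "x \<in> S"
    \<comment> \<open>Testing the form at y = f x bounds f. The absolute value of M appears because
      no sign of M is assumed.\<close>
    have "norm (f x) * norm (f x) = cmod (B (f x) x)"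
      unfolding f[OF x fT[OF x], symmetric] cinner_same by (simp add: power2_eq_square norm_mult)
    also have "\<dots> \<le> \<bar>M\<bar> * norm (f x) * norm x"
      by (rule order_trans[OF bound[OF fT[OF x] x]]) (intro mult_right_mono abs_ge_self norm_ge_zero)
    finally show "norm (f x) \<le> \<bar>M\<bar> * norm x"
      by (cases "norm (f x) = 0") (auto simp: mult_ac)
  qed (rule fT)
  with f show ?thesis by blast
qed

lemma bmap_adjoint:
  fixes S :: "'a::hilbert_space set" and T :: "'b::hilbert_space set"
  assumes "hsub S" "hsub T" "a \<in> bmap S T"
  shows "\<exists>b\<in>bmap T S. \<forall>x\<in>S. \<forall>y\<in>T. cinner x (b y) = cinner (a x) y"
proof -
  obtain M where M: "M \<ge> 0" "\<And>x. x \<in> S \<Longrightarrow> norm (a x) \<le> M * norm x"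
    by (rule bmap_bound[OF assms(3)]) blast
  show ?thesis
  proof (rule form_operator[where M = M])
    fix x y assume x: "x \<in> S"
    have "cmod (cinner (a x) y) \<le> norm (a x) * norm y" by (rule Cauchy_Schwarz)
    also have "\<dots> \<le> M * norm x * norm y" by (intro mult_right_mono M x) simp
    finally show "cmod (cinner (a x) y) \<le> M * norm x * norm y" .
  qed (use assms in \<open>auto simp: cinner_add_right cinner_scaleC_right bmap_add[OF assms(3)]
      bmap_scale[OF assms(3)] cinner_add_left cinner_scaleC_left\<close>)
qed

lemma adj_unique:
  assumes "hsub S" "b \<in> bop S" "\<And>x y. x \<in> S \<Longrightarrow> y \<in> S \<Longrightarrow> cinner (b x) y = cinner x (a y)"
  shows "adj S a = b"
  unfolding adj_def
proof (rule the_equality)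
  fix c assume c: "c \<in> bop S \<and> (\<forall>x\<in>S. \<forall>y\<in>S. cinner (c x) y = cinner x (a y))"
  show "c = b"
  proof (rule bop_eqI[OF assms(1) _ assms(2)])
    fix x y assume "x \<in> S" "y \<in> S"
    then have "cinner (c y) x = cinner (b y) x" using c assms(3) by simp
    then show "cinner x (c y) = cinner x (b y)" by (metis cinner_commute)
  qed (use c in simp)
qed (use assms in auto)

context
  fixes S :: "'a::hilbert_space set"
  assumes S: "hsub S"
begin

lemma adj_bop_and_cinner:
  assumes "a \<in> bop S"
  shows "adj S a \<in> bop S \<and> (\<forall>x\<in>S. \<forall>y\<in>S. cinner (adj S a x) y = cinner x (a y))"
proof -
  obtain b where b: "b \<in> bmap S S" "\<And>x y. x \<in> S \<Longrightarrow> y \<in> S \<Longrightarrow> cinner x (b y) = cinner (a x) y"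
    using bmap_adjoint[OF S S bop_bmap[OF assms]] by blast
  have "cinner (res S b x) y = cinner x (a y)" if "x \<in> S" "y \<in> S" for x y
    using b(2)[OF that(2,1)] that(1) cinner_commute[of "b x" y] cinner_commute[of x "a y"]
    by (simp add: res_apply)
  then show ?thesis
    using adj_unique[OF S res_bop[OF S b(1)], of a] res_bop[OF S b(1)] by auto
qed

lemma adj_bop: "a \<in> bop S \<Longrightarrow> adj S a \<in> bop S"
  using adj_bop_and_cinner by blast

lemma cinner_adj_left: "a \<in> bop S \<Longrightarrow> x \<in> S \<Longrightarrow> y \<in> S \<Longrightarrow> cinner (adj S a x) y = cinner x (a y)"
  using adj_bop_and_cinner by blast

lemma cinner_adj_right: "a \<in> bop S \<Longrightarrow> x \<in> S \<Longrightarrow> y \<in> S \<Longrightarrow> cinner x (adj S a y) = cinner (a x) y"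
  using cinner_adj_left by (metis cinner_commute)

end

subsection \<open>Orthonormal bases of closed subspaces\<close>

definition onb :: "'a::complex_inner set \<Rightarrow> 'a set \<Rightarrow> bool" where
  "onb S D \<longleftrightarrow> D \<subseteq> S \<and> orthonormal D \<and> (\<forall>x\<in>S. (\<forall>d\<in>D. cinner d x = 0) \<longrightarrow> x = 0)"

lemma onb_basis: "onb UNIV basis"
  using orthonormal_basis_basis unfolding onb_def orthonormal_basis_def by auto

text \<open>Zorn's lemma relative to S. It provides bases for spaces that have no preferred one,
  such as the multiplicity spaces.\<close>

lemma ex_onb:
  fixes S :: "'a::complex_inner set"
  assumes S: "hsub S" shows "\<exists>D. onb S D"
proof -
  have "\<exists>M\<in>{B. B \<subseteq> S \<and> orthonormal B}. \<forall>X\<in>{B. B \<subseteq> S \<and> orthonormal B}. M \<subseteq> X \<longrightarrow> X = M"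
  proof (rule subset_Zorn)
    fix \<C> :: "'a set set" assume "subset.chain {B. B \<subseteq> S \<and> orthonormal B} \<C>"
    then have on: "\<And>B. B \<in> \<C> \<Longrightarrow> B \<subseteq> S \<and> orthonormal B"
      and ch: "\<And>X Y. X \<in> \<C> \<Longrightarrow> Y \<in> \<C> \<Longrightarrow> X \<subseteq> Y \<or> Y \<subseteq> X"
      unfolding subset.chain_def by blast+
    have "orthonormal (\<Union>\<C>)"
      unfolding orthonormal_def
    proof safe
      fix x y X Y assume "x \<in> X" "X \<in> \<C>" "y \<in> Y" "Y \<in> \<C>"
      then obtain Z where "Z \<in> \<C>" "x \<in> Z" "y \<in> Z" using ch by blast
      then show "cinner x y = (if x = y then 1 else 0)"
        using on unfolding orthonormal_def by blast
    qed
    then show "\<exists>U\<in>{B. B \<subseteq> S \<and> orthonormal B}. \<forall>X\<in>\<C>. X \<subseteq> U" using on by blast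
  qed
  then obtain B where B0: "B \<in> {B. B \<subseteq> S \<and> orthonormal B}"
    and mx0: "\<forall>X\<in>{B. B \<subseteq> S \<and> orthonormal B}. B \<subseteq> X \<longrightarrow> X = B" by (rule bexE)
  have B: "B \<subseteq> S" "orthonormal B" using B0 by simp_all
  have mx: "X = B" if "X \<subseteq> S" "orthonormal X" "B \<subseteq> X" for X
    using mx0 that by simp
  have "x = 0" if xS: "x \<in> S" and x: "\<forall>b\<in>B. cinner b x = 0" for x
  proof (rule ccontr)
    assume "x \<noteq> 0"
    define u where "u = of_real (inverse (norm x)) *\<^sub>C x"
    have u1: "cinner u u = 1"
      unfolding u_def cinner_scaleC_left cinner_scaleC_right cinner_same[of x]
      using \<open>x \<noteq> 0\<close> by (simp add: power2_eq_square field_simps)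
    have bu: "cinner b u = 0" if "b \<in> B" for b
      using x that by (simp add: u_def cinner_scaleC_right)
    have ub: "cinner u b = 0" if "b \<in> B" for b
      using bu[OF that] cinner_commute[of u b] by simp
    have "orthonormal (insert u B)"
      using B(2) u1 bu ub unfolding orthonormal_def by (metis insert_iff zero_neq_one)
    moreover have "insert u B \<subseteq> S" using B(1) xS by (auto simp: u_def hsub_scale[OF S])
    ultimately have "u \<in> B" using mx by blast
    with bu u1 show False by fastforce
  qed
  with B show ?thesis unfolding onb_def by blast
qed

text \<open>The finite inequality for \<open>L2_set\<close> bounds all partial sums by A * B, and a
  nonnegative family with bounded partial sums is summable.\<close>

lemma Cauchy_Schwarz_family:
  fixes a b :: "'i \<Rightarrow> real"
  assumes "(\<lambda>i. (a i)\<^sup>2) summable_on I" "(\<lambda>i. (b i)\<^sup>2) summable_on I"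
    and "(\<Sum>\<^sub>\<infinity>i\<in>I. (a i)\<^sup>2) \<le> A\<^sup>2" "(\<Sum>\<^sub>\<infinity>i\<in>I. (b i)\<^sup>2) \<le> B\<^sup>2" "0 \<le> A" "0 \<le> B"
  shows "(\<lambda>i. \<bar>a i\<bar> * \<bar>b i\<bar>) summable_on I" "(\<Sum>\<^sub>\<infinity>i\<in>I. \<bar>a i\<bar> * \<bar>b i\<bar>) \<le> A * B"
proof -
  have fin: "(\<Sum>i\<in>F. \<bar>a i\<bar> * \<bar>b i\<bar>) \<le> A * B" if F: "finite F" "F \<subseteq> I" for F
  proof -
    have "L2_set a F \<le> A" "L2_set b F \<le> B"
      using finite_sum_le_infsum[OF assms(1) F] finite_sum_le_infsum[OF assms(2) F] assms(3-6)
      unfolding L2_set_def by (auto intro!: real_le_lsqrt)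
    then show ?thesis
      by (intro order_trans[OF L2_set_mult_ineq] mult_mono) (auto simp: assms)
  qed
  show s: "(\<lambda>i. \<bar>a i\<bar> * \<bar>b i\<bar>) summable_on I"
    by (rule nonneg_bdd_above_summable_on) (auto intro!: bdd_aboveI[of _ "A * B"] fin)
  show "(\<Sum>\<^sub>\<infinity>i\<in>I. \<bar>a i\<bar> * \<bar>b i\<bar>) \<le> A * B"
    by (rule infsum_le_finite_sums[OF s fin])
qed

lemma Bessel:
  assumes "orthonormal D"
  shows "(\<lambda>d. (cmod (cinner d x))\<^sup>2) summable_on D" "(\<Sum>\<^sub>\<infinity>d\<in>D. (cmod (cinner d x))\<^sup>2) \<le> (norm x)\<^sup>2"
proof -
  have fin: "(\<Sum>d\<in>F. (cmod (cinner d x))\<^sup>2) \<le> (norm x)\<^sup>2" if "finite F" "F \<subseteq> D" for F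
    using that assms by (intro Bessel_finite) (auto simp: orthonormal_def subset_iff)
  show s: "(\<lambda>d. (cmod (cinner d x))\<^sup>2) summable_on D"
    by (rule nonneg_bdd_above_summable_on) (auto intro!: bdd_aboveI[of _ "(norm x)\<^sup>2"] fin)
  show "(\<Sum>\<^sub>\<infinity>d\<in>D. (cmod (cinner d x))\<^sup>2) \<le> (norm x)\<^sup>2"
    by (rule infsum_le_finite_sums[OF s fin])
qed

lemma cmod_cinner_commute: "cmod (cinner x y) = cmod (cinner y x)"
  by (metis cinner_commute complex_mod_cnj)

lemma abs_summable_onb_product:
  assumes "orthonormal D"
  shows "(\<lambda>d. cmod (cinner x d * cinner d y)) summable_on D"
    and "(\<Sum>\<^sub>\<infinity>d\<in>D. cmod (cinner x d * cinner d y)) \<le> norm x * norm y"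
  using Cauchy_Schwarz_family[OF Bessel(1)[OF assms, of x] Bessel(1)[OF assms, of y]
      Bessel(2)[OF assms, of x] Bessel(2)[OF assms, of y]]
  by (simp_all add: norm_mult cmod_cinner_commute[of x])

text \<open>The sum over D is a bounded sesquilinear form and so comes from an operator f. Since f y
  - y is orthogonal to D, f is the identity on S; this avoids norm-convergent expansions of
  vectors.\<close>

lemma Parseval:
  fixes S :: "'a::hilbert_space set"
  assumes S: "hsub S" and D: "onb S D" and xy: "x \<in> S" "y \<in> S"
  shows "((\<lambda>d. cinner x d * cinner d y) has_sum cinner x y) D"
proof -
  have on: "orthonormal D" and DS: "D \<subseteq> S" using D by (auto simp: onb_def)
  define B where "B = (\<lambda>x y. \<Sum>\<^sub>\<infinity>d\<in>D. cinner x d * cinner d y)"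
  note sm = abs_summable_summable[OF abs_summable_onb_product(1)[OF on]]
  have bd: "cmod (B x y) \<le> 1 * norm x * norm y" for x y
    unfolding B_def mult_1
    by (rule order_trans[OF norm_infsum_bound[OF abs_summable_onb_product(1)[OF on]]
          abs_summable_onb_product(2)[OF on]])
  have "\<exists>f\<in>bmap S S. \<forall>y\<in>S. \<forall>x\<in>S. cinner y (f x) = B y x"
  proof (rule form_operator[OF S _ _ _ _ bd S])
    fix y x x' :: 'a and c
    show "B y (x + x') = B y x + B y x'"
      unfolding B_def cinner_add_right distrib_left by (rule infsum_add[OF sm sm])
    show "B (y + x') x = B y x + B x' x"
      unfolding B_def cinner_add_left distrib_right by (rule infsum_add[OF sm sm])
    show "B y (c *\<^sub>C x) = c * B y x"
      unfolding B_def cinner_scaleC_right mult.left_commute[of _ c] by (rule infsum_cmult_right')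
    show "B (c *\<^sub>C y) x = cnj c * B y x"
      unfolding B_def cinner_scaleC_left mult.assoc by (rule infsum_cmult_right')
  qed
  then obtain f where f: "f \<in> bmap S S" "\<And>x y. x \<in> S \<Longrightarrow> y \<in> S \<Longrightarrow> cinner y (f x) = B y x" by blast
  have "cinner d (f y - y) = 0" if d: "d \<in> D" for d
  proof -
    have "cinner d (f y) = (\<Sum>\<^sub>\<infinity>c\<in>D. cinner d c * cinner c y)"
      using f(2)[of y d] DS d xy by (auto simp: B_def)
    also have "\<dots> = (\<Sum>\<^sub>\<infinity>c\<in>{d}. cinner d c * cinner c y)"
      by (rule infsum_cong_neutral) (use on d in \<open>auto simp: orthonormal_def\<close>)
    also have "\<dots> = cinner d y" using on d by (simp add: orthonormal_def)
    finally show ?thesis by (simp add: cinner_diff_right)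
  qed
  moreover have "f y - y \<in> S" using f(1) xy S by (intro hsub_diff) (auto simp: bmap_in)
  ultimately have "f y = y" using D unfolding onb_def by force
  then have "cinner x y = B x y" using f(2)[OF xy(2,1)] by simp
  then show ?thesis using has_sum_infsum[OF sm[of x y]] by (simp add: B_def)
qed

lemma Parseval_norm:
  fixes S :: "'a::hilbert_space set"
  assumes "hsub S" "onb S D" "x \<in> S"
  shows "((\<lambda>d. (cmod (cinner d x))\<^sup>2) has_sum (norm x)\<^sup>2) D"
proof -
  have "((\<lambda>d. Re (cinner x d * cinner d x)) has_sum Re (cinner x x)) D"
    by (rule has_sum_Re[OF Parseval[OF assms(1,2,3,3)]])
  moreover have "Re (cinner x d * cinner d x) = (cmod (cinner d x))\<^sup>2" for d
    by (subst cinner_commute) (simp only: cmod_power2, simp add: power2_eq_square)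
  ultimately show ?thesis by (simp add: norm_eq_cinner)
qed

subsection \<open>Square-summable families\<close>

lemma summable_on_pairs:
  fixes f :: "'i \<times> 'j \<Rightarrow> complex" and g :: "'i \<Rightarrow> real"
  assumes "\<And>i. i \<in> I \<Longrightarrow> (\<lambda>j. cmod (f (i, j))) summable_on J"
    and "\<And>i. i \<in> I \<Longrightarrow> (\<Sum>\<^sub>\<infinity>j\<in>J. cmod (f (i, j))) \<le> g i" and "g summable_on I"
  shows "(\<lambda>p. cmod (f p)) summable_on I \<times> J" "f summable_on I \<times> J"
proof -
  show *: "(\<lambda>p. cmod (f p)) summable_on I \<times> J"
  proof (rule summable_on_SigmaI)
    show "((\<lambda>j. cmod (f (i, j))) has_sum (\<Sum>\<^sub>\<infinity>j\<in>J. cmod (f (i, j)))) J" if "i \<in> I" for i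
      by (rule has_sum_infsum[OF assms(1)[OF that]])
    show "(\<lambda>i. \<Sum>\<^sub>\<infinity>j\<in>J. cmod (f (i, j))) summable_on I"
      by (rule summable_on_comparison_test[OF assms(3)]) (auto intro: assms(2) infsum_nonneg)
  qed simp
  show "f summable_on I \<times> J" by (rule abs_summable_summable[OF *])
qed

lemma has_sum_exchange:
  fixes f :: "'i \<times> 'j \<Rightarrow> complex"
  assumes sm: "f summable_on I \<times> J"
    and row: "\<And>i. i \<in> I \<Longrightarrow> ((\<lambda>j. f (i, j)) has_sum r i) J" and s: "(r has_sum s) I"
    and col: "\<And>j. j \<in> J \<Longrightarrow> ((\<lambda>i. f (i, j)) has_sum c j) I"
  shows "(c has_sum s) J"
proof -
  have "(f has_sum s) (I \<times> J)" by (rule has_sum_SigmaI[OF row s sm])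
  then have "((\<lambda>(j, i). f (i, j)) has_sum s) (J \<times> I)" by (subst (asm) has_sum_swap)
  then show ?thesis by (rule has_sum_SigmaD) (use col in simp)
qed

definition sqfam :: "'a::complex_inner set \<Rightarrow> 'i set \<Rightarrow> ('i \<Rightarrow> 'a) \<Rightarrow> bool" where
  "sqfam S I x \<longleftrightarrow> (\<forall>i\<in>I. x i \<in> S) \<and> (\<lambda>i. (norm (x i))\<^sup>2) summable_on I"

text \<open>The general form of an ultraweakly continuous functional. The index set is arbitrary so
  that double families and families over a basis can be used as they arise;
  \<open>normal_onI\<close> renumbers them.\<close>

definition uwf :: "'i set \<Rightarrow> ('i \<Rightarrow> 'a::complex_inner) \<Rightarrow> ('i \<Rightarrow> 'a) \<Rightarrow> ('a \<Rightarrow> 'a) \<Rightarrow> complex" where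
  "uwf I x y a = (\<Sum>\<^sub>\<infinity>i\<in>I. cinner (x i) (a (y i)))"

definition l2norm :: "'i set \<Rightarrow> ('i \<Rightarrow> 'a::complex_inner) \<Rightarrow> real" where
  "l2norm I x = sqrt (\<Sum>\<^sub>\<infinity>i\<in>I. (norm (x i))\<^sup>2)"

lemma l2norm_nonneg: "0 \<le> l2norm I x"
  by (simp add: l2norm_def infsum_nonneg)

lemma sqfam_in: "sqfam S I x \<Longrightarrow> i \<in> I \<Longrightarrow> x i \<in> S"
  by (simp add: sqfam_def)

lemma sqfam_product:
  assumes "sqfam S I x" "sqfam T I y"
  shows "(\<lambda>i. norm (x i) * norm (y i)) summable_on I"
    and "(\<Sum>\<^sub>\<infinity>i\<in>I. norm (x i) * norm (y i)) \<le> l2norm I x * l2norm I y"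
  using Cauchy_Schwarz_family[of "\<lambda>i. norm (x i)" I "\<lambda>i. norm (y i)" "l2norm I x" "l2norm I y"] assms
  by (simp_all add: sqfam_def l2norm_def infsum_nonneg)

lemma uwf_summable:
  fixes x :: "'i \<Rightarrow> 'a::complex_inner" and y :: "'i \<Rightarrow> 'a"
  assumes x: "sqfam S I x" and y: "sqfam T I y"
    and a: "\<And>i. i \<in> I \<Longrightarrow> norm (a (y i)) \<le> M * norm (y i)"
  shows "(\<lambda>i. cmod (cinner (x i) (a (y i)))) summable_on I"
    and "(\<lambda>i. cinner (x i) (a (y i))) summable_on I"
    and "0 \<le> M \<Longrightarrow> cmod (uwf I x y a) \<le> M * (l2norm I x * l2norm I y)"
proof -
  have le: "cmod (cinner (x i) (a (y i))) \<le> M * (norm (x i) * norm (y i))" if "i \<in> I" for i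
  proof -
    have "cmod (cinner (x i) (a (y i))) \<le> norm (x i) * norm (a (y i))" by (rule Cauchy_Schwarz)
    also have "\<dots> \<le> norm (x i) * (M * norm (y i))" by (intro mult_left_mono a that) simp
    finally show ?thesis by (simp add: mult_ac)
  qed
  have s: "(\<lambda>i. M * (norm (x i) * norm (y i))) summable_on I"
    by (intro summable_on_cmult_right sqfam_product(1)[OF x y])
  show *: "(\<lambda>i. cmod (cinner (x i) (a (y i)))) summable_on I"
    by (rule summable_on_comparison_test[OF s le]) auto
  then show "(\<lambda>i. cinner (x i) (a (y i))) summable_on I" by (rule abs_summable_summable)
  assume M: "0 \<le> M"
  have "cmod (uwf I x y a) \<le> (\<Sum>\<^sub>\<infinity>i\<in>I. cmod (cinner (x i) (a (y i))))"
    unfolding uwf_def by (rule norm_infsum_bound[OF *])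
  also have "\<dots> \<le> (\<Sum>\<^sub>\<infinity>i\<in>I. M * (norm (x i) * norm (y i)))"
    by (rule infsum_mono[OF * s le])
  also have "\<dots> \<le> M * (l2norm I x * l2norm I y)"
    unfolding infsum_cmult_right' by (intro mult_left_mono sqfam_product(2)[OF x y] M)
  finally show "cmod (uwf I x y a) \<le> M * (l2norm I x * l2norm I y)" .
qed

lemma uwf_summable_bmap:
  fixes x :: "'i \<Rightarrow> 'a::complex_inner" and y :: "'i \<Rightarrow> 'a"
  assumes "sqfam S I x" "sqfam T I y" "a \<in> bmap T S"
  shows "(\<lambda>i. cmod (cinner (x i) (a (y i)))) summable_on I"
    and "(\<lambda>i. cinner (x i) (a (y i))) summable_on I"
proof -
  obtain M where M: "M \<ge> 0" "\<And>x. x \<in> T \<Longrightarrow> norm (a x) \<le> M * norm x" by (rule bmap_bound[OF assms(3)]) blast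
  have "norm (a (y i)) \<le> M * norm (y i)" if "i \<in> I" for i
    by (rule M(2)) (use assms(2) that in \<open>simp add: sqfam_def\<close>)
  from uwf_summable(1,2)[OF assms(1,2) this]
  show "(\<lambda>i. cmod (cinner (x i) (a (y i)))) summable_on I"
    and "(\<lambda>i. cinner (x i) (a (y i))) summable_on I" by auto
qed

lemma uwf_add:
  assumes "sqfam S I x" "sqfam S I y" "a \<in> bop S" "b \<in> bop S"
  shows "uwf I x y (\<lambda>v. a v + b v) = uwf I x y a + uwf I x y b"
  unfolding uwf_def cinner_add_right
  by (intro infsum_add uwf_summable_bmap(2)[OF assms(1,2)] bop_bmap assms)

lemma uwf_scale: "uwf I x y (\<lambda>v. c *\<^sub>C a v) = c * uwf I x y a"
  unfolding uwf_def cinner_scaleC_right by (rule infsum_cmult_right')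

lemma sqfam_image:
  assumes "sqfam S I x" "a \<in> bmap S T"
  shows "sqfam T I (\<lambda>i. a (x i))"
proof -
  obtain M where M: "M \<ge> 0" "\<And>x. x \<in> S \<Longrightarrow> norm (a x) \<le> M * norm x" by (rule bmap_bound[OF assms(2)]) blast
  have "(\<lambda>i. (norm (a (x i)))\<^sup>2) summable_on I"
  proof (rule summable_on_comparison_test)
    show "(\<lambda>i. M\<^sup>2 * (norm (x i))\<^sup>2) summable_on I"
      using assms(1) by (intro summable_on_cmult_right) (simp add: sqfam_def)
    fix i assume "i \<in> I"
    then have "norm (a (x i)) \<le> M * norm (x i)" using assms(1) by (intro M(2)) (simp add: sqfam_def)
    then show "(norm (a (x i)))\<^sup>2 \<le> M\<^sup>2 * (norm (x i))\<^sup>2"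
      unfolding power_mult_distrib[symmetric] by (rule power_mono) simp
  qed simp
  with assms show ?thesis by (auto simp: sqfam_def bmap_in)
qed

lemma sqfam_single: "x \<in> S \<Longrightarrow> sqfam S {i} (\<lambda>_. x)"
  by (simp add: sqfam_def)

text \<open>Expanding along such a family reduces a normal functional to its values on matrix entries.\<close>

definition resolution :: "'a::complex_inner set \<Rightarrow> 'b set \<Rightarrow> ('b \<Rightarrow> 'a \<Rightarrow> 'a) \<Rightarrow> bool" where
  "resolution S D P \<longleftrightarrow> (\<forall>b\<in>D. P b \<in> bop S) \<and> (\<forall>u\<in>S. \<forall>v\<in>S. ((\<lambda>b. cinner u (P b v)) has_sum cinner u v) D
     \<and> (\<lambda>b. cmod (cinner u (P b v))) summable_on D
     \<and> (\<Sum>\<^sub>\<infinity>b\<in>D. cmod (cinner u (P b v))) \<le> norm u * norm v)"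

text \<open>Fubini. The last clause of \<open>resolution\<close> bounds the row sums by
  \<open>norm (x i) * norm (y i)\<close>, which is summable.\<close>

lemma resolution_sum:
  assumes P: "resolution S D P" and x: "sqfam S I x" and y: "sqfam S I y"
  shows "((\<lambda>b. \<Sum>\<^sub>\<infinity>i\<in>I. cinner (x i) (P b (y i))) has_sum (\<Sum>\<^sub>\<infinity>i\<in>I. cinner (x i) (y i))) D"
proof -
  have P1: "((\<lambda>b. cinner (x i) (P b (y i))) has_sum cinner (x i) (y i)) D"
    and P2: "(\<lambda>b. cmod (cinner (x i) (P b (y i)))) summable_on D"
    and P3: "(\<Sum>\<^sub>\<infinity>b\<in>D. cmod (cinner (x i) (P b (y i)))) \<le> norm (x i) * norm (y i)" if "i \<in> I" for i
    using P sqfam_in[OF x that] sqfam_in[OF y that] unfolding resolution_def by blast+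
  have id: "id \<in> bmap S S" by (rule bmapI[where M = 1]) auto
  show ?thesis
  proof (rule has_sum_exchange[where f = "\<lambda>(i, b). cinner (x i) (P b (y i))"])
    show "(\<lambda>(i, b). cinner (x i) (P b (y i))) summable_on I \<times> D"
      by (rule summable_on_pairs(2)[where g = "\<lambda>i. norm (x i) * norm (y i)"])
        (use P2 P3 sqfam_product(1)[OF x y] in auto)
    show "((\<lambda>i. cinner (x i) (y i)) has_sum (\<Sum>\<^sub>\<infinity>i\<in>I. cinner (x i) (y i))) I"
      using uwf_summable_bmap(2)[OF x y id] by (intro has_sum_infsum) simp
    show "((\<lambda>i. case (i, b) of (i, b) \<Rightarrow> cinner (x i) (P b (y i))) has_sum
        (\<Sum>\<^sub>\<infinity>i\<in>I. cinner (x i) (P b (y i)))) I" if "b \<in> D" for b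
      using uwf_summable_bmap(2)[OF x y bop_bmap[of "P b"]] P that
      by (simp add: resolution_def)
  qed (use P1 in simp)
qed

lemma uwf_resolution_left:
  assumes "resolution S D P" "sqfam S I x" "sqfam S I y" "a \<in> bop S"
  shows "((\<lambda>b. uwf I x y (P b \<circ> a)) has_sum uwf I x y a) D"
  using resolution_sum[OF assms(1,2) sqfam_image[OF assms(3) bop_bmap[OF assms(4)]]]
  by (simp add: uwf_def)

text \<open>Moving a to the left vectors by its adjoint leaves a sum without operator, to which
  \<open>resolution_sum\<close> applies.\<close>

lemma uwf_resolution_right:
  fixes S :: "'a::hilbert_space set"
  assumes "hsub S" "resolution S D P" "sqfam S I x" "sqfam S I y" "a \<in> bop S"
  shows "((\<lambda>b. uwf I x y (a \<circ> P b)) has_sum uwf I x y a) D"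
proof -
  have "((\<lambda>b. \<Sum>\<^sub>\<infinity>i\<in>I. cinner (adj S a (x i)) (P b (y i))) has_sum
      (\<Sum>\<^sub>\<infinity>i\<in>I. cinner (adj S a (x i)) (y i))) D"
    by (rule resolution_sum[OF assms(2) sqfam_image[OF assms(3) bop_bmap[OF adj_bop[OF assms(1,5)]]] assms(4)])
  moreover have "(\<Sum>\<^sub>\<infinity>i\<in>I. cinner (adj S a (x i)) (y i)) = uwf I x y a"
    unfolding uwf_def
    by (intro infsum_cong cinner_adj_left[OF assms(1,5)]) (use assms in \<open>auto simp: sqfam_in\<close>)
  moreover have "uwf I x y (a \<circ> P b) = (\<Sum>\<^sub>\<infinity>i\<in>I. cinner (adj S a (x i)) (P b (y i)))" if "b \<in> D" for b
    unfolding uwf_def o_def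
    by (intro infsum_cong cinner_adj_left[OF assms(1,5), symmetric])
      (use assms that in \<open>auto simp: sqfam_in resolution_def bop_in\<close>)
  ultimately show ?thesis by (subst has_sum_cong) auto
qed

subsection \<open>Normal functionals\<close>

definition normal_on :: "'a::complex_inner set \<Rightarrow> ('a \<Rightarrow> 'a) set \<Rightarrow> (('a \<Rightarrow> 'a) \<Rightarrow> complex) \<Rightarrow> bool" where
  "normal_on S M \<omega> \<longleftrightarrow> (\<exists>x y :: nat \<Rightarrow> 'a. sqfam S UNIV x \<and> sqfam S UNIV y \<and> (\<forall>a\<in>M. \<omega> a = uwf UNIV x y a))"

text \<open>A square-summable family has only countably many nonzero members. The indices with
  nonzero x i are enumerated and the remaining naturals padded with zeros; dropping the other y i is
  harmless because their terms vanish.\<close>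

lemma normal_onI:
  fixes x y :: "'j \<Rightarrow> 'a::complex_inner"
  assumes S: "hsub S" and x: "sqfam S I x" and y: "sqfam S I y"
    and M: "M \<subseteq> bop S" and \<omega>: "\<And>a. a \<in> M \<Longrightarrow> \<omega> a = uwf I x y a"
  shows "normal_on S M \<omega>"
proof -
  define J where "J = {i\<in>I. (norm (x i))\<^sup>2 \<noteq> 0}"
  have cJ: "countable J" unfolding J_def
    by (rule summable_countable_real) (use x in \<open>simp add: sqfam_def\<close>)
  define e where "e = to_nat_on J"
  have inj: "inj_on e J" unfolding e_def using cJ by (rule inj_on_to_nat_on)
  define g where "g = inv_into J e"
  have ge: "g (e j) = j" if "j \<in> J" for j using that inj by (simp add: g_def)
  have gJ: "g n \<in> J" if "n \<in> e ` J" for n using that ge by auto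
  have JI: "J \<subseteq> I" by (auto simp: J_def)
  define r where "r = (\<lambda>(z::'j \<Rightarrow> 'a) n. if n \<in> e ` J then z (g n) else 0)"
  have sq: "sqfam S UNIV (r z)" if z: "sqfam S I z" for z
  proof -
    have "(\<lambda>i. (norm (z i))\<^sup>2) summable_on J"
      using z JI by (auto simp: sqfam_def intro: summable_on_subset_banach)
    then have "((\<lambda>n. (norm (r z n))\<^sup>2) \<circ> e) summable_on J"
      by (subst summable_on_cong[where g = "\<lambda>i. (norm (z i))\<^sup>2"]) (auto simp: r_def ge)
    then have "(\<lambda>n. (norm (r z n))\<^sup>2) summable_on e ` J"
      using inj by (simp add: summable_on_reindex)
    then have "(\<lambda>n. (norm (r z n))\<^sup>2) summable_on UNIV"
      by (subst summable_on_cong_neutral[where S = UNIV and T = "e ` J"]) (auto simp: r_def)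
    moreover have "r z n \<in> S" for n
      using z gJ JI by (auto simp: r_def sqfam_def hsub_zero[OF S])
    ultimately show ?thesis by (simp add: sqfam_def)
  qed
  have "uwf UNIV (r x) (r y) a = uwf I x y a" for a
  proof -
    have "uwf UNIV (r x) (r y) a = (\<Sum>\<^sub>\<infinity>n\<in>e ` J. cinner (r x n) (a (r y n)))"
      unfolding uwf_def by (rule infsum_cong_neutral) (auto simp: r_def)
    also have "\<dots> = (\<Sum>\<^sub>\<infinity>i\<in>J. cinner (r x (e i)) (a (r y (e i))))"
      using inj by (simp add: infsum_reindex o_def)
    also have "\<dots> = (\<Sum>\<^sub>\<infinity>i\<in>J. cinner (x i) (a (y i)))"
      by (rule infsum_cong) (auto simp: r_def ge)
    also have "\<dots> = uwf I x y a"
      unfolding uwf_def by (rule infsum_cong_neutral) (auto simp: J_def)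
    finally show ?thesis .
  qed
  then show ?thesis unfolding normal_on_def using sq[OF x] sq[OF y] \<omega> by metis
qed

section \<open>The ultraweak topology and its continuous linear functionals\<close>

definition uw_generators :: "'a::complex_inner set \<Rightarrow> ('a \<Rightarrow> 'a) set set" where
  "uw_generators S = {{a \<in> bop S. uwf (UNIV :: nat set) x y a \<in> U} | x y U.
     sqfam S UNIV x \<and> sqfam S UNIV y \<and> open U}"

text \<open>\<open>ultraweak\<close> sums in the order of the naturals. The series converge
  absolutely, so unordered sums give the same generators.\<close>

lemma ultraweak_eq: "ultraweak S = topology_generated_by (uw_generators S)"
proof -
  have *: "(\<Sum>i. cinner (x i) (a (y i))) = uwf UNIV x y a"
    if "a \<in> bop S" "sqfam S UNIV x" "sqfam S UNIV y" for a and x y :: "nat \<Rightarrow> 'a"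
    unfolding uwf_def
    by (rule sums_unique[symmetric], rule has_sum_imp_sums, rule has_sum_infsum)
      (rule uwf_summable_bmap(2)[OF that(2,3) bop_bmap[OF that(1)]])
  have sq: "sqfam S UNIV x \<longleftrightarrow> (\<forall>i. x i \<in> S) \<and> summable (\<lambda>i. (norm (x i))\<^sup>2)" for x :: "nat \<Rightarrow> 'a"
    by (simp add: sqfam_def summable_on_UNIV_nonneg_real_iff)
  have set: "{a \<in> bop S. (\<Sum>i. cinner (x i) (a (y i))) \<in> U} = {a \<in> bop S. uwf UNIV x y a \<in> U}"
    if "sqfam S UNIV x" "sqfam S UNIV y" for x y :: "nat \<Rightarrow> 'a" and U
    using *[OF _ that] by auto
  have "{{a \<in> bop S. (\<Sum>i. cinner (x i) (a (y i))) \<in> U} | x y U.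
        (\<forall>i::nat. x i \<in> S \<and> y i \<in> S) \<and> summable (\<lambda>i. (norm (x i))\<^sup>2)
        \<and> summable (\<lambda>i. (norm (y i))\<^sup>2) \<and> open U}
      = {{a \<in> bop S. (\<Sum>i. cinner (x i) (a (y i))) \<in> U} | x y U.
        sqfam S (UNIV :: nat set) x \<and> sqfam S UNIV y \<and> open U}"
    unfolding sq by (intro Collect_cong ex_cong1) auto
  also have "\<dots> = uw_generators S"
    unfolding uw_generators_def
    by (rule arg_cong[where f = Collect]) (intro ext ex_cong1, use set in auto)
  finally show ?thesis by (simp add: ultraweak_def)
qed

lemma topspace_ultraweak: assumes "hsub S" shows "topspace (ultraweak S) = bop S"
proof -
  have "\<exists>G\<in>uw_generators S. a \<in> G" if "a \<in> bop S" for a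
    by (rule bexI[of _ "{a \<in> bop S. uwf UNIV (\<lambda>_::nat. 0) (\<lambda>_. 0) a \<in> UNIV}"])
      (use that hsub_zero[OF assms] in \<open>auto simp: uw_generators_def sqfam_def intro!: exI[of _ "\<lambda>_. 0"] exI[of _ UNIV]\<close>)
  moreover have "\<And>G. G \<in> uw_generators S \<Longrightarrow> G \<subseteq> bop S"
    by (auto simp: uw_generators_def)
  ultimately show ?thesis unfolding ultraweak_eq topology_generated_by_topspace by blast
qed

lemma normal_on_continuous:
  assumes S: "hsub S" and M: "M \<subseteq> bop S" and "normal_on S M \<omega>"
  shows "continuous_map (subtopology (ultraweak S) M) euclidean \<omega>"
proof -
  obtain x y :: "nat \<Rightarrow> 'a" where xy: "sqfam S UNIV x" "sqfam S UNIV y"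
    and \<omega>: "\<And>a. a \<in> M \<Longrightarrow> \<omega> a = uwf UNIV x y a"
    using assms(3) unfolding normal_on_def by blast
  have "openin (subtopology (ultraweak S) M) {a \<in> topspace (subtopology (ultraweak S) M). \<omega> a \<in> U}"
    if "open U" for U
  proof -
    have "openin (ultraweak S) {a \<in> bop S. uwf UNIV x y a \<in> U}"
      unfolding ultraweak_eq
      by (rule topology_generated_by_Basis) (use xy that in \<open>auto simp: uw_generators_def\<close>)
    moreover have "{a \<in> topspace (subtopology (ultraweak S) M). \<omega> a \<in> U}
        = {a \<in> bop S. uwf UNIV x y a \<in> U} \<inter> M"
      using M \<omega> by (auto simp: topspace_ultraweak[OF S])
    ultimately show ?thesis by (auto simp: openin_subtopology)
  qed
  then show ?thesis unfolding continuous_map_def by auto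
qed

text \<open>Induction on J. Addition and scaling are parameters because the operators on a carrier
  form a set of functions and not a vector space type.\<close>

lemma functional_kernel_combination:
  fixes f :: "'v \<Rightarrow> complex" and g :: "'j \<Rightarrow> 'v \<Rightarrow> complex"
  assumes "finite J"
    and add: "\<And>a b. a \<in> V \<Longrightarrow> b \<in> V \<Longrightarrow> add a b \<in> V" and sc: "\<And>a c. a \<in> V \<Longrightarrow> sc c a \<in> V"
    and g: "\<And>j a b. j \<in> J \<Longrightarrow> a \<in> V \<Longrightarrow> b \<in> V \<Longrightarrow> g j (add a b) = g j a + g j b"
      "\<And>j a c. j \<in> J \<Longrightarrow> a \<in> V \<Longrightarrow> g j (sc c a) = c * g j a"
    and f: "\<And>a b. a \<in> V \<Longrightarrow> b \<in> V \<Longrightarrow> f (add a b) = f a + f b" "\<And>a c. a \<in> V \<Longrightarrow> f (sc c a) = c * f a"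
    and ker: "\<And>a. a \<in> V \<Longrightarrow> (\<And>j. j \<in> J \<Longrightarrow> g j a = 0) \<Longrightarrow> f a = 0"
  shows "\<exists>c. \<forall>a\<in>V. f a = (\<Sum>j\<in>J. c j * g j a)"
  using assms(1) g f ker
proof (induction J arbitrary: f rule: finite_induct)
  case (insert j J)
  show ?case
  proof (cases "\<exists>a0\<in>V. (\<forall>i\<in>J. g i a0 = 0) \<and> g j a0 \<noteq> 0")
    case True
    then obtain a0 where a0: "a0 \<in> V" "\<And>i. i \<in> J \<Longrightarrow> g i a0 = 0" "g j a0 \<noteq> 0" by blast
    \<comment> \<open>k is forced, since f - k * g j has to vanish at a0. Below, t moves a into the
      kernel of g j along a0, which the other functionals do not see.\<close>
    define k where "k = f a0 / g j a0"
    have "\<exists>c. \<forall>a\<in>V. f a - k * g j a = (\<Sum>j\<in>J. c j * g j a)"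
    proof (rule insert.IH)
      fix a assume a: "a \<in> V" "\<And>i. i \<in> J \<Longrightarrow> g i a = 0"
      define t where "t = - (g j a / g j a0)"
      have "f (add a (sc t a0)) = 0"
        by (rule insert.prems(5)) (use a a0 in \<open>auto simp: insert.prems add sc t_def\<close>)
      then have "f a + t * f a0 = 0" using a a0 by (simp add: insert.prems sc)
      then show "f a - k * g j a = 0" by (simp add: t_def k_def)
    qed (auto simp: insert.prems algebra_simps)
    then obtain c where c: "\<And>a. a \<in> V \<Longrightarrow> f a - k * g j a = (\<Sum>j\<in>J. c j * g j a)" by blast
    have "f a = (\<Sum>i\<in>insert j J. (c(j := k)) i * g i a)" if "a \<in> V" for a
    proof -
      have "(\<Sum>i\<in>J. (c(j := k)) i * g i a) = (\<Sum>i\<in>J. c i * g i a)"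
        by (rule sum.cong) (use insert.hyps in auto)
      then show ?thesis using c[OF that] insert.hyps by (simp add: algebra_simps)
    qed
    then show ?thesis by blast
  next
    case False
    have "\<exists>c. \<forall>a\<in>V. f a = (\<Sum>j\<in>J. c j * g j a)"
    proof (rule insert.IH)
      fix a assume a: "a \<in> V" "\<And>i. i \<in> J \<Longrightarrow> g i a = 0"
      then have "g j a = 0" using False by blast
      with a show "f a = 0" by (intro insert.prems(5)) auto
    qed (auto simp: insert.prems)
    then obtain c where c: "\<And>a. a \<in> V \<Longrightarrow> f a = (\<Sum>j\<in>J. c j * g j a)" by blast
    have "f a = (\<Sum>i\<in>insert j J. (c(j := 0)) i * g i a)" if "a \<in> V" for a
    proof -
      have "(\<Sum>i\<in>J. (c(j := 0)) i * g i a) = (\<Sum>i\<in>J. c i * g i a)"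
        by (rule sum.cong) (use insert.hyps in auto)
      then show ?thesis using c[OF that] insert.hyps by simp
    qed
    then show ?thesis by blast
  qed
qed auto

lemma generated_neighbourhood:
  assumes "generate_topology_on B W" "p \<in> W"
  shows "\<exists>F. finite F \<and> F \<subseteq> B \<and> p \<in> \<Inter>F \<and> \<Inter>F \<subseteq> W"
  using assms
proof (induction rule: generate_topology_on.induct)
  case (Int a b)
  then obtain F G where "finite F" "F \<subseteq> B" "p \<in> \<Inter>F" "\<Inter>F \<subseteq> a"
    "finite G" "G \<subseteq> B" "p \<in> \<Inter>G" "\<Inter>G \<subseteq> b" by auto
  then show ?case by (intro exI[of _ "F \<union> G"]) auto
next
  case (UN K)
  then obtain k where k: "k \<in> K" "p \<in> k" by blast
  then obtain F where "finite F" "F \<subseteq> B" "p \<in> \<Inter>F" "\<Inter>F \<subseteq> k" using UN.IH[OF k] by (elim exE conjE)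
  with k(1) show ?case by (intro exI[of _ F]) auto
next
  case (Basis s)
  then show ?case by (intro exI[of _ "{s}"]) auto
qed auto

text \<open>A continuous functional has modulus below 1 on some basic neighbourhood of 0. It
  therefore vanishes on the common kernel of the finitely many series functionals that define this
  neighbourhood, and is a linear combination of them.\<close>

lemma continuous_normal_on:
  fixes \<omega> :: "('a::hilbert_space \<Rightarrow> 'a) \<Rightarrow> complex"
  assumes S: "hsub S" and M: "M \<subseteq> bop S" and zero: "(\<lambda>_. 0) \<in> M"
    and add: "\<And>a b. a \<in> M \<Longrightarrow> b \<in> M \<Longrightarrow> (\<lambda>x. a x + b x) \<in> M"
    and sc: "\<And>a c. a \<in> M \<Longrightarrow> (\<lambda>x. c *\<^sub>C a x) \<in> M"
    and \<omega>: "\<And>a b. a \<in> M \<Longrightarrow> b \<in> M \<Longrightarrow> \<omega> (\<lambda>x. a x + b x) = \<omega> a + \<omega> b"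
      "\<And>a c. a \<in> M \<Longrightarrow> \<omega> (\<lambda>x. c *\<^sub>C a x) = c * \<omega> a"
    and cont: "continuous_map (subtopology (ultraweak S) M) euclidean \<omega>"
  shows "normal_on S M \<omega>"
proof -
  have \<omega>0: "\<omega> (\<lambda>_. 0) = 0" using \<omega>(2)[OF zero, of 0] by simp
  have "openin (subtopology (ultraweak S) M) {a \<in> topspace (subtopology (ultraweak S) M). \<omega> a \<in> ball 0 1}"
    by (rule openin_continuous_map_preimage[OF cont]) simp
  moreover have "topspace (subtopology (ultraweak S) M) = M"
    using M by (auto simp: topspace_ultraweak[OF S])
  ultimately obtain W where W: "openin (ultraweak S) W" "{a \<in> M. \<omega> a \<in> ball 0 1} = W \<inter> M"
    by (auto simp: openin_subtopology)
  have "(\<lambda>_. 0) \<in> {a \<in> M. \<omega> a \<in> ball 0 1}" using zero \<omega>0 by simp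
  then have "(\<lambda>_. 0) \<in> W" unfolding W(2) by (rule IntD1)
  with W(1) obtain F where F: "finite F" "F \<subseteq> uw_generators S" "(\<lambda>_. 0) \<in> \<Inter>F" "\<Inter>F \<subseteq> W"
    using generated_neighbourhood unfolding ultraweak_eq openin_topology_generated_by_iff by meson
  have "\<forall>G\<in>F. \<exists>p. G = {a \<in> bop S. uwf (UNIV :: nat set) (fst p) (fst (snd p)) a \<in> snd (snd p)}
      \<and> sqfam S UNIV (fst p) \<and> sqfam S UNIV (fst (snd p))"
  proof
    fix G assume "G \<in> F"
    with F(2) have "G \<in> uw_generators S" by blast
    then obtain x y :: "nat \<Rightarrow> 'a" and U where "G = {a \<in> bop S. uwf UNIV x y a \<in> U}"
      "sqfam S UNIV x" "sqfam S UNIV y"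
      unfolding uw_generators_def by blast
    then show "\<exists>p. G = {a \<in> bop S. uwf (UNIV :: nat set) (fst p) (fst (snd p)) a \<in> snd (snd p)}
        \<and> sqfam S UNIV (fst p) \<and> sqfam S UNIV (fst (snd p))"
      by (intro exI[of _ "(x, y, U)"]) simp
  qed
  from bchoice[OF this] obtain p where
    p: "\<forall>G\<in>F. G = {a \<in> bop S. uwf (UNIV :: nat set) (fst (p G)) (fst (snd (p G))) a \<in> snd (snd (p G))}
      \<and> sqfam S UNIV (fst (p G)) \<and> sqfam S UNIV (fst (snd (p G)))" ..
  define x y U where "x G = fst (p G)" and "y G = fst (snd (p G))" and "U G = snd (snd (p G))" for G
  have G: "G = {a \<in> bop S. uwf UNIV (x G) (y G) a \<in> U G}"
    and sq: "sqfam S UNIV (x G)" "sqfam S UNIV (y G)" if "G \<in> F" for G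
    using p that unfolding x_def y_def U_def by blast+
  have U0: "0 \<in> U G" if "G \<in> F" for G
  proof -
    have "(\<lambda>_. 0) \<in> G" using F(3) that by blast
    then have "(\<lambda>_. 0) \<in> {a \<in> bop S. uwf UNIV (x G) (y G) a \<in> U G}"
      by (rule subst[OF G[OF that], where P = "\<lambda>X. (\<lambda>_. 0) \<in> X"])
    then show ?thesis by (simp add: uwf_def)
  qed
  have "\<exists>c. \<forall>a\<in>M. \<omega> a = (\<Sum>G\<in>F. c G * uwf UNIV (x G) (y G) a)"
  proof (rule functional_kernel_combination[where add = "\<lambda>a b x. a x + b x" and sc = "\<lambda>c a x. c *\<^sub>C a x"])
    fix a assume a: "a \<in> M" and 0: "\<And>G. G \<in> F \<Longrightarrow> uwf UNIV (x G) (y G) a = 0"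
    \<comment> \<open>Every multiple of a stays in the neighbourhood, because the functionals that
      define it remain 0.\<close>
    have "cmod (of_nat n * \<omega> a) < 1" for n :: nat
    proof -
      have m: "(\<lambda>x. of_nat n *\<^sub>C a x) \<in> M" by (rule sc[OF a])
      have "(\<lambda>x. of_nat n *\<^sub>C a x) \<in> G" if "G \<in> F" for G
        by (subst G[OF that]) (use m M 0[OF that] U0[OF that] in \<open>auto simp: uwf_scale\<close>)
      then have "(\<lambda>x. of_nat n *\<^sub>C a x) \<in> W" using F(4) by blast
      with m W(2) have "\<omega> (\<lambda>x. of_nat n *\<^sub>C a x) \<in> ball 0 1" by blast
      then show ?thesis by (simp add: \<omega>(2)[OF a])
    qed
    then have *: "real n * cmod (\<omega> a) < 1" for n :: nat by (simp add: norm_mult)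
    show "\<omega> a = 0"
    proof (rule ccontr)
      assume "\<omega> a \<noteq> 0"
      then obtain n where "1 < real n * cmod (\<omega> a)"
        using reals_Archimedean3[of "cmod (\<omega> a)"] by auto
      with *[of n] show False by simp
    qed
  qed (use F(1) add sc \<omega> M sq in \<open>auto simp: uwf_scale intro!: uwf_add\<close>)
  then obtain c where c: "\<And>a. a \<in> M \<Longrightarrow> \<omega> a = (\<Sum>G\<in>F. c G * uwf UNIV (x G) (y G) a)" by blast
  \<comment> \<open>The finite combination becomes one series indexed by F \<times> UNIV. The
    coefficients move to the left vectors, conjugated because the inner product is antilinear
    there.\<close>
  define x' where "x' = (\<lambda>(G, i). cnj (c G) *\<^sub>C x G i)"
  define y' where "y' = (\<lambda>(G, i). y G i)"
  have sqc: "sqfam S UNIV (\<lambda>i. cnj (c G) *\<^sub>C x G i)" if "G \<in> F" for G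
  proof (rule sqfam_image[OF sq(1)[OF that], where a = "\<lambda>v. cnj (c G) *\<^sub>C v"])
    show "(\<lambda>v. cnj (c G) *\<^sub>C v) \<in> bmap S S"
      by (rule bmapI[where M = "cmod (c G)"])
        (auto simp: hsub_scale[OF S] scaleC_add_right scaleC_scaleC norm_scaleC mult.commute)
  qed
  have sqF: "sqfam S (F \<times> UNIV) (\<lambda>(G, i). z G i)"
    if "\<And>G. G \<in> F \<Longrightarrow> sqfam S UNIV (z G)" for z :: "('a \<Rightarrow> 'a) set \<Rightarrow> nat \<Rightarrow> 'a"
  proof -
    have "(\<lambda>(G, i). (norm (z G i))\<^sup>2) summable_on F \<times> UNIV"
      by (rule summable_on_SigmaI[where g = "\<lambda>G. \<Sum>\<^sub>\<infinity>i. (norm (z G i))\<^sup>2"])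
        (use that F(1) in \<open>auto simp: sqfam_def\<close>)
    then show ?thesis using that by (auto simp: sqfam_def case_prod_unfold)
  qed
  have sx: "sqfam S (F \<times> UNIV) x'" unfolding x'_def by (rule sqF[OF sqc])
  have sy: "sqfam S (F \<times> UNIV) y'" unfolding y'_def by (rule sqF[OF sq(2)])
  show ?thesis
  proof (rule normal_onI[OF S sx sy M])
    fix a assume a: "a \<in> M"
    have "uwf (F \<times> UNIV) x' y' a = (\<Sum>\<^sub>\<infinity>G\<in>F. \<Sum>\<^sub>\<infinity>i. cinner (x' (G, i)) (a (y' (G, i))))"
      unfolding uwf_def
      by (rule infsum_Sigma_banach[symmetric], rule uwf_summable_bmap(2)[OF sx sy]) (use a M bop_bmap in auto)
    also have "\<dots> = (\<Sum>G\<in>F. \<Sum>\<^sub>\<infinity>i. c G * cinner (x G i) (a (y G i)))"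
      by (simp add: F(1) x'_def y'_def cinner_scaleC_left)
    also have "\<dots> = \<omega> a" by (simp add: c[OF a] uwf_def infsum_cmult_right')
    finally show "\<omega> a = uwf (F \<times> UNIV) x' y' a" by simp
  qed
qed

subsection \<open>Commutants\<close>

lemma commutant_bop: "b \<in> commutant S M \<Longrightarrow> b \<in> bop S"
  by (simp add: commutant_def)

lemma commutantD: "b \<in> commutant S M \<Longrightarrow> a \<in> M \<Longrightarrow> a (b x) = b (a x)"
proof -
  assume "b \<in> commutant S M" "a \<in> M"
  then have "a \<circ> b = b \<circ> a" by (auto simp: commutant_def)
  from fun_cong[OF this, of x] show ?thesis by simp
qed

lemma commutantI:
  assumes "b \<in> bop S" "\<And>a x. a \<in> M \<Longrightarrow> a (b x) = b (a x)" shows "b \<in> commutant S M"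
  unfolding commutant_def using assms by (simp add: fun_eq_iff)

text \<open>Outside \<open>S\<close> both sides vanish, so commutation has to be checked on \<open>S\<close> only.\<close>

lemma commutantI':
  assumes S: "hsub S" and M: "M \<subseteq> bop S" and b: "b \<in> bop S"
    and "\<And>a x. a \<in> M \<Longrightarrow> x \<in> S \<Longrightarrow> a (b x) = b (a x)"
  shows "b \<in> commutant S M"
proof (rule commutantI[OF b])
  fix a x assume a: "a \<in> M"
  show "a (b x) = b (a x)"
  proof (cases "x \<in> S")
    case False
    have aS: "a \<in> bop S" using a M by blast
    have "a 0 = 0" "b 0 = 0" using bmap_zero[OF S bop_bmap] aS b by blast+
    then show ?thesis
      using False bop_outside[OF aS False] bop_outside[OF b False] by simp
  qed (use a assms in auto)
qed

lemma commutant_antimono: "M \<subseteq> N \<Longrightarrow> commutant S N \<subseteq> commutant S M"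
  by (auto simp: commutant_def)

lemma subset_double_commutant: "M \<subseteq> bop S \<Longrightarrow> M \<subseteq> commutant S (commutant S M)"
  by (auto intro!: commutantI simp: commutantD[symmetric])

lemma triple_commutant: "M \<subseteq> bop S \<Longrightarrow> commutant S (commutant S (commutant S M)) = commutant S M"
  by (meson commutant_antimono commutant_bop subsetI subset_antisym subset_double_commutant)

text \<open>The algebraic closure properties of a von Neumann algebra. The double commutant
  condition is carried as a separate hypothesis by the lemmas that use it.\<close>

definition op_algebra :: "'a::complex_inner set \<Rightarrow> ('a \<Rightarrow> 'a) set \<Rightarrow> bool" where
  "op_algebra S M \<longleftrightarrow> M \<subseteq> bop S \<and> idop S \<in> M \<and> (\<forall>a\<in>M. \<forall>b\<in>M. (\<lambda>x. a x + b x) \<in> M)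
     \<and> (\<forall>c. \<forall>a\<in>M. (\<lambda>x. c *\<^sub>C a x) \<in> M) \<and> (\<forall>a\<in>M. \<forall>b\<in>M. a \<circ> b \<in> M) \<and> (\<forall>a\<in>M. adj S a \<in> M)"

lemma
  assumes "op_algebra S M"
  shows op_algebra_sub: "a \<in> M \<Longrightarrow> a \<in> bop S"
    and op_algebra_idop: "idop S \<in> M"
    and op_algebra_plus: "a \<in> M \<Longrightarrow> b \<in> M \<Longrightarrow> (\<lambda>x. a x + b x) \<in> M"
    and op_algebra_scaled: "a \<in> M \<Longrightarrow> (\<lambda>x. c *\<^sub>C a x) \<in> M"
    and op_algebra_comp: "a \<in> M \<Longrightarrow> b \<in> M \<Longrightarrow> a \<circ> b \<in> M"
    and op_algebra_adj: "a \<in> M \<Longrightarrow> adj S a \<in> M"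
  using assms unfolding op_algebra_def by auto

lemma op_algebra_zero: assumes "op_algebra S M" shows "(\<lambda>_. 0) \<in> M"
proof -
  have "(\<lambda>x. 0 *\<^sub>C idop S x) \<in> M" using assms unfolding op_algebra_def by blast
  then show ?thesis by simp
qed

lemma op_algebra_bop: "hsub S \<Longrightarrow> op_algebra S (bop (S :: 'a::hilbert_space set))"
  by (auto simp: op_algebra_def bop_idop bop_plus bop_scaled bop_comp adj_bop)

lemma commutant_adj:
  fixes S :: "'a::hilbert_space set"
  assumes S: "hsub S" and M: "M \<subseteq> bop S" "\<And>a. a \<in> M \<Longrightarrow> adj S a \<in> M" and b: "b \<in> commutant S M"
  shows "adj S b \<in> commutant S M"
proof -
  have bb: "b \<in> bop S" by (rule commutant_bop[OF b])
  have "a \<circ> adj S b = adj S b \<circ> a" if a: "a \<in> M" for a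
  proof (rule bop_eqI[OF S])
    have ab: "a \<in> bop S" using a M by blast
    show "a \<circ> adj S b \<in> bop S" "adj S b \<circ> a \<in> bop S"
      by (intro bop_comp[OF S] ab adj_bop[OF S] bb)+
    fix x y assume xy: "x \<in> S" "y \<in> S"
    note [simp] = xy bop_in[OF ab] bop_in[OF bb] bop_in[OF adj_bop[OF S ab]] bop_in[OF adj_bop[OF S bb]]
    have "cinner x (a (adj S b y)) = cinner (b (adj S a x)) y"
      by (simp add: cinner_adj_right[OF S bb] flip: cinner_adj_left[OF S ab])
    also have "\<dots> = cinner (adj S a (b x)) y"
      using commutantD[OF b M(2)[OF a]] by simp
    also have "\<dots> = cinner x (adj S b (a y))"
      by (simp add: cinner_adj_right[OF S bb] cinner_adj_left[OF S ab])
    finally show "cinner x ((a \<circ> adj S b) y) = cinner x ((adj S b \<circ> a) y)" by simp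
  qed
  then show ?thesis using adj_bop[OF S bb] by (simp add: commutant_def)
qed

lemma op_algebra_commutant:
  fixes S :: "'a::hilbert_space set"
  assumes S: "hsub S" and M: "M \<subseteq> bop S" "\<And>a. a \<in> M \<Longrightarrow> adj S a \<in> M"
  shows "op_algebra S (commutant S M)"
  unfolding op_algebra_def
proof (intro conjI ballI allI)
  show "commutant S M \<subseteq> bop S" by (auto simp: commutant_def)
  show "idop S \<in> commutant S M"
    by (rule commutantI'[OF S M(1) bop_idop[OF S]]) (use M in \<open>auto simp: idop_def bop_in\<close>)
  fix b assume b: "b \<in> commutant S M"
  show "adj S b \<in> commutant S M" by (rule commutant_adj[OF S M b])
  note bb = commutant_bop[OF b]
  show "(\<lambda>x. c *\<^sub>C b x) \<in> commutant S M" for c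
    by (rule commutantI'[OF S M(1) bop_scaled[OF S bb]])
      (use M bb in \<open>auto simp: bop_in bop_scale commutantD[OF b] subset_iff\<close>)
  fix d assume d: "d \<in> commutant S M"
  note dd = commutant_bop[OF d]
  show "(\<lambda>x. b x + d x) \<in> commutant S M"
    by (rule commutantI'[OF S M(1) bop_plus[OF S bb dd]])
      (use M bb dd in \<open>auto simp: bop_in bop_add commutantD[OF b] commutantD[OF d] subset_iff\<close>)
  show "b \<circ> d \<in> commutant S M"
    by (rule commutantI[OF bop_comp[OF S bb dd]]) (simp add: commutantD[OF b] commutantD[OF d])
qed

lemma op_algebra_double_commutant:
  fixes S :: "'a::hilbert_space set"
  assumes S: "hsub S" and M: "M \<subseteq> bop S" "\<And>a. a \<in> M \<Longrightarrow> adj S a \<in> M"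
  shows "op_algebra S (commutant S (commutant S M))"
  by (rule op_algebra_commutant[OF S]) (use commutant_adj[OF S M] in \<open>auto simp: commutant_def\<close>)

text \<open>Continuity is traded for the series form, in which all computations with states are
  done.\<close>

lemma normal_state_iff:
  fixes S :: "'a::hilbert_space set"
  assumes S: "hsub S" and M: "op_algebra S M"
  shows "normal_state S M \<omega> \<longleftrightarrow>
     (\<forall>a\<in>M. \<forall>b\<in>M. \<omega> (\<lambda>x. a x + b x) = \<omega> a + \<omega> b)
     \<and> (\<forall>c. \<forall>a\<in>M. \<omega> (\<lambda>x. c *\<^sub>C a x) = c * \<omega> a)
     \<and> (\<forall>a\<in>M. \<omega> (adj S a \<circ> a) \<in> \<real>\<^sub>\<ge>\<^sub>0) \<and> \<omega> (idop S) = 1 \<and> normal_on S M \<omega>"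
proof -
  have Mb: "M \<subseteq> bop S" using M by (simp add: op_algebra_def)
  have "normal_on S M \<omega>" if "normal_state S M \<omega>"
    by (rule continuous_normal_on[OF S Mb op_algebra_zero[OF M]])
      (use that M in \<open>auto simp: normal_state_def op_algebra_def\<close>)
  with normal_on_continuous[OF S Mb, of \<omega>] show ?thesis unfolding normal_state_def by blast
qed

section \<open>Hilbert space tensor products\<close>

text \<open>The contraction \<langle>h| \<otimes> 1 from T to S, that is, the adjoint of y \<mapsto>
  \<tau> h y. Only its values on T are determined.\<close>

definition rcf :: "('a::complex_inner \<Rightarrow> 'b::complex_inner \<Rightarrow> 'c::complex_inner) \<Rightarrow> 'b set \<Rightarrow> 'c set \<Rightarrow> 'a \<Rightarrow> 'c \<Rightarrow> 'b" where
  "rcf \<tau> S T h = (SOME b. b \<in> bmap T S \<and> (\<forall>y\<in>S. \<forall>z\<in>T. cinner y (b z) = cinner (\<tau> h y) z))"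

text \<open>The slice map: the h, h' matrix entry of Z with respect to the first tensor factor,
  which is an operator on the second.\<close>

definition slice :: "('a::complex_inner \<Rightarrow> 'b::complex_inner \<Rightarrow> 'c::complex_inner) \<Rightarrow> 'b set \<Rightarrow> 'c set
    \<Rightarrow> 'a \<Rightarrow> 'a \<Rightarrow> ('c \<Rightarrow> 'c) \<Rightarrow> 'b \<Rightarrow> 'b" where
  "slice \<tau> S T h h' Z = res S (\<lambda>y. rcf \<tau> S T h (Z (\<tau> h' y)))"

lemma idop_apply [simp]: "x \<in> S \<Longrightarrow> idop S x = x"
  by (simp add: idop_def)

text \<open>A Hilbert space tensor product, characterised up to a unitary by inner products and
  totality; bilinearity and boundedness of \<tau> follow. The canonical maps of the definitions are
  instances, and so are \<open>mtensor\<close> and \<open>amp\<close>, which exhibit a given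
  representation as an amplification.\<close>

locale htensor =
  fixes \<tau> :: "'a::hilbert_space \<Rightarrow> 'b::hilbert_space \<Rightarrow> 'c::hilbert_space" and R S T
  assumes hR: "hsub R" and hS: "hsub S" and hT: "hsub T"
    and tau_in: "x \<in> R \<Longrightarrow> y \<in> S \<Longrightarrow> \<tau> x y \<in> T"
    and cinner_tau: "x \<in> R \<Longrightarrow> x' \<in> R \<Longrightarrow> y \<in> S \<Longrightarrow> y' \<in> S \<Longrightarrow>
      cinner (\<tau> x y) (\<tau> x' y') = cinner x x' * cinner y y'"
    and total: "z \<in> T \<Longrightarrow> (\<And>x y. x \<in> R \<Longrightarrow> y \<in> S \<Longrightarrow> cinner (\<tau> x y) z = 0) \<Longrightarrow> z = 0"
begin

text \<open>Statements about one factor are transferred to the other by this symmetry.\<close>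

lemma swap: "htensor (\<lambda>y x. \<tau> x y) S R T"
proof
  show "z = 0" if "z \<in> T" "\<And>y x. y \<in> S \<Longrightarrow> x \<in> R \<Longrightarrow> cinner (\<tau> x y) z = 0" for z
    by (rule total[OF that(1)]) (rule that(2))
qed (simp_all add: hR hS hT tau_in cinner_tau)

lemma tau_eqI:
  assumes "u \<in> T" "v \<in> T" "\<And>x y. x \<in> R \<Longrightarrow> y \<in> S \<Longrightarrow> cinner (\<tau> x y) u = cinner (\<tau> x y) v"
  shows "u = v"
  using total[OF hsub_diff[OF hT assms(1,2)]] assms(3) by (simp add: cinner_diff_right)

lemma tau_add_left: "x \<in> R \<Longrightarrow> x' \<in> R \<Longrightarrow> y \<in> S \<Longrightarrow> \<tau> (x + x') y = \<tau> x y + \<tau> x' y"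
  by (rule tau_eqI)
    (auto simp: tau_in hsub_add[OF hT] hsub_add[OF hR] cinner_tau cinner_add_right algebra_simps)

lemma tau_scale_left: "x \<in> R \<Longrightarrow> y \<in> S \<Longrightarrow> \<tau> (c *\<^sub>C x) y = c *\<^sub>C \<tau> x y"
  by (rule tau_eqI)
    (auto simp: tau_in hsub_scale[OF hT] hsub_scale[OF hR] cinner_tau cinner_scaleC_right)

lemma norm_tau: assumes "x \<in> R" "y \<in> S" shows "norm (\<tau> x y) = norm x * norm y"
proof -
  have "complex_of_real ((norm (\<tau> x y))\<^sup>2) = of_real ((norm x * norm y)\<^sup>2)"
    unfolding cinner_same[symmetric] cinner_tau[OF assms(1,1,2,2)]
    by (simp add: cinner_same power_mult_distrib)
  then have "(norm (\<tau> x y))\<^sup>2 = (norm x * norm y)\<^sup>2" by (simp only: of_real_eq_iff)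
  then show ?thesis by (simp add: power2_eq_iff_nonneg)
qed

lemma tau_bmap_left: assumes "y \<in> S" shows "(\<lambda>x. \<tau> x y) \<in> bmap R T"
  by (rule bmapI[where M = "norm y"])
    (use assms in \<open>auto simp: tau_in tau_add_left tau_scale_left norm_tau mult.commute\<close>)

lemmas tau_scale_right = htensor.tau_scale_left[OF swap]
lemmas tau_bmap_right = htensor.tau_bmap_left[OF swap]

text \<open>Elementary tensors separate T, so the adjoints of A and B agree on U, and then A and B
  agree on T. Passing to adjoints replaces an argument with density and continuity.\<close>

lemma tau_ext:
  fixes U :: "'d::hilbert_space set"
  assumes U: "hsub U" and A: "A \<in> bmap T U" and B: "B \<in> bmap T U"
    and eq: "\<And>x y. x \<in> R \<Longrightarrow> y \<in> S \<Longrightarrow> A (\<tau> x y) = B (\<tau> x y)" and z: "z \<in> T"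
  shows "A z = B z"
proof -
  obtain A' where A': "A' \<in> bmap U T" "\<And>x y. x \<in> T \<Longrightarrow> y \<in> U \<Longrightarrow> cinner x (A' y) = cinner (A x) y"
    using bmap_adjoint[OF hT U A] by blast
  obtain B' where B': "B' \<in> bmap U T" "\<And>x y. x \<in> T \<Longrightarrow> y \<in> U \<Longrightarrow> cinner x (B' y) = cinner (B x) y"
    using bmap_adjoint[OF hT U B] by blast
  have *: "A' u = B' u" if u: "u \<in> U" for u
    by (rule tau_eqI) (use u A' B' eq in \<open>auto simp: bmap_in tau_in\<close>)
  have d: "A z - B z \<in> U" by (intro hsub_diff U bmap_in[OF A] bmap_in[OF B] z)
  have "cinner (A z) (A z - B z) = cinner (B z) (A z - B z)"
    using A'(2)[OF z d] B'(2)[OF z d] *[OF d] by simp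
  then have "cinner (A z - B z) (A z - B z) = 0" by (simp add: cinner_diff_left)
  then show ?thesis by (simp add: cinner_eq_zero_iff)
qed

lemma bop_tau_ext:
  assumes "A \<in> bop T" "B \<in> bop T" "\<And>x y. x \<in> R \<Longrightarrow> y \<in> S \<Longrightarrow> A (\<tau> x y) = B (\<tau> x y)"
  shows "A = B"
proof
  fix z show "A z = B z"
    using tau_ext[OF hT bop_bmap[OF assms(1)] bop_bmap[OF assms(2)] assms(3)] assms(1,2)
    by (cases "z \<in> T") (auto simp: bop_outside)
qed

lemma bop_tau_inner_ext:
  assumes A: "A \<in> bop T" and B: "B \<in> bop T"
    and eq: "\<And>x y x' y'. x \<in> R \<Longrightarrow> y \<in> S \<Longrightarrow> x' \<in> R \<Longrightarrow> y' \<in> S \<Longrightarrow>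
      cinner (\<tau> x y) (A (\<tau> x' y')) = cinner (\<tau> x y) (B (\<tau> x' y'))"
  shows "A = B"
  by (rule bop_tau_ext[OF A B], rule tau_eqI) (use assms in \<open>auto simp: bop_in tau_in\<close>)

lemma rcf_props:
  assumes "h \<in> R"
  shows "rcf \<tau> S T h \<in> bmap T S \<and> (\<forall>y\<in>S. \<forall>z\<in>T. cinner y (rcf \<tau> S T h z) = cinner (\<tau> h y) z)"
proof -
  define P where "P b \<longleftrightarrow> b \<in> bmap T S \<and> (\<forall>y\<in>S. \<forall>z\<in>T. cinner y (b z) = cinner (\<tau> h y) z)" for b
  obtain b where "b \<in> bmap T S" "\<And>y z. y \<in> S \<Longrightarrow> z \<in> T \<Longrightarrow> cinner y (b z) = cinner (\<tau> h y) z"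
    using bmap_adjoint[OF hS hT tau_bmap_right[OF assms]] by (elim bexE) simp
  then have "P b" by (simp add: P_def)
  then have "P (SOME b. P b)" by (rule someI[of P b])
  then show ?thesis by (simp add: P_def rcf_def)
qed

lemma rcf_bmap: "h \<in> R \<Longrightarrow> rcf \<tau> S T h \<in> bmap T S"
  by (simp add: rcf_props)

lemma cinner_rcf: "h \<in> R \<Longrightarrow> y \<in> S \<Longrightarrow> z \<in> T \<Longrightarrow> cinner y (rcf \<tau> S T h z) = cinner (\<tau> h y) z"
  by (simp add: rcf_props)

lemma rcf_eqI:
  assumes "h \<in> R" "z \<in> T" "s \<in> S" "\<And>y. y \<in> S \<Longrightarrow> cinner y s = cinner (\<tau> h y) z"
  shows "rcf \<tau> S T h z = s"
proof -
  define d where "d = rcf \<tau> S T h z - s"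
  have "d \<in> S" unfolding d_def by (intro hsub_diff[OF hS] bmap_in[OF rcf_bmap] assms)
  then have "cinner d d = 0"
    using assms by (simp add: d_def[THEN arg_cong[where f = "cinner d"]] cinner_diff_right cinner_rcf)
  then show ?thesis by (simp add: cinner_eq_zero_iff d_def)
qed

lemma rcf_tau: "h \<in> R \<Longrightarrow> x \<in> R \<Longrightarrow> y \<in> S \<Longrightarrow> rcf \<tau> S T h (\<tau> x y) = cinner h x *\<^sub>C y"
  by (rule rcf_eqI) (auto simp: tau_in hsub_scale[OF hS] cinner_scaleC_right cinner_tau)

text \<open>As for scalar coefficients: with s the sum of the \<tau> d (c d) over a finite set, the
  squared norm of s - z is nonnegative.\<close>

lemma rcf_Bessel:
  assumes D: "orthonormal D" "D \<subseteq> R" and z: "z \<in> T"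
  shows "sqfam S D (\<lambda>d. rcf \<tau> S T d z)" "l2norm D (\<lambda>d. rcf \<tau> S T d z) \<le> norm z"
proof -
  let ?c = "\<lambda>d. rcf \<tau> S T d z"
  have cS: "?c d \<in> S" if "d \<in> D" for d using that D z by (intro bmap_in[OF rcf_bmap]) auto
  have fin: "(\<Sum>d\<in>F. (norm (?c d))\<^sup>2) \<le> (norm z)\<^sup>2" if F: "finite F" "F \<subseteq> D" for F
  proof -
    have FR: "d \<in> R" if "d \<in> F" for d using that F D by blast
    have FS: "?c d \<in> S" if "d \<in> F" for d using that F cS by blast
    define s where "s = (\<Sum>d\<in>F. \<tau> d (?c d))"
    have sz: "cinner s z = of_real (\<Sum>d\<in>F. (norm (?c d))\<^sup>2)"
      by (simp add: s_def cinner_sum_left cinner_rcf[symmetric] FR FS z cinner_same)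
    have "cinner s s = (\<Sum>d\<in>F. \<Sum>c\<in>F. cinner c d * cinner (?c c) (?c d))"
      by (simp add: s_def cinner_sum_left cinner_sum_right cinner_tau FR FS)
    also have "\<dots> = (\<Sum>d\<in>F. \<Sum>c\<in>F. if c = d then of_real ((norm (?c d))\<^sup>2) else 0)"
      using D F by (intro sum.cong refl) (auto simp: orthonormal_def cinner_same subset_iff)
    also have "\<dots> = of_real (\<Sum>d\<in>F. (norm (?c d))\<^sup>2)" using F by simp
    finally have ss: "(norm s)\<^sup>2 = (\<Sum>d\<in>F. (norm (?c d))\<^sup>2)" by (simp add: norm_eq_cinner[of s])
    have "0 \<le> (norm (s - z))\<^sup>2" by simp
    then show ?thesis unfolding norm_diff_sq sz ss by simp
  qed
  have sm: "(\<lambda>d. (norm (?c d))\<^sup>2) summable_on D"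
    by (rule nonneg_bdd_above_summable_on) (auto intro!: bdd_aboveI[of _ "(norm z)\<^sup>2"] fin)
  then show "sqfam S D ?c" using cS by (simp add: sqfam_def)
  show "l2norm D ?c \<le> norm z"
    unfolding l2norm_def by (rule real_le_lsqrt) (auto intro: infsum_le_finite_sums[OF sm fin])
qed

lemma rcf_add: "h \<in> R \<Longrightarrow> z \<in> T \<Longrightarrow> z' \<in> T \<Longrightarrow> rcf \<tau> S T h (z + z') = rcf \<tau> S T h z + rcf \<tau> S T h z'"
  by (rule bmap_add[OF rcf_bmap])
lemma rcf_scale: "h \<in> R \<Longrightarrow> z \<in> T \<Longrightarrow> rcf \<tau> S T h (c *\<^sub>C z) = c *\<^sub>C rcf \<tau> S T h z"
  by (rule bmap_scale[OF rcf_bmap])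

end

text \<open>The map \<open>1 \<otimes> b\<close>, obtained from its sesquilinear form in an orthonormal basis of \<open>R\<close>.\<close>

lemma tensor_map_right:
  assumes t: "htensor \<tau> R S T" and t': "htensor \<tau>' R S' T'" and D: "onb R D" and b: "b \<in> bmap S S'"
  shows "\<exists>B\<in>bmap T T'. (\<forall>x\<in>R. \<forall>y\<in>S. B (\<tau> x y) = \<tau>' x (b y)) \<and>
    (\<forall>u\<in>T'. \<forall>v\<in>T. ((\<lambda>d. cinner (rcf \<tau>' S' T' d u) (b (rcf \<tau> S T d v))) has_sum cinner u (B v)) D)"
proof -
  interpret t: htensor \<tau> R S T by (rule t)
  interpret t': htensor \<tau>' R S' T' by (rule t')
  have on: "orthonormal D" "D \<subseteq> R" using D by (auto simp: onb_def)
  define f where "f u v d = cinner (rcf \<tau>' S' T' d u) (b (rcf \<tau> S T d v))" for u v d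
  define F where "F u v = (\<Sum>\<^sub>\<infinity>d\<in>D. f u v d)" for u v
  obtain M where M: "M \<ge> 0" "\<And>x. x \<in> S \<Longrightarrow> norm (b x) \<le> M * norm x" by (rule bmap_bound[OF b]) blast
  have R: "d \<in> R" if "d \<in> D" for d using that on by blast
  have S: "rcf \<tau> S T d v \<in> S" if "d \<in> D" "v \<in> T" for d v
    using that R by (intro bmap_in[OF t.rcf_bmap]) auto
  have sm: "f u v summable_on D" and bd: "cmod (F u v) \<le> M * norm u * norm v"
    if u: "u \<in> T'" and v: "v \<in> T" for u v
  proof -
    note B1 = t'.rcf_Bessel[OF on u] and B2 = t.rcf_Bessel[OF on v]
    have le: "cmod (f u v d) \<le> M * (norm (rcf \<tau>' S' T' d u) * norm (rcf \<tau> S T d v))" if "d \<in> D" for d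
    proof -
      have "cmod (f u v d) \<le> norm (rcf \<tau>' S' T' d u) * norm (b (rcf \<tau> S T d v))"
        unfolding f_def by (rule Cauchy_Schwarz)
      also have "\<dots> \<le> norm (rcf \<tau>' S' T' d u) * (M * norm (rcf \<tau> S T d v))"
        by (intro mult_left_mono M S that v) simp
      finally show ?thesis by (simp add: mult_ac)
    qed
    have s: "(\<lambda>d. M * (norm (rcf \<tau>' S' T' d u) * norm (rcf \<tau> S T d v))) summable_on D"
      by (intro summable_on_cmult_right sqfam_product(1)[OF B1(1) B2(1)])
    have *: "(\<lambda>d. cmod (f u v d)) summable_on D"
      by (rule summable_on_comparison_test[OF s le]) auto
    then show "f u v summable_on D" by (rule abs_summable_summable)
    have "cmod (F u v) \<le> (\<Sum>\<^sub>\<infinity>d\<in>D. cmod (f u v d))"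
      unfolding F_def by (rule norm_infsum_bound[OF *])
    also have "\<dots> \<le> (\<Sum>\<^sub>\<infinity>d\<in>D. M * (norm (rcf \<tau>' S' T' d u) * norm (rcf \<tau> S T d v)))"
      by (rule infsum_mono[OF * s le])
    also have "\<dots> \<le> M * (l2norm D (\<lambda>d. rcf \<tau>' S' T' d u) * l2norm D (\<lambda>d. rcf \<tau> S T d v))"
      unfolding infsum_cmult_right' by (intro mult_left_mono sqfam_product(2)[OF B1(1) B2(1)] M)
    also have "\<dots> \<le> M * (norm u * norm v)"
      by (intro mult_left_mono mult_mono B1(2) B2(2) M norm_ge_zero l2norm_nonneg)
    finally show "cmod (F u v) \<le> M * norm u * norm v" by (simp add: mult.assoc)
  qed
  have "\<exists>B\<in>bmap T T'. \<forall>u\<in>T'. \<forall>v\<in>T. cinner u (B v) = F u v"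
  proof (rule form_operator[OF t'.hT _ _ _ _ bd t.hT])
    fix u v v' assume u: "u \<in> T'" and v: "v \<in> T" "v' \<in> T"
    have "F u (v + v') = (\<Sum>\<^sub>\<infinity>d\<in>D. f u v d + f u v' d)"
      unfolding F_def f_def
      by (rule infsum_cong) (simp add: R S t.rcf_add v bmap_add[OF b] cinner_add_right)
    then show "F u (v + v') = F u v + F u v'" unfolding F_def by (simp add: infsum_add sm u v)
  next
    fix u v c assume u: "u \<in> T'" and v: "v \<in> T"
    have "F u (c *\<^sub>C v) = (\<Sum>\<^sub>\<infinity>d\<in>D. c * f u v d)"
      unfolding F_def f_def
      by (rule infsum_cong) (simp add: R S t.rcf_scale v bmap_scale[OF b] cinner_scaleC_right)
    then show "F u (c *\<^sub>C v) = c * F u v" unfolding F_def by (simp add: infsum_cmult_right')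
  next
    fix u u' v assume u: "u \<in> T'" "u' \<in> T'" and v: "v \<in> T"
    have "F (u + u') v = (\<Sum>\<^sub>\<infinity>d\<in>D. f u v d + f u' v d)"
      unfolding F_def f_def
      by (rule infsum_cong) (simp add: R t'.rcf_add u cinner_add_left)
    then show "F (u + u') v = F u v + F u' v" unfolding F_def by (simp add: infsum_add sm u v)
  next
    fix u v c assume u: "u \<in> T'" and v: "v \<in> T"
    have "F (c *\<^sub>C u) v = (\<Sum>\<^sub>\<infinity>d\<in>D. cnj c * f u v d)"
      unfolding F_def f_def
      by (rule infsum_cong) (simp add: R t'.rcf_scale u cinner_scaleC_left)
    then show "F (c *\<^sub>C u) v = cnj c * F u v" unfolding F_def by (simp add: infsum_cmult_right')
  qed
  then obtain B where B: "B \<in> bmap T T'" "\<And>u v. u \<in> T' \<Longrightarrow> v \<in> T \<Longrightarrow> cinner u (B v) = F u v"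
    by blast
  have "B (\<tau> x y) = \<tau>' x (b y)" if x: "x \<in> R" and y: "y \<in> S" for x y
  proof (rule t'.tau_eqI)
    show "B (\<tau> x y) \<in> T'" by (intro bmap_in[OF B(1)] t.tau_in x y)
    show "\<tau>' x (b y) \<in> T'" by (intro t'.tau_in x bmap_in[OF b] y)
    fix x' y' assume x': "x' \<in> R" and y': "y' \<in> S'"
    have "cinner (\<tau>' x' y') (B (\<tau> x y)) = F (\<tau>' x' y') (\<tau> x y)"
      by (intro B t.tau_in t'.tau_in x y x' y')
    also have "\<dots> = (\<Sum>\<^sub>\<infinity>d\<in>D. (cinner x' d * cinner d x) * cinner y' (b y))"
      unfolding F_def f_def
    proof (rule infsum_cong)
      fix d assume "d \<in> D"
      then show "cinner (rcf \<tau>' S' T' d (\<tau>' x' y')) (b (rcf \<tau> S T d (\<tau> x y))) =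
          (cinner x' d * cinner d x) * cinner y' (b y)"
        using cinner_commute[of x' d]
        by (simp add: R t.rcf_tau t'.rcf_tau x y x' y' bmap_scale[OF b] cinner_scaleC_left
            cinner_scaleC_right)
    qed
    \<comment> \<open>On elementary tensors the form factorises, and Parseval in R sums the first
      factor.\<close>
    also have "\<dots> = cinner x' x * cinner y' (b y)"
      unfolding infsum_cmult_left' by (simp add: infsumI[OF Parseval[OF t.hR D x' x]])
    finally show "cinner (\<tau>' x' y') (B (\<tau> x y)) = cinner (\<tau>' x' y') (\<tau>' x (b y))"
      by (simp add: t'.cinner_tau x x' y y' bmap_in[OF b])
  qed
  moreover have "((\<lambda>d. cinner (rcf \<tau>' S' T' d u) (b (rcf \<tau> S T d v))) has_sum cinner u (B v)) D"
    if "u \<in> T'" "v \<in> T" for u v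
    using has_sum_infsum[OF sm[OF that]] unfolding B(2)[OF that] F_def unfolding f_def .
  ultimately show ?thesis using B(1) by blast
qed

section \<open>Operators on a tensor product and their slices\<close>

context htensor
begin

text \<open>The case b = 1 of \<open>tensor_map_right\<close>: the operator obtained there fixes all
  elementary tensors.\<close>

lemma tensor_Parseval:
  assumes D: "onb R D" and u: "u \<in> T" and v: "v \<in> T"
  shows "((\<lambda>d. cinner (rcf \<tau> S T d u) (rcf \<tau> S T d v)) has_sum cinner u v) D"
proof -
  have id: "id \<in> bmap S S" "id \<in> bmap T T" by (rule bmapI[where M = 1], auto)+
  obtain B where B: "B \<in> bmap T T" "\<And>x y. x \<in> R \<Longrightarrow> y \<in> S \<Longrightarrow> B (\<tau> x y) = \<tau> x (id y)"
    and Bs: "((\<lambda>d. cinner (rcf \<tau> S T d u) (id (rcf \<tau> S T d v))) has_sum cinner u (B v)) D"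
    using tensor_map_right[OF htensor_axioms htensor_axioms D id(1)] u v by blast
  have "B v = id v" by (rule tau_ext[OF hT B(1) id(2) _ v]) (simp add: B(2))
  with Bs show ?thesis by simp
qed

text \<open>a \<otimes> b is the product of 1 \<otimes> b and a \<otimes> 1, and the latter is of
  the former kind after swapping the factors.\<close>

lemma op_tensor_exists:
  assumes a: "a \<in> bop R" and b: "b \<in> bop S"
  shows "\<exists>z\<in>bop T. \<forall>x\<in>R. \<forall>y\<in>S. z (\<tau> x y) = \<tau> (a x) (b y)"
proof -
  obtain D where D: "onb R D" using ex_onb[OF hR] by blast
  obtain E where E: "onb S E" using ex_onb[OF hS] by blast
  obtain B where B: "B \<in> bmap T T" "\<And>x y. x \<in> R \<Longrightarrow> y \<in> S \<Longrightarrow> B (\<tau> x y) = \<tau> x (b y)"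
    using tensor_map_right[OF htensor_axioms htensor_axioms D bop_bmap[OF b]] by blast
  obtain A where A: "A \<in> bmap T T" "\<And>x y. x \<in> R \<Longrightarrow> y \<in> S \<Longrightarrow> A (\<tau> x y) = \<tau> (a x) y"
    using tensor_map_right[OF swap swap E bop_bmap[OF a]] by blast
  have "res T (B \<circ> A) \<in> bop T" by (rule res_bop[OF hT bmap_comp[OF A(1) B(1)]])
  moreover have "res T (B \<circ> A) (\<tau> x y) = \<tau> (a x) (b y)" if "x \<in> R" "y \<in> S" for x y
    using that by (simp add: res_apply tau_in A(2) B(2) bop_in[OF a])
  ultimately show ?thesis by blast
qed

abbreviation ot where "ot a b \<equiv> op_tensor \<tau> R S T a b"

lemma op_tensor_unique:
  assumes "z \<in> bop T" "\<And>x y. x \<in> R \<Longrightarrow> y \<in> S \<Longrightarrow> z (\<tau> x y) = \<tau> (a x) (b y)"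
  shows "ot a b = z"
  unfolding op_tensor_def
proof (rule the_equality)
  fix z' assume z': "z' \<in> bop T \<and> (\<forall>x\<in>R. \<forall>y\<in>S. z' (\<tau> x y) = \<tau> (a x) (b y))"
  show "z' = z" by (rule bop_tau_ext) (use z' assms in auto)
qed (use assms in auto)

lemma op_tensor_props:
  assumes "a \<in> bop R" "b \<in> bop S"
  shows "ot a b \<in> bop T \<and> (\<forall>x\<in>R. \<forall>y\<in>S. ot a b (\<tau> x y) = \<tau> (a x) (b y))"
proof -
  obtain z where z: "z \<in> bop T" "\<And>x y. x \<in> R \<Longrightarrow> y \<in> S \<Longrightarrow> z (\<tau> x y) = \<tau> (a x) (b y)"
    using op_tensor_exists[OF assms] by blast
  from op_tensor_unique[OF this] z show ?thesis by simp
qed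

lemma op_tensor_bop: "a \<in> bop R \<Longrightarrow> b \<in> bop S \<Longrightarrow> ot a b \<in> bop T"
  by (simp add: op_tensor_props)

lemma op_tensor_tau: "a \<in> bop R \<Longrightarrow> b \<in> bop S \<Longrightarrow> x \<in> R \<Longrightarrow> y \<in> S \<Longrightarrow> ot a b (\<tau> x y) = \<tau> (a x) (b y)"
  by (simp add: op_tensor_props)

lemma op_tensor_swap:
  assumes "a \<in> bop R" "b \<in> bop S"
  shows "op_tensor (\<lambda>y x. \<tau> x y) S R T b a = ot a b"
  by (rule htensor.op_tensor_unique[OF swap]) (auto simp: op_tensor_bop op_tensor_tau assms)

lemma op_tensor_comp:
  assumes "a \<in> bop R" "b \<in> bop S" "c \<in> bop R" "d \<in> bop S"
  shows "ot a b \<circ> ot c d = ot (a \<circ> c) (b \<circ> d)"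
  by (rule op_tensor_unique[symmetric])
    (use assms in \<open>auto simp: op_tensor_bop op_tensor_tau bop_in bop_comp hT\<close>)

lemma op_tensor_idop: "ot (idop R) (idop S) = idop T"
  by (rule op_tensor_unique) (auto simp: bop_idop hT tau_in)

lemma op_tensor_adj:
  assumes a: "a \<in> bop R" and b: "b \<in> bop S"
  shows "adj T (ot a b) = ot (adj R a) (adj S b)"
proof (rule op_tensor_unique[symmetric])
  show Z: "adj T (ot a b) \<in> bop T" by (intro adj_bop hT op_tensor_bop a b)
  note [simp] = a b tau_in bop_in[OF a] bop_in[OF b] bop_in[OF adj_bop[OF hR a]] bop_in[OF adj_bop[OF hS b]]
  fix x y assume [simp]: "x \<in> R" "y \<in> S"
  show "adj T (ot a b) (\<tau> x y) = \<tau> (adj R a x) (adj S b y)"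
    by (rule tau_eqI)
      (auto simp: bop_in[OF Z] cinner_adj_right[OF hT] cinner_adj_right[OF hR] cinner_adj_right[OF hS]
        op_tensor_bop op_tensor_tau cinner_tau)
qed

lemma op_tensor_add_left:
  assumes "a \<in> bop R" "a' \<in> bop R" "b \<in> bop S"
  shows "ot (\<lambda>x. a x + a' x) b = (\<lambda>z. ot a b z + ot a' b z)"
  by (rule op_tensor_unique)
    (use assms in \<open>auto simp: bop_plus hT op_tensor_bop op_tensor_tau tau_add_left bop_in\<close>)

lemma op_tensor_scale_left:
  assumes "a \<in> bop R" "b \<in> bop S"
  shows "ot (\<lambda>x. c *\<^sub>C a x) b = (\<lambda>z. c *\<^sub>C ot a b z)"
  by (rule op_tensor_unique)
    (use assms in \<open>auto simp: bop_scaled hT op_tensor_bop op_tensor_tau tau_scale_left bop_in\<close>)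

abbreviation sl where "sl h h' Z \<equiv> slice \<tau> S T h h' Z"

lemma slice_bop:
  assumes h: "h \<in> R" "h' \<in> R" and Z: "Z \<in> bop T"
  shows "sl h h' Z \<in> bop S"
proof -
  have "rcf \<tau> S T h \<circ> (Z \<circ> \<tau> h') \<in> bmap S S"
    by (rule bmap_comp[OF bmap_comp[OF tau_bmap_right[OF h(2)] bop_bmap[OF Z]] rcf_bmap[OF h(1)]])
  from res_bop[OF hS this] show ?thesis by (simp add: slice_def o_def)
qed

lemma cinner_slice:
  assumes "h \<in> R" "h' \<in> R" "Z \<in> bop T" "y \<in> S" "y' \<in> S"
  shows "cinner y (sl h h' Z y') = cinner (\<tau> h y) (Z (\<tau> h' y'))"
  using assms by (simp add: slice_def res_apply cinner_rcf tau_in bop_in)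

lemma slice_eqI:
  assumes "h \<in> R" "h' \<in> R" "Z \<in> bop T" "c \<in> bop S"
    "\<And>y y'. y \<in> S \<Longrightarrow> y' \<in> S \<Longrightarrow> cinner (\<tau> h y) (Z (\<tau> h' y')) = cinner y (c y')"
  shows "sl h h' Z = c"
  by (rule bop_eqI[OF hS slice_bop[OF assms(1-3)] assms(4)]) (use assms in \<open>simp add: cinner_slice\<close>)

text \<open>The matrix entries of the products of Y with a slice of Z are those of the products of 1
  \<otimes> Y with Z between elementary tensors.\<close>

lemma commute_iff_slices:
  assumes Z: "Z \<in> bop T" and Y: "Y \<in> bop S"
  shows "ot (idop R) Y \<circ> Z = Z \<circ> ot (idop R) Y \<longleftrightarrow>
    (\<forall>h\<in>R. \<forall>h'\<in>R. Y \<circ> sl h h' Z = sl h h' Z \<circ> Y)"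
proof -
  let ?Y = "ot (idop R) Y"
  have I: "idop R \<in> bop R" by (rule bop_idop[OF hR])
  have YT: "?Y \<in> bop T" by (rule op_tensor_bop[OF I Y])
  have 1: "cinner y ((sl h h' Z \<circ> Y) y') = cinner (\<tau> h y) ((Z \<circ> ?Y) (\<tau> h' y'))"
    if "h \<in> R" "h' \<in> R" "y \<in> S" "y' \<in> S" for h h' y y'
    using that by (simp add: cinner_slice Z bop_in[OF Y] op_tensor_tau I Y)
  have 2: "cinner y ((Y \<circ> sl h h' Z) y') = cinner (\<tau> h y) ((?Y \<circ> Z) (\<tau> h' y'))"
    if [simp]: "h \<in> R" "h' \<in> R" "y \<in> S" "y' \<in> S" for h h' y y'
  proof -
    have aY: "adj S Y \<in> bop S" by (rule adj_bop[OF hS Y])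
    have aI: "adj R (idop R) = idop R"
      by (rule adj_unique[OF hR I]) simp
    have "cinner y ((Y \<circ> sl h h' Z) y') = cinner (adj S Y y) (sl h h' Z y')"
      by (simp add: cinner_adj_left[OF hS Y] bop_in[OF slice_bop] Z)
    also have "\<dots> = cinner (\<tau> h (adj S Y y)) (Z (\<tau> h' y'))"
      by (simp add: cinner_slice Z bop_in[OF aY])
    also have "\<tau> h (adj S Y y) = adj T ?Y (\<tau> h y)"
      by (simp add: op_tensor_adj I Y aI op_tensor_tau aY)
    also have "cinner (adj T ?Y (\<tau> h y)) (Z (\<tau> h' y')) = cinner (\<tau> h y) ((?Y \<circ> Z) (\<tau> h' y'))"
      by (simp add: cinner_adj_left[OF hT YT] tau_in bop_in[OF Z])
    finally show ?thesis .
  qed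
  show ?thesis
  proof
    assume *: "?Y \<circ> Z = Z \<circ> ?Y"
    show "\<forall>h\<in>R. \<forall>h'\<in>R. Y \<circ> sl h h' Z = sl h h' Z \<circ> Y"
    proof (intro ballI)
      fix h h' assume h: "h \<in> R" "h' \<in> R"
      note s = slice_bop[OF h Z]
      show "Y \<circ> sl h h' Z = sl h h' Z \<circ> Y"
        by (rule bop_eqI[OF hS bop_comp[OF hS Y s] bop_comp[OF hS s Y]])
          (simp only: 1[OF h] 2[OF h] *)
    qed
  next
    assume *: "\<forall>h\<in>R. \<forall>h'\<in>R. Y \<circ> sl h h' Z = sl h h' Z \<circ> Y"
    show "?Y \<circ> Z = Z \<circ> ?Y"
      by (rule bop_tau_inner_ext[OF bop_comp[OF hT YT Z] bop_comp[OF hT Z YT]])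
        (simp only: 1[symmetric] 2[symmetric] *[rule_format])
  qed
qed

lemma slice_commutant:
  assumes Z: "Z \<in> bop T" and N: "N \<subseteq> bop S"
    and comm: "\<And>Y. Y \<in> N \<Longrightarrow> ot (idop R) Y \<circ> Z = Z \<circ> ot (idop R) Y" and h: "h \<in> R" "h' \<in> R"
  shows "sl h h' Z \<in> commutant S N"
proof -
  have "Y \<circ> sl h h' Z = sl h h' Z \<circ> Y" if "Y \<in> N" for Y
    using commute_iff_slices[OF Z, of Y] comm[OF that] N h that by auto
  then show ?thesis using slice_bop[OF h Z] by (simp add: commutant_def)
qed

text \<open>Commutation passes from generators to the von Neumann algebra that they generate,
  without topology: the slices of Z lie in the commutant of N, hence commute with Y, and commutation
  with all slices gives commutation with Z.\<close>

lemma commute_double_commutant_right: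
  assumes Z: "Z \<in> bop T" and N: "N \<subseteq> bop S"
    and comm: "\<And>Y. Y \<in> N \<Longrightarrow> ot (idop R) Y \<circ> Z = Z \<circ> ot (idop R) Y"
    and Y: "Y \<in> commutant S (commutant S N)"
  shows "ot (idop R) Y \<circ> Z = Z \<circ> ot (idop R) Y"
proof -
  have "Y \<circ> sl h h' Z = sl h h' Z \<circ> Y" if "h \<in> R" "h' \<in> R" for h h'
    using commutantD[OF Y slice_commutant[OF Z N comm that]] by (simp add: fun_eq_iff)
  then show ?thesis using commute_iff_slices[OF Z commutant_bop[OF Y]] by blast
qed

lemma commute_double_commutant_left:
  assumes Z: "Z \<in> bop T" and N: "N \<subseteq> bop R"
    and comm: "\<And>X. X \<in> N \<Longrightarrow> ot X (idop S) \<circ> Z = Z \<circ> ot X (idop S)"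
    and X: "X \<in> commutant R (commutant R N)"
  shows "ot X (idop S) \<circ> Z = Z \<circ> ot X (idop S)"
proof -
  have *: "op_tensor (\<lambda>y x. \<tau> x y) S R T (idop S) X = ot X (idop S)" if "X \<in> bop R" for X
    by (rule op_tensor_swap[OF that bop_idop[OF hS]])
  show ?thesis
    unfolding *[OF commutant_bop[OF X], symmetric]
  proof (rule htensor.commute_double_commutant_right[OF swap Z N _ X])
    fix Y assume Y: "Y \<in> N"
    then have "Y \<in> bop R" using N by blast
    with comm[OF Y] show "op_tensor (\<lambda>y x. \<tau> x y) S R T (idop S) Y \<circ> Z = Z \<circ> op_tensor (\<lambda>y x. \<tau> x y) S R T (idop S) Y"
      by (simp add: *)
  qed
qed

end

subsection \<open>The tensor powers\<close>

lemma cinner_ell2_eq: "cinner x y = (\<Sum>\<^sub>\<infinity>i. cnj (Rep_ell2 x i) * Rep_ell2 y i)"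
  by (simp add: cinner_ell2.rep_eq)

lift_definition ket :: "'i \<Rightarrow> 'i ell2" is "\<lambda>i j. if j = i then 1 else 0"
  subgoal for i
    by (subst summable_on_cong_neutral[where T = "{i}" and g = "\<lambda>_. 1"]) auto
  done

lemma cinner_ket: "cinner (ket i) v = Rep_ell2 v i"
proof -
  have "cinner (ket i) v = (\<Sum>\<^sub>\<infinity>j\<in>{i}. Rep_ell2 v j)"
    unfolding cinner_ell2_eq ket.rep_eq by (rule infsum_cong_neutral) auto
  then show ?thesis by simp
qed

lemma hsub_support: "hsub {v :: 'i ell2. \<forall>i. Rep_ell2 v i \<noteq> 0 \<longrightarrow> P i}"
  unfolding hsub_def
proof (intro conjI ballI allI)
  show "closed {v :: 'i ell2. \<forall>i. Rep_ell2 v i \<noteq> 0 \<longrightarrow> P i}"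
    unfolding closed_sequential_limits
  proof (intro allI impI, elim conjE)
    fix X and l :: "'i ell2"
    assume X: "\<forall>n. X n \<in> {v. \<forall>i. Rep_ell2 v i \<noteq> 0 \<longrightarrow> P i}" "X \<longlonglongrightarrow> l"
    have "Rep_ell2 l i = 0" if "\<not> P i" for i
    proof -
      have "(\<lambda>n. cinner (ket i) (X n)) \<longlonglongrightarrow> cinner (ket i) l" by (intro tendsto_intros X)
      moreover have "(\<lambda>n. cinner (ket i) (X n)) = (\<lambda>n. 0)" using X(1) that by (auto simp: cinner_ket)
      ultimately show ?thesis by (simp add: cinner_ket LIMSEQ_const_iff)
    qed
    then show "l \<in> {v. \<forall>i. Rep_ell2 v i \<noteq> 0 \<longrightarrow> P i}" by auto
  qed
\<comment> \<open>For sums, a nonzero coordinate of the sum forces a nonzero coordinate of a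
  summand.\<close>
qed (auto simp: zero_ell2.rep_eq plus_ell2.rep_eq scaleC_ell2.rep_eq, metis add_0)

lemma hsub_powspace: "hsub (powspace n)"
  unfolding powspace_def by (rule hsub_support)

lemma hsub_syspowspace: "hsub (syspowspace n)"
proof -
  have "syspowspace n = {v :: ('a \<times> 'b list) ell2. \<forall>i. Rep_ell2 v i \<noteq> 0 \<longrightarrow>
      fst i \<in> basis \<and> length (snd i) = n \<and> set (snd i) \<subseteq> basis}"
    by (auto simp: syspowspace_def)
  then show ?thesis by (simp only: hsub_support)
qed

lemma coord_Parseval:
  "(\<lambda>b. cnj (coord x b) * coord y b) summable_on UNIV"
  "(\<Sum>\<^sub>\<infinity>b. cnj (coord x b) * coord y b) = cinner x (y :: 'a::hilbert_space)"
proof -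
  have "((\<lambda>b. cinner x b * cinner b y) has_sum cinner x y) basis"
    by (rule Parseval[OF hsub_UNIV onb_basis]) auto
  also have "?this \<longleftrightarrow> ((\<lambda>b. cnj (coord x b) * coord y b) has_sum cinner x y) UNIV"
    using cinner_commute by (intro has_sum_cong_neutral) (auto simp: coord_def)
  finally show "(\<lambda>b. cnj (coord x b) * coord y b) summable_on UNIV"
    "(\<Sum>\<^sub>\<infinity>b. cnj (coord x b) * coord y b) = cinner x y"
    by (auto simp: has_sum_imp_summable infsumI)
qed

lemma Rep_ell2_Parseval: "(\<lambda>i. cnj (Rep_ell2 x i) * Rep_ell2 y i) summable_on UNIV"
  using square_summable_product[of "Rep_ell2 x" "Rep_ell2 y"] Rep_ell2[of x] Rep_ell2[of y] by simp

lemma infsum_product: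
  fixes f :: "'i \<Rightarrow> complex" and g :: "'j \<Rightarrow> complex"
  assumes f: "f summable_on UNIV" and g: "g summable_on UNIV"
  shows "(\<Sum>\<^sub>\<infinity>(i, j). f i * g j) = (\<Sum>\<^sub>\<infinity>i. f i) * (\<Sum>\<^sub>\<infinity>j. g j)"
proof -
  have f': "(\<lambda>i. cmod (f i)) summable_on UNIV" and g': "(\<lambda>j. cmod (g j)) summable_on UNIV"
    using f g unfolding summable_on_iff_abs_summable_on_complex by auto
  have "(\<lambda>(i, j). f i * g j) summable_on UNIV \<times> UNIV"
    by (rule summable_on_pairs(2)[where g = "\<lambda>i. cmod (f i) * (\<Sum>\<^sub>\<infinity>j. cmod (g j))"])
      (auto simp: norm_mult infsum_cmult_right' intro!: summable_on_cmult_right summable_on_cmult_left f' g')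
  from infsum_Sigma_banach[OF this]
  show ?thesis by (simp add: infsum_cmult_right' infsum_cmult_left')
qed

text \<open>The canonical maps multiply coordinates along a bijection between part of the index set
  and pairs, and vanish off this part. Their inner products are all computed by this
  formula.\<close>

lemma infsum_product_reindexed:
  fixes f :: "'i \<Rightarrow> complex" and g :: "'j \<Rightarrow> complex"
  assumes "f summable_on UNIV" "g summable_on UNIV" and p: "bij_betw p A UNIV"
    and "\<And>l. l \<in> A \<Longrightarrow> h l = f (fst (p l)) * g (snd (p l))" "\<And>l. l \<notin> A \<Longrightarrow> h l = 0"
  shows "(\<Sum>\<^sub>\<infinity>l. h l) = (\<Sum>\<^sub>\<infinity>i. f i) * (\<Sum>\<^sub>\<infinity>j. g j)"
proof -
  have "(\<Sum>\<^sub>\<infinity>l. h l) = (\<Sum>\<^sub>\<infinity>l\<in>A. (\<lambda>(i, j). f i * g j) (p l))"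
    by (rule infsum_cong_neutral) (auto simp: assms case_prod_unfold)
  also have "\<dots> = (\<Sum>\<^sub>\<infinity>(i, j). f i * g j)" by (rule infsum_reindex_bij_betw[OF p])
  also have "\<dots> = (\<Sum>\<^sub>\<infinity>i. f i) * (\<Sum>\<^sub>\<infinity>j. g j)" by (rule infsum_product[OF assms(1,2)])
  finally show ?thesis .
qed

lemma Rep_tensor_sys: "Rep_ell2 (tensor_sys x w) (b, bs) = coord x b * Rep_ell2 w bs"
  by (simp add: tensor_sys.rep_eq)

lemma Rep_tensor_pow: "Rep_ell2 (tensor_pow w y) bs =
    (if bs \<noteq> [] then Rep_ell2 w (butlast bs) * coord y (last bs) else 0)"
  by (simp add: tensor_pow.rep_eq)

lemma Rep_tensor_syspow: "Rep_ell2 (tensor_syspow v y) (b, bs) =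
    (if bs \<noteq> [] then Rep_ell2 v (b, butlast bs) * coord y (last bs) else 0)"
  by (simp add: tensor_syspow.rep_eq)

lemma cinner_tensor_sys:
  fixes x x' :: "'a::hilbert_space" and w w' :: "'b::hilbert_space list ell2"
  shows "cinner (tensor_sys x w) (tensor_sys x' w') = cinner x x' * cinner w w'"
  unfolding cinner_ell2_eq[of w] cinner_ell2_eq[of "tensor_sys x w"] coord_Parseval(2)[of x x', symmetric]
  by (rule infsum_product_reindexed[OF coord_Parseval(1) Rep_ell2_Parseval, where p = id and A = UNIV])
    (auto simp: Rep_tensor_sys)

lemma bij_butlast_last: "bij_betw (\<lambda>bs. (butlast bs, last bs)) (- {[]}) UNIV"
  by (rule bij_betwI[where g = "\<lambda>(ws, b). ws @ [b]"]) auto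

lemma bij_butlast_last': "bij_betw (\<lambda>(b, bs). ((b, butlast bs), last bs)) (UNIV \<times> - {[]}) UNIV"
  by (rule bij_betwI[where g = "\<lambda>((b, ws), c). (b, ws @ [c])"]) auto

lemma cinner_tensor_pow:
  fixes w w' :: "'b::hilbert_space list ell2"
  shows "cinner (tensor_pow w y) (tensor_pow w' y') = cinner w w' * cinner y y'"
  unfolding cinner_ell2_eq[of w] cinner_ell2_eq[of "tensor_pow w y"] coord_Parseval(2)[of y y', symmetric]
  by (rule infsum_product_reindexed[OF Rep_ell2_Parseval coord_Parseval(1) bij_butlast_last])
    (auto simp: Rep_tensor_pow)

lemma cinner_tensor_syspow:
  fixes v v' :: "('a::hilbert_space \<times> 'b::hilbert_space list) ell2"
  shows "cinner (tensor_syspow v y) (tensor_syspow v' y') = cinner v v' * cinner y y'"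
  unfolding cinner_ell2_eq[of v] cinner_ell2_eq[of "tensor_syspow v y"] coord_Parseval(2)[of y y', symmetric]
proof (rule infsum_product_reindexed[OF Rep_ell2_Parseval coord_Parseval(1) bij_butlast_last'])
  fix l :: "'a \<times> 'b list"
  obtain b bs where l: "l = (b, bs)" by (cases l)
  show "cnj (Rep_ell2 (tensor_syspow v y) l) * Rep_ell2 (tensor_syspow v' y') l = 0"
    if "l \<notin> UNIV \<times> - {[]}" using that by (simp add: l Rep_tensor_syspow)
  let ?p = "case l of (b, bs) \<Rightarrow> ((b, butlast bs), last bs)"
  show "cnj (Rep_ell2 (tensor_syspow v y) l) * Rep_ell2 (tensor_syspow v' y') l =
      cnj (Rep_ell2 v (fst ?p)) * Rep_ell2 v' (fst ?p) * (cnj (coord y (snd ?p)) * coord y' (snd ?p))"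
    if "l \<in> UNIV \<times> - {[]}" using that by (simp add: l Rep_tensor_syspow)
qed

lemma coord_basis: "b \<in> basis \<Longrightarrow> coord b c = (if c = b then 1 else 0)"
  using onb_basis unfolding onb_def orthonormal_def coord_def by auto

lemma ket_powspace: "length bs = n \<Longrightarrow> set bs \<subseteq> basis \<Longrightarrow> ket bs \<in> powspace n"
  by (auto simp: powspace_def ket.rep_eq split: if_splits)

lemma ket_syspowspace: "b \<in> basis \<Longrightarrow> length bs = n \<Longrightarrow> set bs \<subseteq> basis \<Longrightarrow> ket (b, bs) \<in> syspowspace n"
  by (auto simp: syspowspace_def ket.rep_eq split: if_splits)

lemma tensor_sys_ket: "b \<in> basis \<Longrightarrow> tensor_sys b (ket bs) = ket (b, bs)"
  by (rule Rep_ell2_inject[THEN iffD1]) (auto simp: fun_eq_iff Rep_tensor_sys ket.rep_eq coord_basis)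

lemma tensor_pow_ket: "b \<in> basis \<Longrightarrow> tensor_pow (ket bs) b = ket (bs @ [b])"
  by (rule Rep_ell2_inject[THEN iffD1])
    (auto simp: fun_eq_iff Rep_tensor_pow ket.rep_eq coord_basis append_eq_conv_conj snoc_eq_iff_butlast)

lemma tensor_syspow_ket: "c \<in> basis \<Longrightarrow> tensor_syspow (ket (b, bs)) c = ket (b, bs @ [c])"
  by (rule Rep_ell2_inject[THEN iffD1])
    (auto simp: fun_eq_iff Rep_tensor_syspow ket.rep_eq coord_basis snoc_eq_iff_butlast)

lemma ell2_eq_zeroI: "(\<And>i. Rep_ell2 z i = 0) \<Longrightarrow> z = 0"
  by (rule Rep_ell2_inject[THEN iffD1]) (auto simp: zero_ell2.rep_eq)

text \<open>For totality, each admissible coordinate of z is its inner product with an elementary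
  tensor of basis vectors, and the other coordinates vanish by membership in the subspace. The next
  two interpretations follow the same pattern.\<close>

interpretation sys: htensor "tensor_sys :: 'h::hilbert_space \<Rightarrow> 'k::hilbert_space list ell2 \<Rightarrow> _"
  UNIV "powspace n" "syspowspace n" for n
proof
  fix z :: "('h \<times> 'k list) ell2"
  assume z: "z \<in> syspowspace n" "\<And>x y. x \<in> UNIV \<Longrightarrow> y \<in> powspace n \<Longrightarrow> cinner (tensor_sys x y) z = 0"
  have "Rep_ell2 z (b, bs) = 0" for b bs
  proof (cases "b \<in> basis \<and> length bs = n \<and> set bs \<subseteq> basis")
    case True
    then show ?thesis using z(2)[OF UNIV_I ket_powspace, of bs b]
      by (simp add: tensor_sys_ket cinner_ket)
  qed (use z(1) in \<open>unfold syspowspace_def, blast\<close>)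
  then show "z = 0" by (intro ell2_eq_zeroI) auto
next
  show "tensor_sys x w \<in> syspowspace n" if "w \<in> powspace n" for x :: 'h and w :: "'k list ell2"
    using that by (auto simp: syspowspace_def powspace_def Rep_tensor_sys coord_def split: if_splits)
qed (simp_all add: hsub_powspace hsub_syspowspace cinner_tensor_sys)

interpretation pow: htensor "tensor_pow :: 'k::hilbert_space list ell2 \<Rightarrow> _"
  "powspace n" UNIV "powspace (Suc n)" for n
proof
  fix z :: "'k list ell2"
  assume z: "z \<in> powspace (Suc n)" "\<And>x y. x \<in> powspace n \<Longrightarrow> y \<in> UNIV \<Longrightarrow> cinner (tensor_pow x y) z = 0"
  have "Rep_ell2 z bs = 0" for bs
  proof (cases "length bs = Suc n \<and> set bs \<subseteq> basis")
    case True
    then obtain ws b where [simp]: "bs = ws @ [b]" by (cases bs rule: rev_cases) auto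
    show ?thesis using z(2)[OF ket_powspace UNIV_I, of ws b] True
      by (simp add: tensor_pow_ket cinner_ket)
  qed (use z(1) in \<open>auto simp: powspace_def\<close>)
  then show "z = 0" by (rule ell2_eq_zeroI)
next
  fix w :: "'k list ell2" and y :: 'k assume w: "w \<in> powspace n"
  show "tensor_pow w y \<in> powspace (Suc n)"
    unfolding powspace_def
  proof (intro CollectI allI impI)
    fix bs assume "Rep_ell2 (tensor_pow w y) bs \<noteq> 0"
    then have "bs \<noteq> []" "Rep_ell2 w (butlast bs) \<noteq> 0" "last bs \<in> basis"
      by (auto simp: Rep_tensor_pow coord_def split: if_splits)
    with w show "length bs = Suc n \<and> set bs \<subseteq> basis"
      by (cases bs rule: rev_cases) (auto simp: powspace_def)
  qed
qed (auto simp: hsub_powspace cinner_tensor_pow)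

interpretation syspow: htensor "tensor_syspow :: ('h::hilbert_space \<times> 'k::hilbert_space list) ell2 \<Rightarrow> _"
  "syspowspace n" UNIV "syspowspace (Suc n)" for n
proof
  fix z :: "('h \<times> 'k list) ell2"
  assume z: "z \<in> syspowspace (Suc n)"
    "\<And>x y. x \<in> syspowspace n \<Longrightarrow> y \<in> UNIV \<Longrightarrow> cinner (tensor_syspow x y) z = 0"
  have "Rep_ell2 z (b, bs) = 0" for b bs
  proof (cases "b \<in> basis \<and> length bs = Suc n \<and> set bs \<subseteq> basis")
    case True
    then obtain ws c where [simp]: "bs = ws @ [c]" by (cases bs rule: rev_cases) auto
    show ?thesis using z(2)[OF ket_syspowspace UNIV_I, of b ws c] True
      by (simp add: tensor_syspow_ket cinner_ket)
  qed (use z(1) in \<open>auto simp: syspowspace_def\<close>)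
  then show "z = 0" by (intro ell2_eq_zeroI) auto
next
  fix w :: "('h \<times> 'k list) ell2" and y :: 'k assume w: "w \<in> syspowspace n"
  show "tensor_syspow w y \<in> syspowspace (Suc n)"
    unfolding syspowspace_def
  proof (intro CollectI allI impI)
    fix b bs assume "Rep_ell2 (tensor_syspow w y) (b, bs) \<noteq> 0"
    then have "bs \<noteq> []" "Rep_ell2 w (b, butlast bs) \<noteq> 0" "last bs \<in> basis"
      by (auto simp: Rep_tensor_syspow coord_def split: if_splits)
    with w show "b \<in> basis \<and> length bs = Suc n \<and> set bs \<subseteq> basis"
      by (cases bs rule: rev_cases) (auto simp: syspowspace_def)
  qed
qed (auto simp: hsub_syspowspace cinner_tensor_syspow)

text \<open>The first tensor power is \<open>K\<close> itself up to the vacuum factor \<open>ket []\<close>.\<close>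

definition tensor_one :: "'h::hilbert_space \<Rightarrow> 'k::hilbert_space \<Rightarrow> ('h \<times> 'k list) ell2" where
  "tensor_one h k = tensor_sys h (tensor_pow (ket []) k)"

lemma ket_Nil: "ket [] \<in> powspace 0"
  by (rule ket_powspace) auto

lemma powspace_0: assumes "w \<in> powspace 0" shows "w = Rep_ell2 w [] *\<^sub>C ket []"
proof (rule Rep_ell2_inject[THEN iffD1], rule ext)
  fix bs show "Rep_ell2 w bs = Rep_ell2 (Rep_ell2 w [] *\<^sub>C ket []) bs"
    using assms by (cases bs) (auto simp: scaleC_ell2.rep_eq ket.rep_eq powspace_def)
qed

interpretation one: htensor "tensor_one :: 'h::hilbert_space \<Rightarrow> 'k::hilbert_space \<Rightarrow> _" UNIV UNIV "syspowspace (Suc 0)"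
proof
  show "tensor_one x y \<in> syspowspace (Suc 0)" for x :: 'h and y :: 'k
    unfolding tensor_one_def by (intro sys.tau_in pow.tau_in ket_Nil UNIV_I)
  show "cinner (tensor_one x y) (tensor_one x' y') = cinner x x' * cinner y y'" for x x' :: 'h and y y' :: 'k
    by (simp add: tensor_one_def cinner_tensor_sys cinner_tensor_pow cinner_ket ket.rep_eq)
  fix z :: "('h \<times> 'k list) ell2"
  assume z: "z \<in> syspowspace (Suc 0)" "\<And>x y. x \<in> UNIV \<Longrightarrow> y \<in> UNIV \<Longrightarrow> cinner (tensor_one x y) z = 0"
  show "z = 0"
  proof (rule sys.total[OF z(1)])
    fix x :: 'h and w :: "'k list ell2" assume w: "w \<in> powspace (Suc 0)"
    \<comment> \<open>Totality in two stages: the system factor is contracted with x, and what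
      remains in the first tensor power is tested against elementary tensors, whose vacuum part is a
      multiple of \<open>ket []\<close>.\<close>
    let ?r = "rcf tensor_sys (powspace (Suc 0)) (syspowspace (Suc 0)) x z"
    have r: "?r \<in> powspace (Suc 0)" by (rule bmap_in[OF sys.rcf_bmap z(1)]) simp
    have "?r = 0"
    proof (rule pow.total[OF r])
      fix v :: "'k list ell2" and y :: 'k assume v: "v \<in> powspace 0"
      have "cinner (tensor_pow (ket []) y) ?r = cinner (tensor_one x y) z"
        unfolding tensor_one_def by (rule sys.cinner_rcf[OF UNIV_I pow.tau_in[OF ket_Nil UNIV_I] z(1)])
      then have "cinner (tensor_pow (ket []) y) ?r = 0" using z(2) by simp
      then show "cinner (tensor_pow v y) ?r = 0"
        by (subst powspace_0[OF v]) (simp add: pow.tau_scale_left[OF ket_Nil] cinner_scaleC_left)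
    qed
    then show "cinner (tensor_sys x w) z = 0"
      using sys.cinner_rcf[OF UNIV_I w z(1), of x] by simp
  qed
qed (auto simp: hsub_syspowspace)

lemma first_copy_bop:
  fixes c :: "'k::hilbert_space \<Rightarrow> 'k"
  assumes "c \<in> bop UNIV" shows "first_copy c \<in> bop (powspace (Suc 0))"
  unfolding first_copy_def One_nat_def by (intro pow.op_tensor_bop bop_idop hsub_powspace assms)

text \<open>Brings the generators in the definition of \<open>tensor_id\<close> into the form of
  elementary tensors on H \<otimes> K.\<close>

lemma sys_tensor_first_copy:
  fixes a :: "'h::hilbert_space \<Rightarrow> 'h" and c :: "'k::hilbert_space \<Rightarrow> 'k"
  assumes "a \<in> bop UNIV" "c \<in> bop UNIV"
  shows "sys_tensor 1 a (first_copy c) = op_tensor tensor_one UNIV UNIV (syspowspace (Suc 0)) a c"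
  unfolding sys_tensor_def One_nat_def
proof (rule one.op_tensor_unique[symmetric])
  note f = first_copy_bop[OF assms(2)]
  show "sys.ot (Suc 0) a (first_copy c) \<in> bop (syspowspace (Suc 0))"
    by (rule sys.op_tensor_bop[OF assms(1) f])
  fix x y
  have "first_copy c (tensor_pow (ket []) y) = tensor_pow (idop (powspace 0) (ket [])) (c y)"
    unfolding first_copy_def One_nat_def
    by (rule pow.op_tensor_tau[OF bop_idop[OF hsub_powspace] assms(2) ket_Nil UNIV_I])
  then show "sys.ot (Suc 0) a (first_copy c) (tensor_one x y) = tensor_one (a x) (c y)"
    unfolding tensor_one_def sys.op_tensor_tau[OF assms(1) f UNIV_I pow.tau_in[OF ket_Nil UNIV_I]]
    by (simp add: ket_Nil)
qed

section \<open>Normal positive functionals on the bounded operators\<close>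

subsection \<open>Rank-one operators\<close>

definition ketbra :: "'a::complex_inner \<Rightarrow> 'a \<Rightarrow> 'a \<Rightarrow> 'a" where
  "ketbra x y = (\<lambda>z. cinner y z *\<^sub>C x)"

lemma norm_ketbra: "norm (ketbra x y z) \<le> (norm x * norm y) * norm z"
  using mult_right_mono[OF Cauchy_Schwarz[of y z] norm_ge_zero[of x]]
  by (simp add: ketbra_def norm_scaleC mult_ac)

lemma ketbra_bop: "ketbra x y \<in> bop UNIV"
  unfolding bop_UNIV_iff
  by (rule bmapI[where M = "norm x * norm y"])
    (auto simp: norm_ketbra, auto simp: ketbra_def cinner_add_right scaleC_add_left cinner_scaleC_right scaleC_scaleC)

lemma comp_ketbra: "a \<in> bop UNIV \<Longrightarrow> a \<circ> ketbra x y = ketbra (a x) y"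
  by (auto simp: ketbra_def bop_scale)

lemma ketbra_comp_ketbra: "ketbra x y \<circ> ketbra u v = (\<lambda>z. cinner y u *\<^sub>C ketbra x v z)"
  by (auto simp: ketbra_def cinner_scaleC_right scaleC_scaleC mult.commute)

lemma adj_ketbra: "adj UNIV (ketbra x y) = ketbra y (x :: 'a::hilbert_space)"
  by (rule adj_unique[OF hsub_UNIV ketbra_bop])
    (simp add: ketbra_def cinner_scaleC_left cinner_scaleC_right, metis cinner_commute mult.commute)

lemma ketbra_add_left: "ketbra (x + x') y = (\<lambda>z. ketbra x y z + ketbra x' y z)"
  by (auto simp: ketbra_def scaleC_add_right)

lemma ketbra_add_right: "ketbra x (y + y') = (\<lambda>z. ketbra x y z + ketbra x y' z)"
  by (auto simp: ketbra_def cinner_add_left scaleC_add_left)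

lemma ketbra_scale_left: "ketbra (c *\<^sub>C x) y = (\<lambda>z. c *\<^sub>C ketbra x y z)"
  by (auto simp: ketbra_def scaleC_scaleC mult.commute)

lemma ketbra_scale_right: "ketbra x (c *\<^sub>C y) = (\<lambda>z. cnj c *\<^sub>C ketbra x y z)"
  by (auto simp: ketbra_def cinner_scaleC_left scaleC_scaleC)

lemma resolution_ketbra:
  "resolution (UNIV :: 'a::hilbert_space set) basis (\<lambda>b. ketbra b b)"
proof -
  have on: "orthonormal (basis :: 'a set)" by (rule onb_basis[unfolded onb_def, THEN conjunct2, THEN conjunct1])
  have e: "cinner u (ketbra b b v) = cinner u b * cinner b v" for u v b :: 'a
    by (simp add: ketbra_def cinner_scaleC_right)
  show ?thesis
    unfolding resolution_def e
    using Parseval[OF hsub_UNIV onb_basis] abs_summable_onb_product[OF on] ketbra_bop by auto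
qed

subsection \<open>Cholesky decomposition of positive forms\<close>

definition psd :: "('a::complex_inner \<Rightarrow> 'a \<Rightarrow> complex) \<Rightarrow> bool" where
  "psd q \<longleftrightarrow> (\<forall>x y z. q x (y + z) = q x y + q x z) \<and> (\<forall>c x y. q x (c *\<^sub>C y) = c * q x y)
    \<and> (\<forall>x y. q y x = cnj (q x y)) \<and> (\<forall>x. 0 \<le> Re (q x x))"

context
  fixes q :: "'a::complex_inner \<Rightarrow> 'a \<Rightarrow> complex"
  assumes q: "psd q"
begin

lemma psd_add_right: "q x (y + z) = q x y + q x z"
  by (rule q[unfolded psd_def, THEN conjunct1, rule_format])
lemma psd_scale_right: "q x (c *\<^sub>C y) = c * q x y"
  by (rule q[unfolded psd_def, THEN conjunct2, THEN conjunct1, rule_format])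
lemma psd_commute: "q y x = cnj (q x y)"
  by (rule q[unfolded psd_def, THEN conjunct2, THEN conjunct2, THEN conjunct1, rule_format])
lemma psd_nonneg: "0 \<le> Re (q x x)"
  by (rule q[unfolded psd_def, THEN conjunct2, THEN conjunct2, THEN conjunct2, rule_format])
lemma psd_add_left: "q (x + y) z = q x z + q y z"
  by (subst psd_commute) (simp add: psd_add_right flip: psd_commute[where x = z])
lemma psd_scale_left: "q (c *\<^sub>C x) z = cnj c * q x z"
  by (subst psd_commute) (simp add: psd_scale_right flip: psd_commute[where x = z])
lemma psd_real: "q x x = of_real (Re (q x x))"
  using arg_cong[OF psd_commute[of x x], of Im] by (simp add: complex_eq_iff)

lemma psd_Cauchy_Schwarz: "(cmod (q x y))\<^sup>2 \<le> Re (q x x) * Re (q y y)"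
proof (rule psd_discriminant)
  fix t
  have yx: "q y x = cnj (q x y)" by (rule psd_commute)
  have yy: "q y y = of_real (Re (q y y))" by (rule psd_real)
  have tt: "cnj t * (t * q y y) = of_real ((cmod t)\<^sup>2 * Re (q y y))"
    by (subst yy) (simp add: complex_norm_square mult_ac flip: of_real_power)
  have "q (x + t *\<^sub>C y) (x + t *\<^sub>C y) = q x x + t * q x y + cnj t * cnj (q x y) + cnj t * (t * q y y)"
    by (simp add: psd_add_left psd_add_right psd_scale_left psd_scale_right yx algebra_simps)
  then have "Re (q (x + t *\<^sub>C y) (x + t *\<^sub>C y)) = Re (q x x) + 2 * Re (t * q x y) + (cmod t)\<^sup>2 * Re (q y y)"
    unfolding tt by simp
  with psd_nonneg[of "x + t *\<^sub>C y"]
  show "0 \<le> Re (q x x) + 2 * Re (t * q x y) + (cmod t)\<^sup>2 * Re (q y y)" by simp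
qed (rule psd_nonneg)+

end

text \<open>The Schur complement of q at e. If \<open>q e e\<close> is 0, division by zero leaves q
  unchanged, as it should: by Cauchy-Schwarz e is then in the radical of q.\<close>

definition schur :: "('a::complex_inner \<Rightarrow> 'a \<Rightarrow> complex) \<Rightarrow> 'a \<Rightarrow> 'a \<Rightarrow> 'a \<Rightarrow> complex" where
  "schur q e x y = q x y - q x e * q e y / q e e"

lemma schur_diag:
  assumes "psd q" shows "Re (schur q e x x) = Re (q x x) - (cmod (q e x))\<^sup>2 / Re (q e e)"
proof -
  have "q x e * q e x = of_real ((cmod (q e x))\<^sup>2)"
    unfolding psd_commute[OF assms, of x e] complex_norm_square by (rule mult.commute)
  then have "q x e * q e x / q e e = of_real ((cmod (q e x))\<^sup>2 / Re (q e e))"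
    by (subst psd_real[OF assms, of e]) simp
  then show ?thesis by (simp add: schur_def)
qed

lemma psd_schur:
  assumes q: "psd q" shows "psd (schur q e)"
  unfolding psd_def
proof (intro conjI allI)
  show "schur q e y x = cnj (schur q e x y)" for x y
    unfolding schur_def
    by (simp add: mult.commute flip: psd_commute[OF q])
  show "0 \<le> Re (schur q e x x)" for x
    unfolding schur_diag[OF q]
    using psd_Cauchy_Schwarz[OF q, of e x] psd_nonneg[OF q, of e] psd_nonneg[OF q, of x]
    by (cases "Re (q e e) = 0") (simp_all add: pos_divide_le_eq mult.commute)
qed (auto simp: schur_def psd_add_right[OF q] psd_scale_right[OF q] algebra_simps add_divide_distrib)

lemma schur_le: "psd q \<Longrightarrow> Re (schur q e x x) \<le> Re (q x x)"
  by (simp add: schur_diag psd_nonneg)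

lemma schur_self: assumes q: "psd q" shows "schur q e e y = 0"
proof (cases "q e e = 0")
  case True
  then have "q e y = 0" using psd_Cauchy_Schwarz[OF q, of e y] by simp
  then show ?thesis by (simp add: schur_def)
qed (simp add: schur_def)

text \<open>What remains of q after the first m vectors of e have been eliminated one by
  one.\<close>

primrec cholesky :: "('a::complex_inner \<Rightarrow> 'a \<Rightarrow> complex) \<Rightarrow> (nat \<Rightarrow> 'a) \<Rightarrow> nat \<Rightarrow> 'a \<Rightarrow> 'a \<Rightarrow> complex" where
  "cholesky q e 0 = q"
| "cholesky q e (Suc m) = schur (cholesky q e m) (e m)"

lemma psd_cholesky: "psd q \<Longrightarrow> psd (cholesky q e m)"
  by (induction m) (auto simp: psd_schur)

lemma cholesky_le: "psd q \<Longrightarrow> Re (cholesky q e m x x) \<le> Re (q x x)"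
  by (induction m) (auto intro: order_trans[OF schur_le] psd_cholesky)

lemma cholesky_kill:
  assumes q: "psd q" and "j < m" shows "cholesky q e m (e j) y = 0"
  using assms(2)
proof (induction m arbitrary: y)
  case (Suc m)
  show ?case
  proof (cases "j = m")
    case False
    then have "cholesky q e m (e j) z = 0" for z using Suc by simp
    then show ?thesis by (simp add: schur_def)
  qed (simp add: schur_self psd_cholesky q)
qed simp

lemma cholesky_bound:
  assumes q: "psd q" and M: "\<And>x. Re (q x x) \<le> M * (norm x)\<^sup>2"
  shows "cmod (cholesky q e m x y) \<le> \<bar>M\<bar> * norm x * norm y"
proof (rule power2_le_imp_le)
  have M': "Re (cholesky q e m x x) \<le> \<bar>M\<bar> * (norm x)\<^sup>2" for x
    by (rule order_trans[OF cholesky_le[OF q] order_trans[OF M]]) (intro mult_right_mono, auto)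
  have "(cmod (cholesky q e m x y))\<^sup>2 \<le> Re (cholesky q e m x x) * Re (cholesky q e m y y)"
    by (rule psd_Cauchy_Schwarz[OF psd_cholesky[OF q]])
  also have "\<dots> \<le> (\<bar>M\<bar> * (norm x)\<^sup>2) * (\<bar>M\<bar> * (norm y)\<^sup>2)"
    by (intro mult_mono M' psd_nonneg[OF psd_cholesky[OF q]]) auto
  finally show "(cmod (cholesky q e m x y))\<^sup>2 \<le> (\<bar>M\<bar> * norm x * norm y)\<^sup>2"
    by (simp add: power_mult_distrib power2_eq_square mult_ac)
qed simp

text \<open>Each eliminated vector is in the radical of all later remainders, so in its row the
  finite sums are eventually equal to q. The difference r of q and the full series is bounded and
  vanishes on the dense sequence e, hence everywhere. The e n may be dependent: a redundant one
  yields the zero vector.\<close>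

lemma cholesky_decomposition:
  fixes q :: "'a::hilbert_space \<Rightarrow> 'a \<Rightarrow> complex" and e :: "nat \<Rightarrow> 'a"
  assumes q: "psd q" and M: "\<And>x. Re (q x x) \<le> M * (norm x)\<^sup>2"
    and e: "\<And>x \<epsilon>. \<epsilon> > 0 \<Longrightarrow> \<exists>n. norm (x - e n) < \<epsilon>"
  shows "\<exists>z::nat \<Rightarrow> 'a. \<forall>x y. ((\<lambda>i. cinner x (z i) * cinner (z i) y) has_sum q x y) UNIV"
proof -
  let ?Q = "cholesky q e"
  note pQ = psd_cholesky[OF q]
  \<comment> \<open>The Riesz vector of the normalised row of e m; its rank-one form is the term
    subtracted at step m.\<close>
  have "\<exists>z. \<forall>y. ?Q m (e m) y / of_real (sqrt (Re (?Q m (e m) (e m)))) = cinner z y" for m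
  proof -
    have "\<exists>z\<in>UNIV. \<forall>y\<in>UNIV. ?Q m (e m) y / of_real (sqrt (Re (?Q m (e m) (e m)))) = cinner z y"
    proof (rule riesz[OF hsub_UNIV])
      fix y
      show "cmod (?Q m (e m) y / of_real (sqrt (Re (?Q m (e m) (e m)))))
          \<le> (\<bar>M\<bar> * norm (e m) / sqrt (Re (?Q m (e m) (e m)))) * norm y"
        using divide_right_mono[OF cholesky_bound[OF q M, where e = e and m = m and x = "e m" and y = y],
            of "sqrt (Re (?Q m (e m) (e m)))"] psd_nonneg[OF pQ, of e m "e m"]
        by (simp add: norm_divide)
    qed (simp_all add: psd_add_right[OF pQ] psd_scale_right[OF pQ] add_divide_distrib)
    then show ?thesis by simp
  qed
  then obtain z where z: "\<And>m y. ?Q m (e m) y / of_real (sqrt (Re (?Q m (e m) (e m)))) = cinner (z m) y"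
    by metis
  have zz: "cinner x (z m) * cinner (z m) y = ?Q m x (e m) * ?Q m (e m) y / ?Q m (e m) (e m)" for x y m
  proof -
    let ?s = "Re (?Q m (e m) (e m))"
    have "cinner x (z m) = ?Q m x (e m) / of_real (sqrt ?s)"
      by (subst cinner_commute, subst z[symmetric]) (simp flip: psd_commute[OF pQ])
    moreover have "of_real (sqrt ?s) * of_real (sqrt ?s) = ?Q m (e m) (e m)"
      by (subst (3) psd_real[OF pQ]) (simp add: psd_nonneg[OF pQ] flip: of_real_mult)
    ultimately show ?thesis by (simp flip: z)
  qed
  have step: "q x y = ?Q m x y + (\<Sum>i<m. cinner x (z i) * cinner (z i) y)" for x y m
    by (induction m) (simp_all add: zz schur_def)
  have fin: "(\<Sum>i\<in>F. (cmod (cinner (z i) x))\<^sup>2) \<le> M * (norm x)\<^sup>2" if F: "finite F" for F x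
  proof -
    obtain m where m: "F \<subseteq> {..<m}" using finite_nat_bounded[OF F] by blast
    have c: "Re (cinner x (z i) * cinner (z i) x) = (cmod (cinner (z i) x))\<^sup>2" for i
      by (subst cinner_commute) (simp only: cmod_power2, simp add: power2_eq_square)
    have "(\<Sum>i\<in>F. (cmod (cinner (z i) x))\<^sup>2) \<le> (\<Sum>i<m. (cmod (cinner (z i) x))\<^sup>2)"
      by (rule sum_mono2) (use m in auto)
    also have "\<dots> = Re (q x x) - Re (?Q m x x)"
      by (subst step[of x x m]) (simp add: c del: times_complex.sel)
    also have "\<dots> \<le> M * (norm x)\<^sup>2"
      using psd_nonneg[OF pQ, of e m x] M[of x] by linarith
    finally show ?thesis .
  qed
  have sq: "(\<lambda>i. (cmod (cinner (z i) x))\<^sup>2) summable_on UNIV"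
    and sqb: "(\<Sum>\<^sub>\<infinity>i. (cmod (cinner (z i) x))\<^sup>2) \<le> (sqrt \<bar>M\<bar> * norm x)\<^sup>2" for x
  proof -
    show s: "(\<lambda>i. (cmod (cinner (z i) x))\<^sup>2) summable_on UNIV"
      by (rule nonneg_bdd_above_summable_on) (auto intro!: bdd_aboveI[of _ "M * (norm x)\<^sup>2"] fin)
    have "(\<Sum>\<^sub>\<infinity>i. (cmod (cinner (z i) x))\<^sup>2) \<le> M * (norm x)\<^sup>2"
      by (rule infsum_le_finite_sums[OF s fin])
    also have "\<dots> \<le> (sqrt \<bar>M\<bar> * norm x)\<^sup>2"
      by (simp add: power_mult_distrib mult_right_mono)
    finally show "(\<Sum>\<^sub>\<infinity>i. (cmod (cinner (z i) x))\<^sup>2) \<le> (sqrt \<bar>M\<bar> * norm x)\<^sup>2" .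
  qed
  have abs: "(\<lambda>i. cmod (cinner x (z i) * cinner (z i) y)) summable_on UNIV"
    and absb: "(\<Sum>\<^sub>\<infinity>i. cmod (cinner x (z i) * cinner (z i) y)) \<le> \<bar>M\<bar> * norm x * norm y" for x y
    using Cauchy_Schwarz_family[OF sq sq sqb sqb, of x y]
    by (simp_all add: norm_mult cmod_cinner_commute[of x] mult_ac real_sqrt_mult_self)
  note sm = abs_summable_summable[OF abs]
  define r where "r x y = q x y - (\<Sum>\<^sub>\<infinity>i. cinner x (z i) * cinner (z i) y)" for x y
  have rb: "cmod (r x y) \<le> 2 * \<bar>M\<bar> * norm x * norm y" for x y
  proof -
    have "cmod (r x y) \<le> cmod (q x y) + cmod (\<Sum>\<^sub>\<infinity>i. cinner x (z i) * cinner (z i) y)"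
      unfolding r_def by (rule norm_triangle_ineq4)
    moreover have "cmod (q x y) \<le> \<bar>M\<bar> * norm x * norm y"
      using cholesky_bound[OF q M, of e 0 x y] by simp
    ultimately show ?thesis using norm_infsum_bound[OF abs, of x y] absb[of x y] by linarith
  qed
  have re: "r (e j) y = 0" for j y
  proof -
    have "(\<lambda>m. \<Sum>i<m. cinner (e j) (z i) * cinner (z i) y) \<longlonglongrightarrow> (\<Sum>\<^sub>\<infinity>i. cinner (e j) (z i) * cinner (z i) y)"
      using has_sum_imp_sums[OF has_sum_infsum[OF sm]] unfolding sums_def .
    moreover have "(\<lambda>m. \<Sum>i<m. cinner (e j) (z i) * cinner (z i) y) \<longlonglongrightarrow> q (e j) y"
    proof (rule tendsto_eventually, rule eventually_mono[OF eventually_gt_at_top[of j]])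
      fix m assume "j < m"
      then show "(\<Sum>i<m. cinner (e j) (z i) * cinner (z i) y) = q (e j) y"
        using step[of "e j" y m] cholesky_kill[OF q, of j m e y] by simp
    qed
    ultimately show ?thesis unfolding r_def using LIMSEQ_unique by fastforce
  qed
  have rd: "r (x - x') y = r x y - r x' y" for x x' y
  proof -
    have "q (x - x') y = q x y - q x' y"
      using psd_add_left[OF q, of "x - x'" x' y] by simp
    moreover have "(\<Sum>\<^sub>\<infinity>i. cinner x (z i) * cinner (z i) y) =
        (\<Sum>\<^sub>\<infinity>i. cinner (x - x') (z i) * cinner (z i) y) + (\<Sum>\<^sub>\<infinity>i. cinner x' (z i) * cinner (z i) y)"
      unfolding infsum_add[OF sm sm, symmetric] by (simp add: cinner_diff_left algebra_simps)
    ultimately show ?thesis by (simp add: r_def)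
  qed
  have "r x y = 0" for x y
  proof (rule ccontr)
    assume nz: "r x y \<noteq> 0"
    \<comment> \<open>The approximation below uses K + 1, since K may be 0.\<close>
    define K where "K = 2 * \<bar>M\<bar> * norm y"
    have K: "K \<ge> 0" by (simp add: K_def)
    obtain n where n: "norm (x - e n) < cmod (r x y) / (K + 1)"
      using e[of "cmod (r x y) / (K + 1)" x] nz K by auto
    have "cmod (r x y) \<le> K * norm (x - e n)"
      using rb[of "x - e n" y] rd[of x "e n" y] re[of n y] by (simp add: K_def mult_ac)
    also have "\<dots> \<le> (K + 1) * norm (x - e n)" by (intro mult_right_mono) auto
    also have "\<dots> < cmod (r x y)" using n K by (simp add: pos_less_divide_eq mult.commute)
    finally show False by simp
  qed
  then have "q x y = (\<Sum>\<^sub>\<infinity>i. cinner x (z i) * cinner (z i) y)" for x y by (simp add: r_def)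
  with has_sum_infsum[OF sm] show ?thesis by metis
qed

subsection \<open>Decomposition into vector functionals\<close>

text \<open>Normal states without normalisation, so that vector functionals of arbitrary vectors are
  covered.\<close>

definition pos_functional :: "'a::complex_inner set \<Rightarrow> ('a \<Rightarrow> 'a) set \<Rightarrow> (('a \<Rightarrow> 'a) \<Rightarrow> complex) \<Rightarrow> bool" where
  "pos_functional S M \<omega> \<longleftrightarrow>
     (\<forall>a\<in>M. \<forall>b\<in>M. \<omega> (\<lambda>x. a x + b x) = \<omega> a + \<omega> b)
     \<and> (\<forall>c. \<forall>a\<in>M. \<omega> (\<lambda>x. c *\<^sub>C a x) = c * \<omega> a)
     \<and> (\<forall>a\<in>M. \<omega> (adj S a \<circ> a) \<in> \<real>\<^sub>\<ge>\<^sub>0) \<and> normal_on S M \<omega>"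

lemma
  assumes "pos_functional S M \<omega>"
  shows pos_functional_add: "a \<in> M \<Longrightarrow> b \<in> M \<Longrightarrow> \<omega> (\<lambda>x. a x + b x) = \<omega> a + \<omega> b"
    and pos_functional_scale: "a \<in> M \<Longrightarrow> \<omega> (\<lambda>x. c *\<^sub>C a x) = c * \<omega> a"
    and pos_functional_pos: "a \<in> M \<Longrightarrow> \<omega> (adj S a \<circ> a) \<in> \<real>\<^sub>\<ge>\<^sub>0"
    and pos_functional_normal: "normal_on S M \<omega>"
  using assms unfolding pos_functional_def by simp_all

lemma normal_state_pos_functional:
  fixes S :: "'a::hilbert_space set"
  assumes "hsub S" "op_algebra S M"
  shows "normal_state S M \<omega> \<longleftrightarrow> pos_functional S M \<omega> \<and> \<omega> (idop S) = 1"
  unfolding normal_state_iff[OF assms] pos_functional_def by (simp only: conj_ac)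

lemma dense_sequence:
  assumes "separable_space (euclidean :: 'a::real_normed_vector topology)"
  shows "\<exists>e :: nat \<Rightarrow> 'a. \<forall>x. \<forall>\<epsilon>>0. \<exists>n. norm (x - e n) < \<epsilon>"
proof -
  obtain D :: "'a set" where D: "countable D" "closure D = UNIV"
    using assms unfolding separable_space_def by auto
  then have "D \<noteq> {}" by auto
  with D(1) have range: "range (from_nat_into D) = D" by (simp add: range_from_nat_into)
  have "\<exists>n. norm (x - from_nat_into D n) < \<epsilon>" if \<epsilon>: "\<epsilon> > 0" for x \<epsilon>
  proof -
    have "x \<in> closure D" using D(2) by simp
    then obtain d where "d \<in> D" "dist d x < \<epsilon>" using \<epsilon> unfolding closure_approachable by blast
    then show ?thesis using range by (metis dist_commute dist_norm imageE)
  qed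
  then show ?thesis by blast
qed

text \<open>The form q x y = \<omega> |y\<rangle>\<langle>x| is positive and bounded, and its
  Cholesky vectors are the z i. Normality then extends the agreement from rank-one operators to all
  operators and bounds the sum of the squared norms.\<close>

theorem pos_functional_decomposition:
  fixes \<omega> :: "('a::hilbert_space \<Rightarrow> 'a) \<Rightarrow> complex"
  assumes sep: "separable_space (euclidean :: 'a topology)" and \<omega>: "pos_functional UNIV (bop UNIV) \<omega>"
  shows "\<exists>z :: nat \<Rightarrow> 'a. sqfam UNIV UNIV z \<and> (\<forall>a\<in>bop UNIV. \<omega> a = uwf UNIV z z a)"
proof -
  have add: "\<omega> (\<lambda>x. a x + b x) = \<omega> a + \<omega> b" if "a \<in> bop UNIV" "b \<in> bop UNIV" for a b
    using \<omega> that unfolding pos_functional_def by blast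
  have sc: "\<omega> (\<lambda>x. c *\<^sub>C a x) = c * \<omega> a" if "a \<in> bop UNIV" for a c
    using \<omega> that unfolding pos_functional_def by blast
  have pos: "\<omega> (adj UNIV a \<circ> a) \<in> \<real>\<^sub>\<ge>\<^sub>0" if "a \<in> bop UNIV" for a
    using \<omega> that unfolding pos_functional_def by blast
  obtain u v :: "nat \<Rightarrow> 'a" where uv: "sqfam UNIV UNIV u" "sqfam UNIV UNIV v"
    and uw: "\<And>a. a \<in> bop UNIV \<Longrightarrow> \<omega> a = uwf UNIV u v a"
    using \<omega> unfolding pos_functional_def normal_on_def by blast
  obtain e :: "nat \<Rightarrow> 'a" where e: "\<And>x \<epsilon>. \<epsilon> > 0 \<Longrightarrow> \<exists>n. norm (x - e n) < \<epsilon>"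
    using dense_sequence[OF sep] by blast
  define q where "q x y = \<omega> (ketbra y x)" for x y
  have q_add_r: "q x (y + y') = q x y + q x y'" for x y y'
    by (simp add: q_def ketbra_add_left add ketbra_bop)
  have q_add_l: "q (x + x') y = q x y + q x' y" for x x' y
    by (simp add: q_def ketbra_add_right add ketbra_bop)
  have q_sc_r: "q x (c *\<^sub>C y) = c * q x y" for x y c
    by (simp add: q_def ketbra_scale_left sc ketbra_bop)
  have q_sc_l: "q (c *\<^sub>C x) y = cnj c * q x y" for x y c
    by (simp add: q_def ketbra_scale_right sc ketbra_bop)
  have q_pos: "q x x \<in> \<real>\<^sub>\<ge>\<^sub>0" for x
  proof (cases "x = 0")
    case True
    then have "q x x = 0" using q_sc_r[of x 0 x] by simp
    then show ?thesis by simp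
  next
    case False
    define n where "n = of_real (1 / norm x) *\<^sub>C x"
    have nn: "cinner n n = 1"
      unfolding n_def cinner_scaleC_left cinner_scaleC_right cinner_same[of x]
      using False by (simp add: power2_eq_square field_simps)
    \<comment> \<open>|x\<rangle>\<langle>x| has the form of an adjoint times operator, with the
      operator |n\<rangle>\<langle>x| for a unit vector n.\<close>
    have "adj UNIV (ketbra n x) \<circ> ketbra n x = ketbra x x"
      by (simp add: adj_ketbra ketbra_comp_ketbra nn)
    with pos[OF ketbra_bop, of n x] show ?thesis by (simp add: q_def)
  qed
  have q_comm: "q y x = cnj (q x y)" for x y
  proof -
    have im: "Im (q x x) = 0" for x
      using q_pos[of x] by (auto simp: nonneg_Reals_def complex_is_Real_iff[symmetric])
    \<comment> \<open>Polarisation: the diagonal is real, and x + y and x + \<i> y give imaginary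
      and real part of the Hermitian symmetry.\<close>
    have "Im (q x y) + Im (q y x) = 0"
      using im[of "x + y"] im[of x] im[of y] by (simp add: q_add_l q_add_r)
    moreover have "Re (q x y) - Re (q y x) = 0"
      using im[of "x + \<i> *\<^sub>C y"] im[of x] im[of y] by (simp add: q_add_l q_add_r q_sc_l q_sc_r)
    ultimately show ?thesis by (simp add: complex_eq_iff)
  qed
  have psd: "psd q"
    unfolding psd_def
    by (intro conjI allI q_add_r q_sc_r q_comm) (use q_pos in \<open>simp add: complex_nonneg_Reals_iff\<close>)
  have bd: "Re (q x x) \<le> (l2norm UNIV u * l2norm UNIV v) * (norm x)\<^sup>2" for x
  proof -
    have "Re (q x x) \<le> cmod (q x x)" by (rule complex_Re_le_cmod)
    also have "\<dots> \<le> (norm x * norm x) * (l2norm UNIV u * l2norm UNIV v)"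
      unfolding q_def uw[OF ketbra_bop] by (rule uwf_summable(3)[OF uv norm_ketbra]) auto
    finally show ?thesis by (simp add: power2_eq_square mult_ac)
  qed
  obtain z :: "nat \<Rightarrow> 'a" where z: "\<And>x y. ((\<lambda>i. cinner x (z i) * cinner (z i) y) has_sum q x y) UNIV"
    using cholesky_decomposition[OF psd bd e] by blast
  \<comment> \<open>A trace formula: inserting the rank-one resolution of the identity recovers
    \<omega> from q.\<close>
  have expand: "((\<lambda>b. q b (a b)) has_sum \<omega> a) basis" if a: "a \<in> bop UNIV" for a
    using uwf_resolution_right[OF hsub_UNIV resolution_ketbra uv a]
    unfolding uw[OF a, symmetric] comp_ketbra[OF a] uw[OF ketbra_bop, symmetric] q_def .
  have zsq: "((\<lambda>i. (cmod (cinner (z i) x))\<^sup>2) has_sum Re (q x x)) UNIV" for x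
  proof -
    have "Re (cinner x (z i) * cinner (z i) x) = (cmod (cinner (z i) x))\<^sup>2" for i
      by (subst cinner_commute) (simp only: cmod_power2, simp add: power2_eq_square)
    with has_sum_Re[OF z[of x x]] show ?thesis by simp
  qed
  \<comment> \<open>Summed over i first, this double family gives the diagonal of q, which sums to
    \<omega> 1 over the basis; summed over b first, it gives the squared norms of the z i.\<close>
  have "(\<lambda>(b, i). (cmod (cinner (z i) b))\<^sup>2) summable_on basis \<times> UNIV"
  proof (rule summable_on_SigmaI[where g = "\<lambda>b. Re (q b b)"])
    show "(\<lambda>b. Re (q b b)) summable_on basis"
      using has_sum_Re[OF expand[OF bop_idop[OF hsub_UNIV]]] by (simp add: has_sum_imp_summable)
  qed (use zsq in auto)
  then have "(\<lambda>(i, b). (cmod (cinner (z i) b))\<^sup>2) summable_on UNIV \<times> basis"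
    by (subst (asm) summable_on_swap) simp
  then have "(\<lambda>i. \<Sum>\<^sub>\<infinity>b\<in>basis. (cmod (cinner (z i) b))\<^sup>2) summable_on UNIV"
    by (rule summable_on_Sigma_banach)
  moreover have "(\<Sum>\<^sub>\<infinity>b\<in>basis. (cmod (cinner (z i) b))\<^sup>2) = (norm (z i))\<^sup>2" for i
    using infsumI[OF Parseval_norm[OF hsub_UNIV onb_basis, of "z i"]] by (simp add: cmod_cinner_commute)
  ultimately have sqz: "sqfam UNIV UNIV z" by (simp add: sqfam_def)
  have "\<omega> a = uwf UNIV z z a" if a: "a \<in> bop UNIV" for a
  proof -
    have "((\<lambda>b. uwf UNIV z z (ketbra (a b) b)) has_sum uwf UNIV z z a) basis"
      using uwf_resolution_right[OF hsub_UNIV resolution_ketbra sqz sqz a] unfolding comp_ketbra[OF a] .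
    moreover have "uwf UNIV z z (ketbra (a b) b) = q b (a b)" for b
      unfolding uwf_def
      using infsumI[OF z[of b "a b"]] by (simp add: ketbra_def cinner_scaleC_right)
    ultimately show ?thesis using expand[OF a] has_sum_unique by fastforce
  qed
  with sqz show ?thesis by blast
qed

section \<open>Product functionals\<close>

context htensor
begin

definition elementary :: "('a \<Rightarrow> 'a) set \<Rightarrow> ('b \<Rightarrow> 'b) set \<Rightarrow> ('c \<Rightarrow> 'c) set" where
  "elementary M N = {ot a b | a b. a \<in> M \<and> b \<in> N}"

lemma vn_tensor_eq: "vn_tensor \<tau> R S T M N = commutant T (commutant T (elementary M N))"
  by (simp add: vn_tensor_def elementary_def)

context
  fixes M N
  assumes M: "op_algebra R M" and N: "op_algebra S N"
begin

lemma elementary_bop: "elementary M N \<subseteq> bop T"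
  by (auto simp: elementary_def intro!: op_tensor_bop op_algebra_sub[OF M] op_algebra_sub[OF N])

lemma elementary_adj: assumes "z \<in> elementary M N" shows "adj T z \<in> elementary M N"
proof -
  obtain a b where z: "z = ot a b" and a: "a \<in> M" and b: "b \<in> N"
    using assms by (auto simp: elementary_def)
  have "adj T z = ot (adj R a) (adj S b)"
    unfolding z by (rule op_tensor_adj[OF op_algebra_sub[OF M a] op_algebra_sub[OF N b]])
  then show ?thesis
    using op_algebra_adj[OF M a] op_algebra_adj[OF N b] unfolding elementary_def by blast
qed

lemma vn_tensor_op_algebra: "op_algebra T (vn_tensor \<tau> R S T M N)"
  unfolding vn_tensor_eq by (rule op_algebra_double_commutant[OF hT elementary_bop elementary_adj])

lemma vn_tensor_double_commutant:
  "commutant T (commutant T (vn_tensor \<tau> R S T M N)) = vn_tensor \<tau> R S T M N"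
  unfolding vn_tensor_eq by (subst triple_commutant[OF elementary_bop]) (rule refl)

lemma op_tensor_in_vn_tensor: "a \<in> M \<Longrightarrow> b \<in> N \<Longrightarrow> ot a b \<in> vn_tensor \<tau> R S T M N"
  unfolding vn_tensor_eq using subset_double_commutant[OF elementary_bop]
  by (auto simp: elementary_def)

lemma vn_tensor_bop: "X \<in> vn_tensor \<tau> R S T M N \<Longrightarrow> X \<in> bop T"
  unfolding vn_tensor_eq by (rule commutant_bop)

text \<open>For Y in the commutant of N, 1 \<otimes> Y commutes with all elementary tensors and
  hence with X. The slices of X therefore commute with Y and lie in the double commutant of
  N.\<close>

lemma slice_in_factor:
  assumes NN: "commutant S (commutant S N) = N" and X: "X \<in> vn_tensor \<tau> R S T M N"
    and h: "h \<in> R" "h' \<in> R"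
  shows "sl h h' X \<in> N"
proof -
  have MR: "M \<subseteq> bop R" and NS: "N \<subseteq> bop S" using M N by (auto simp: op_algebra_def)
  have I: "idop R \<in> bop R" by (rule bop_idop[OF hR])
  have "sl h h' X \<in> commutant S (commutant S N)"
  proof (rule slice_commutant[OF vn_tensor_bop[OF X] _ _ h])
    fix Y assume Y: "Y \<in> commutant S N"
    note Yb = commutant_bop[OF Y]
    have "ot (idop R) Y \<in> commutant T (elementary M N)"
    proof (rule commutantI[OF op_tensor_bop[OF I Yb]])
      fix z v assume "z \<in> elementary M N"
      then obtain a b where z: "z = ot a b" and a: "a \<in> M" and b: "b \<in> N"
        by (auto simp: elementary_def)
      have ab: "a \<in> bop R" "b \<in> bop S" using a b MR NS by auto
      have "a \<circ> idop R = idop R \<circ> a"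
        using bop_in[OF ab(1)] bop_outside[OF ab(1)] bmap_zero[OF hR bop_bmap[OF ab(1)]]
        by (auto simp: fun_eq_iff idop_def hsub_zero[OF hR])
      moreover have "b \<circ> Y = Y \<circ> b" using commutantD[OF Y b] by (simp add: fun_eq_iff)
      ultimately have "ot a b \<circ> ot (idop R) Y = ot (idop R) Y \<circ> ot a b"
        by (simp add: op_tensor_comp ab I Yb)
      then show "z (ot (idop R) Y v) = ot (idop R) Y (z v)" by (simp add: z fun_eq_iff)
    qed
    then show "ot (idop R) Y \<circ> X = X \<circ> ot (idop R) Y"
      using commutantD[OF X[unfolded vn_tensor_eq]] by (simp add: fun_eq_iff)
  qed (auto dest: commutant_bop)
  then show ?thesis by (simp add: NN)
qed

end

lemma slice_add:
  assumes "X \<in> bop T" "Y \<in> bop T" "h \<in> R" "h' \<in> R"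
  shows "sl h h' (\<lambda>z. X z + Y z) = (\<lambda>y. sl h h' X y + sl h h' Y y)"
  by (rule slice_eqI) (use assms in \<open>auto simp: bop_plus hT hS slice_bop cinner_add_right cinner_slice\<close>)

context
  fixes X
  assumes X: "X \<in> bop T"
begin

lemma slice_scale:
  assumes "h \<in> R" "h' \<in> R" shows "sl h h' (\<lambda>z. c *\<^sub>C X z) = (\<lambda>y. c *\<^sub>C sl h h' X y)"
  by (rule slice_eqI) (use assms in \<open>auto simp: bop_scaled hT hS X slice_bop cinner_scaleC_right cinner_slice\<close>)

lemma slice_add_left:
  assumes "h \<in> R" "k \<in> R" "h' \<in> R" shows "sl (h + k) h' X = (\<lambda>y. sl h h' X y + sl k h' X y)"
  by (rule slice_eqI)
    (use assms in \<open>auto simp: bop_plus hsub_add[OF hR] hS X slice_bop cinner_add_right cinner_add_left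
      cinner_slice tau_add_left\<close>)

lemma slice_add_right:
  assumes "h \<in> R" "k \<in> R" "h' \<in> R" shows "sl h (h' + k) X = (\<lambda>y. sl h h' X y + sl h k X y)"
  by (rule slice_eqI)
    (use assms in \<open>auto simp: bop_plus hsub_add[OF hR] hS X slice_bop cinner_add_right
      cinner_slice tau_add_left bop_add[OF X] tau_in\<close>)

lemma slice_scale_left:
  assumes "h \<in> R" "h' \<in> R" shows "sl (c *\<^sub>C h) h' X = (\<lambda>y. cnj c *\<^sub>C sl h h' X y)"
  by (rule slice_eqI)
    (use assms in \<open>auto simp: bop_scaled hsub_scale[OF hR] hS X slice_bop cinner_scaleC_right cinner_scaleC_left
      cinner_slice tau_scale_left\<close>)

lemma slice_scale_right:
  assumes "h \<in> R" "h' \<in> R" shows "sl h (c *\<^sub>C h') X = (\<lambda>y. c *\<^sub>C sl h h' X y)"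
  by (rule slice_eqI)
    (use assms in \<open>auto simp: bop_scaled hsub_scale[OF hR] hS X slice_bop cinner_scaleC_right
      cinner_slice tau_scale_left bop_scale[OF X] tau_in\<close>)

end

lemma slice_op_tensor:
  assumes "h \<in> R" "h' \<in> R" "a \<in> bop R" "b \<in> bop S"
  shows "sl h h' (ot a b) = (\<lambda>y. cinner h (a h') *\<^sub>C b y)"
  by (rule slice_eqI)
    (use assms in \<open>auto simp: op_tensor_bop bop_scaled hS op_tensor_tau cinner_tau bop_in cinner_scaleC_right\<close>)

end

section \<open>Tensor products whose first factor is a whole Hilbert space type\<close>

locale htensor_full = htensor \<tau> UNIV S T
  for \<tau> :: "'a::hilbert_space \<Rightarrow> 'b::hilbert_space \<Rightarrow> 'c::hilbert_space" and S T
begin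

definition proj where "proj b = ot (ketbra b b) (idop S)"

lemma proj_bop: "proj b \<in> bop T"
  unfolding proj_def by (intro op_tensor_bop ketbra_bop bop_idop hS)

lemma proj_apply: assumes "v \<in> T" shows "proj b v = \<tau> b (rcf \<tau> S T b v)"
proof -
  have "\<tau> b \<circ> rcf \<tau> S T b \<in> bmap T T"
    by (rule bmap_comp[OF rcf_bmap tau_bmap_right]) auto
  from tau_ext[OF hT bop_bmap[OF proj_bop[of b]] this _ assms]
  show ?thesis
    by (simp add: proj_def op_tensor_tau ketbra_bop bop_idop hS rcf_tau tau_scale_right)
      (simp add: ketbra_def tau_scale_left)
qed

lemma cinner_proj:
  assumes "u \<in> T" "v \<in> T"
  shows "cinner u (proj b v) = cinner (rcf \<tau> S T b u) (rcf \<tau> S T b v)"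
proof -
  have r: "rcf \<tau> S T b v \<in> S" by (rule bmap_in[OF rcf_bmap assms(2)]) simp
  have "cinner (\<tau> b (rcf \<tau> S T b v)) u = cinner (rcf \<tau> S T b v) (rcf \<tau> S T b u)"
    by (rule cinner_rcf[symmetric, OF UNIV_I r assms(1)])
  then show ?thesis
    unfolding proj_apply[OF assms(2)] by (metis cinner_commute)
qed

lemma orthonormal_basis': "orthonormal (basis :: 'a set)"
  by (rule onb_basis[unfolded onb_def, THEN conjunct2, THEN conjunct1])

lemma resolution_proj: "resolution T basis proj"
  unfolding resolution_def
proof (intro conjI ballI)
  fix u v assume u: "u \<in> T" and v: "v \<in> T"
  note B1 = rcf_Bessel[OF orthonormal_basis' subset_UNIV u] and B2 = rcf_Bessel[OF orthonormal_basis' subset_UNIV v]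
  have id: "id \<in> bmap S S" by (rule bmapI[where M = 1]) auto
  note sp = sqfam_product[OF B1(1) B2(1)]
  show "((\<lambda>b. cinner u (proj b v)) has_sum cinner u v) basis"
    unfolding cinner_proj[OF u v] by (rule tensor_Parseval[OF onb_basis u v])
  have le: "cmod (cinner u (proj b v)) \<le> norm (rcf \<tau> S T b u) * norm (rcf \<tau> S T b v)" for b
    unfolding cinner_proj[OF u v] by (rule Cauchy_Schwarz)
  show s: "(\<lambda>b. cmod (cinner u (proj b v))) summable_on basis"
    by (rule summable_on_comparison_test[OF sp(1) le]) auto
  have "(\<Sum>\<^sub>\<infinity>b\<in>basis. cmod (cinner u (proj b v))) \<le>
      (\<Sum>\<^sub>\<infinity>b\<in>basis. norm (rcf \<tau> S T b u) * norm (rcf \<tau> S T b v))"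
    by (rule infsum_mono[OF s sp(1) le])
  also have "\<dots> \<le> norm u * norm v"
    by (rule order_trans[OF sp(2)]) (intro mult_mono B1(2) B2(2) l2norm_nonneg norm_ge_zero)
  finally show "(\<Sum>\<^sub>\<infinity>b\<in>basis. cmod (cinner u (proj b v))) \<le> norm u * norm v" .
qed (rule proj_bop)

text \<open>The b', b block of X is elementary: a matrix unit tensored with a slice.\<close>

lemma proj_sandwich:
  assumes X: "X \<in> bop T"
  shows "proj b' \<circ> (X \<circ> proj b) = ot (ketbra b' b) (sl b' b X)"
proof (rule bop_tau_ext)
  have s: "sl b' b X \<in> bop S" by (rule slice_bop[OF UNIV_I UNIV_I X])
  show "ot (ketbra b' b) (sl b' b X) \<in> bop T" by (intro op_tensor_bop ketbra_bop s)
  show "proj b' \<circ> (X \<circ> proj b) \<in> bop T" by (intro bop_comp hT X proj_bop)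
  fix x y assume y: "y \<in> S"
  have Xt: "X (\<tau> b y) \<in> T" by (intro bop_in[OF X] tau_in y UNIV_I)
  have r: "rcf \<tau> S T b' (X (\<tau> b y)) \<in> S" by (rule bmap_in[OF rcf_bmap Xt]) simp
  have "(proj b' \<circ> (X \<circ> proj b)) (\<tau> x y) = \<tau> b' (rcf \<tau> S T b' (X (\<tau> b (cinner b x *\<^sub>C y))))"
    using y by (simp add: proj_apply bop_in[OF X] tau_in rcf_tau hsub_scale[OF hS])
  also have "\<dots> = cinner b x *\<^sub>C \<tau> b' (rcf \<tau> S T b' (X (\<tau> b y)))"
    using y by (simp add: tau_scale_right bop_scale[OF X] tau_in rcf_scale Xt r)
  also have "\<dots> = ot (ketbra b' b) (sl b' b X) (\<tau> x y)"
    using y by (simp add: op_tensor_tau ketbra_bop s)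
      (simp add: ketbra_def tau_scale_left bop_in[OF s] slice_def res_apply r)
  finally show "(proj b' \<circ> (X \<circ> proj b)) (\<tau> x y) = ot (ketbra b' b) (sl b' b X) (\<tau> x y)" .
qed

text \<open>Expanding X on both sides along the projections \<open>proj b\<close> reduces a normal
  functional to the blocks of X, which are elementary tensors of a rank-one operator and an element
  of N. This takes the place of ultraweak density of the span of elementary tensors.\<close>

lemma normal_on_eqI:
  assumes N: "op_algebra S N" and NN: "commutant S (commutant S N) = N"
    and f: "normal_on T (vn_tensor \<tau> UNIV S T (bop UNIV) N) f"
    and g: "normal_on T (vn_tensor \<tau> UNIV S T (bop UNIV) N) g"
    and eq: "\<And>a d. a \<in> bop UNIV \<Longrightarrow> d \<in> N \<Longrightarrow> f (ot a d) = g (ot a d)"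
    and X: "X \<in> vn_tensor \<tau> UNIV S T (bop UNIV) N"
  shows "f X = g X"
proof -
  let ?V = "vn_tensor \<tau> UNIV S T (bop UNIV) N"
  note B = op_algebra_bop[OF hsub_UNIV, where 'a = 'a]
  have V: "op_algebra T ?V" by (rule vn_tensor_op_algebra[OF B N])
  have NI: "idop S \<in> N" by (rule op_algebra_idop[OF N])
  have pV: "proj b \<in> ?V" for b
    unfolding proj_def by (intro op_tensor_in_vn_tensor[OF B N] ketbra_bop NI)
  have Vc: "P \<circ> Q \<in> ?V" if "P \<in> ?V" "Q \<in> ?V" for P Q
    by (rule op_algebra_comp[OF V that])
  have Vb: "P \<in> bop T" if "P \<in> ?V" for P
    by (rule op_algebra_sub[OF V that])
  have expand: "((\<lambda>b. f (Y \<circ> proj b)) has_sum f Y) basis \<and> ((\<lambda>b. f (proj b \<circ> Y)) has_sum f Y) basis"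
    if f: "normal_on T ?V f" and Y: "Y \<in> ?V" for f Y
  proof -
    obtain x y :: "nat \<Rightarrow> 'c" where xy: "sqfam T UNIV x" "sqfam T UNIV y"
      and fe: "\<And>Z. Z \<in> ?V \<Longrightarrow> f Z = uwf UNIV x y Z" using f unfolding normal_on_def by blast
    show ?thesis
      using uwf_resolution_right[OF hT resolution_proj xy Vb[OF Y]]
        uwf_resolution_left[OF resolution_proj xy Vb[OF Y]]
      by (simp add: fe Vc Y pV)
  qed
  have "f (X \<circ> proj b) = g (X \<circ> proj b)" for b
  proof -
    have "f (proj b' \<circ> (X \<circ> proj b)) = g (proj b' \<circ> (X \<circ> proj b))" for b'
      unfolding proj_sandwich[OF Vb[OF X]]
      by (intro eq ketbra_bop slice_in_factor[OF B N NN X] UNIV_I)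
    with expand[OF f Vc[OF X pV], THEN conjunct2, of b] expand[OF g Vc[OF X pV], THEN conjunct2, of b]
    show ?thesis by (simp add: has_sum_unique)
  qed
  with expand[OF f X, THEN conjunct1] expand[OF g X, THEN conjunct1]
  show ?thesis by (simp add: has_sum_unique)
qed

context
  fixes N \<theta>
  assumes N: "op_algebra S N" and NN: "commutant S (commutant S N) = N" and \<theta>: "pos_functional S N \<theta>"
begin

abbreviation V where "V \<equiv> vn_tensor \<tau> UNIV S T (bop UNIV) N"

lemma V_op_algebra: "op_algebra T V"
  by (rule vn_tensor_op_algebra[OF op_algebra_bop[OF hsub_UNIV] N])

lemma V_bop: "X \<in> V \<Longrightarrow> X \<in> bop T"
  by (rule op_algebra_sub[OF V_op_algebra])

lemma slice_N: "X \<in> V \<Longrightarrow> sl h h' X \<in> N"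
  by (rule slice_in_factor[OF op_algebra_bop[OF hsub_UNIV] N NN _ UNIV_I UNIV_I])

text \<open>Inserting the resolution \<open>proj\<close> between \<open>adj T X\<close> and X writes
  the argument of \<theta> as a sum over b of adjoint times operator, the operator being the slice
  \<open>sl b h X\<close> in N.\<close>

lemma theta_slice_pos:
  assumes X: "X \<in> V"
  shows "\<theta> (sl h h (adj T X \<circ> X)) \<in> \<real>\<^sub>\<ge>\<^sub>0"
proof -
  obtain x y :: "nat \<Rightarrow> 'b" where x: "sqfam S UNIV x" and y: "sqfam S UNIV y"
    and fe: "\<And>Z. Z \<in> N \<Longrightarrow> \<theta> Z = uwf UNIV x y Z"
    using pos_functional_normal[OF \<theta>] unfolding normal_on_def by blast
  note Xb = V_bop[OF X]
  have XX: "adj T X \<circ> X \<in> V" by (intro op_algebra_comp[OF V_op_algebra] op_algebra_adj[OF V_op_algebra] X)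
  have xS: "x i \<in> S" and yS: "y i \<in> S" for i using x y by (auto simp: sqfam_def)
  have tm: "X \<circ> \<tau> h \<in> bmap S T" by (rule bmap_comp[OF tau_bmap_right[OF UNIV_I] bop_bmap[OF Xb]])
  have u: "sqfam T UNIV (\<lambda>i. X (\<tau> h (x i)))" and v: "sqfam T UNIV (\<lambda>i. X (\<tau> h (y i)))"
    using sqfam_image[OF x tm] sqfam_image[OF y tm] by simp_all
  have "((\<lambda>b. \<Sum>\<^sub>\<infinity>i. cinner (X (\<tau> h (x i))) (proj b (X (\<tau> h (y i))))) has_sum
      (\<Sum>\<^sub>\<infinity>i. cinner (X (\<tau> h (x i))) (X (\<tau> h (y i))))) basis"
    by (rule resolution_sum[OF resolution_proj u v])
  moreover have "(\<Sum>\<^sub>\<infinity>i. cinner (X (\<tau> h (x i))) (X (\<tau> h (y i)))) = \<theta> (sl h h (adj T X \<circ> X))"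
    unfolding fe[OF slice_N[OF XX]] uwf_def
    by (rule infsum_cong)
      (simp add: cinner_slice V_bop[OF XX] xS yS cinner_adj_right[OF hT Xb] bop_in[OF Xb] tau_in)
  moreover have "(\<Sum>\<^sub>\<infinity>i. cinner (X (\<tau> h (x i))) (proj b (X (\<tau> h (y i))))) \<in> \<real>\<^sub>\<ge>\<^sub>0" for b
  proof -
    let ?Y = "sl b h X"
    note YN = slice_N[OF X, of b h]
    have Yb: "?Y \<in> bop S" by (rule slice_bop[OF UNIV_I UNIV_I Xb])
    have YY: "adj S ?Y \<circ> ?Y \<in> N" by (intro op_algebra_comp[OF N] op_algebra_adj[OF N] YN)
    have "(\<Sum>\<^sub>\<infinity>i. cinner (X (\<tau> h (x i))) (proj b (X (\<tau> h (y i))))) = uwf UNIV x y (adj S ?Y \<circ> ?Y)"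
      unfolding uwf_def
    proof (rule infsum_cong)
      fix i
      have "cinner (X (\<tau> h (x i))) (proj b (X (\<tau> h (y i)))) = cinner (?Y (x i)) (?Y (y i))"
        by (simp add: cinner_proj bop_in[OF Xb] tau_in xS yS slice_def res_apply)
      then show "cinner (X (\<tau> h (x i))) (proj b (X (\<tau> h (y i)))) = cinner (x i) ((adj S ?Y \<circ> ?Y) (y i))"
        by (simp add: cinner_adj_right[OF hS Yb] xS yS bop_in[OF Yb])
    qed
    then show ?thesis using pos_functional_pos[OF \<theta> YN] fe[OF YY] by simp
  qed
  ultimately have hs: "((\<lambda>b. \<Sum>\<^sub>\<infinity>i. cinner (X (\<tau> h (x i))) (proj b (X (\<tau> h (y i))))) has_sum
      \<theta> (sl h h (adj T X \<circ> X))) basis"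
    and p: "\<And>b. (\<Sum>\<^sub>\<infinity>i. cinner (X (\<tau> h (x i))) (proj b (X (\<tau> h (y i))))) \<in> \<real>\<^sub>\<ge>\<^sub>0" by simp_all
  have "((\<lambda>b. Re (\<Sum>\<^sub>\<infinity>i. cinner (X (\<tau> h (x i))) (proj b (X (\<tau> h (y i)))))) has_sum
      Re (\<theta> (sl h h (adj T X \<circ> X)))) basis" by (rule has_sum_Re[OF hs])
  then have "0 \<le> Re (\<theta> (sl h h (adj T X \<circ> X)))"
    by (rule has_sum_nonneg) (use p in \<open>simp add: complex_nonneg_Reals_iff\<close>)
  \<comment> \<open>All terms are nonnegative reals, so the imaginary parts form the zero
    series.\<close>
  moreover have "((\<lambda>b. Im (\<Sum>\<^sub>\<infinity>i. cinner (X (\<tau> h (x i))) (proj b (X (\<tau> h (y i)))))) has_sum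
      Im (\<theta> (sl h h (adj T X \<circ> X)))) basis" by (rule has_sum_Im[OF hs])
  then have "((\<lambda>b. 0) has_sum Im (\<theta> (sl h h (adj T X \<circ> X)))) (basis :: 'a set)"
    using p by (simp add: complex_nonneg_Reals_iff)
  then have "Im (\<theta> (sl h h (adj T X \<circ> X))) = 0" using has_sum_unique[OF _ has_sum_0_simp] by blast
  ultimately show ?thesis by (simp add: complex_nonneg_Reals_iff)
qed

text \<open>If \<theta> is the series of the families x and y, the sum over m is the series of the
  \<tau> (\<zeta> m) (x i) and \<tau> (\<zeta> m) (y i). These are square-summable because norms
  multiply.\<close>

lemma theta_slice_normal:
  assumes \<zeta>: "sqfam UNIV UNIV (\<zeta> :: nat \<Rightarrow> 'a)"
  shows "\<exists>u v :: nat \<times> nat \<Rightarrow> 'c. sqfam T UNIV u \<and> sqfam T UNIV v \<and>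
    (\<forall>X\<in>V. ((\<lambda>m. \<theta> (sl (\<zeta> m) (\<zeta> m) X)) has_sum uwf UNIV u v X) UNIV)"
proof -
  obtain x y :: "nat \<Rightarrow> 'b" where x: "sqfam S UNIV x" and y: "sqfam S UNIV y"
    and fe: "\<And>Z. Z \<in> N \<Longrightarrow> \<theta> Z = uwf UNIV x y Z"
    using pos_functional_normal[OF \<theta>] unfolding normal_on_def by blast
  have sq: "sqfam T UNIV (\<lambda>(m, i). \<tau> (\<zeta> m) (z i))" if z: "sqfam S UNIV z" for z :: "nat \<Rightarrow> 'b"
  proof -
    have "(\<lambda>(m, i). (norm (\<zeta> m))\<^sup>2 * (norm (z i))\<^sup>2) summable_on UNIV \<times> UNIV"
      by (rule summable_on_SigmaI[where g = "\<lambda>m. (norm (\<zeta> m))\<^sup>2 * (\<Sum>\<^sub>\<infinity>i. (norm (z i))\<^sup>2)"])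
        (use \<zeta> z in \<open>auto simp: sqfam_def intro!: has_sum_cmult_right summable_on_cmult_left\<close>)
    moreover have "norm (\<tau> (\<zeta> m) (z i)) = norm (\<zeta> m) * norm (z i)" for m i
      using z by (intro norm_tau) (auto simp: sqfam_def)
    ultimately show ?thesis
      using z by (auto simp: sqfam_def case_prod_unfold power_mult_distrib tau_in)
  qed
  define u where "u = (\<lambda>(m, i). \<tau> (\<zeta> m) (x i))"
  define v where "v = (\<lambda>(m, i). \<tau> (\<zeta> m) (y i))"
  have u: "sqfam T UNIV u" and v: "sqfam T UNIV v" unfolding u_def v_def by (rule sq[OF x], rule sq[OF y])
  have "((\<lambda>m. \<theta> (sl (\<zeta> m) (\<zeta> m) X)) has_sum uwf UNIV u v X) UNIV" if X: "X \<in> V" for X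
  proof -
    note Xb = V_bop[OF X]
    have sm: "(\<lambda>p. cinner (u p) (X (v p))) summable_on UNIV \<times> UNIV"
      using uwf_summable_bmap(2)[OF u v bop_bmap[OF Xb]] by simp
    have "((\<lambda>p. cinner (u p) (X (v p))) has_sum uwf UNIV u v X) (UNIV \<times> UNIV)"
      using has_sum_infsum[OF sm] by (simp add: uwf_def)
    moreover have "((\<lambda>i. cinner (u (m, i)) (X (v (m, i)))) has_sum \<theta> (sl (\<zeta> m) (\<zeta> m) X)) UNIV" for m
    proof -
      have "cinner (u (m, i)) (X (v (m, i))) = cinner (x i) (sl (\<zeta> m) (\<zeta> m) X (y i))" for i
        using x y by (simp add: u_def v_def cinner_slice Xb sqfam_def)
      moreover have "((\<lambda>i. cinner (x i) (sl (\<zeta> m) (\<zeta> m) X (y i))) has_sum \<theta> (sl (\<zeta> m) (\<zeta> m) X)) UNIV"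
        unfolding fe[OF slice_N[OF X]] uwf_def
        by (rule has_sum_infsum, rule uwf_summable_bmap(2)[OF x y bop_bmap[OF slice_bop[OF UNIV_I UNIV_I Xb]]])
      ultimately show ?thesis by simp
    qed
    ultimately show ?thesis by (rule has_sum_SigmaD)
  qed
  with u v show ?thesis by blast
qed

lemma theta_slice_functional: "pos_functional T V (\<lambda>X. \<theta> (sl h h X))"
proof -
  \<comment> \<open>A family with a single nonzero member reduces one slice to the summed
    case.\<close>
  define \<zeta> :: "nat \<Rightarrow> 'a" where "\<zeta> m = (if m = 0 then h else 0)" for m
  have "(\<lambda>m. (norm (\<zeta> m))\<^sup>2) summable_on UNIV"
    by (subst summable_on_cong_neutral[where T = "{0}" and g = "\<lambda>m. (norm (\<zeta> m))\<^sup>2"]) (auto simp: \<zeta>_def)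
  then have "sqfam UNIV UNIV \<zeta>" by (simp add: sqfam_def)
  from theta_slice_normal[OF this] obtain u v :: "nat \<times> nat \<Rightarrow> 'c" where u: "sqfam T UNIV u" and v: "sqfam T UNIV v"
    and hs: "\<And>X. X \<in> V \<Longrightarrow> ((\<lambda>m. \<theta> (sl (\<zeta> m) (\<zeta> m) X)) has_sum uwf UNIV u v X) UNIV"
    by blast
  have zero: "\<theta> (sl 0 0 X) = 0" if "X \<in> V" for X
    using slice_scale_left[OF V_bop[OF that], of 0 0 0]
      pos_functional_scale[OF \<theta> slice_N[OF that], of 0 0 0] by simp
  have "\<theta> (sl h h X) = uwf UNIV u v X" if X: "X \<in> V" for X
  proof -
    have "((\<lambda>m. \<theta> (sl (\<zeta> m) (\<zeta> m) X)) has_sum \<theta> (sl h h X)) {0}"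
      by (rule has_sum_finiteI) (auto simp: \<zeta>_def)
    then have "((\<lambda>m. \<theta> (sl (\<zeta> m) (\<zeta> m) X)) has_sum \<theta> (sl h h X)) UNIV"
      by (subst (asm) has_sum_cong_neutral[where T = UNIV and g = "\<lambda>m. \<theta> (sl (\<zeta> m) (\<zeta> m) X)"])
        (auto simp: \<zeta>_def zero[OF X])
    with hs[OF X] show ?thesis by (simp add: has_sum_unique)
  qed
  then have "normal_on T V (\<lambda>X. \<theta> (sl h h X))"
    by (intro normal_onI[OF hT u v]) (auto simp: V_bop)
  then show ?thesis
    unfolding pos_functional_def
    by (auto simp: theta_slice_pos slice_add slice_scale V_bop slice_N pos_functional_add[OF \<theta>]
        pos_functional_scale[OF \<theta>])
qed

text \<open>Existence of the product functional: the first state is a sum of vector functionals, and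
  for a vector functional tensoring with \<theta> means slicing and then applying \<theta>.\<close>

lemma product_functional:
  assumes \<zeta>: "sqfam UNIV UNIV (\<zeta> :: nat \<Rightarrow> 'a)"
  defines "\<omega> \<equiv> \<lambda>X. \<Sum>\<^sub>\<infinity>m. \<theta> (sl (\<zeta> m) (\<zeta> m) X)"
  shows "pos_functional T V \<omega>"
    and "\<And>a d. a \<in> bop UNIV \<Longrightarrow> d \<in> N \<Longrightarrow> \<omega> (ot a d) = uwf UNIV \<zeta> \<zeta> a * \<theta> d"
    and "\<And>X. X \<in> V \<Longrightarrow> ((\<lambda>m. \<theta> (sl (\<zeta> m) (\<zeta> m) X)) has_sum \<omega> X) UNIV"
proof -
  obtain u v :: "nat \<times> nat \<Rightarrow> 'c" where u: "sqfam T UNIV u" and v: "sqfam T UNIV v"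
    and hs: "\<And>X. X \<in> V \<Longrightarrow> ((\<lambda>m. \<theta> (sl (\<zeta> m) (\<zeta> m) X)) has_sum uwf UNIV u v X) UNIV"
    using theta_slice_normal[OF \<zeta>] by blast
  have \<omega>: "\<omega> X = uwf UNIV u v X" if "X \<in> V" for X
    unfolding \<omega>_def by (rule infsumI[OF hs[OF that]])
  show hs': "((\<lambda>m. \<theta> (sl (\<zeta> m) (\<zeta> m) X)) has_sum \<omega> X) UNIV" if "X \<in> V" for X
    using hs[OF that] \<omega>[OF that] by simp
  have Vp: "(\<lambda>z. X z + Y z) \<in> V" "(\<lambda>z. c *\<^sub>C X z) \<in> V" "adj T X \<circ> X \<in> V" if "X \<in> V" "Y \<in> V" for X Y c
    by (rule op_algebra_plus[OF V_op_algebra that] op_algebra_scaled[OF V_op_algebra that(1)]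
        op_algebra_comp[OF V_op_algebra op_algebra_adj[OF V_op_algebra that(1)] that(1)])+
  have "normal_on T V \<omega>"
    by (rule normal_onI[OF hT u v _ \<omega>]) (auto simp: V_bop)
  moreover have "\<omega> (adj T X \<circ> X) \<in> \<real>\<^sub>\<ge>\<^sub>0" if X: "X \<in> V" for X
  proof -
    have p: "\<theta> (sl (\<zeta> m) (\<zeta> m) (adj T X \<circ> X)) \<in> \<real>\<^sub>\<ge>\<^sub>0" for m by (rule theta_slice_pos[OF X])
    note h = hs'[OF Vp(3)[OF X X]]
    have "0 \<le> Re (\<omega> (adj T X \<circ> X))"
      by (rule has_sum_nonneg[OF has_sum_Re[OF h]]) (use p in \<open>simp add: complex_nonneg_Reals_iff\<close>)
    moreover have "((\<lambda>m::nat. 0) has_sum Im (\<omega> (adj T X \<circ> X))) UNIV"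
      using has_sum_Im[OF h] p by (simp add: complex_nonneg_Reals_iff)
    then have "Im (\<omega> (adj T X \<circ> X)) = 0" using has_sum_unique[OF _ has_sum_0_simp] by blast
    ultimately show ?thesis by (simp add: complex_nonneg_Reals_iff)
  qed
  ultimately show "pos_functional T V \<omega>"
    unfolding pos_functional_def
    by (auto simp: \<omega> Vp uwf_add[OF u v] V_bop uwf_scale)
  fix a d assume a: "a \<in> bop (UNIV :: 'a set)" and d: "d \<in> N"
  have db: "d \<in> bop S" by (rule op_algebra_sub[OF N d])
  have "\<omega> (ot a d) = (\<Sum>\<^sub>\<infinity>m. cinner (\<zeta> m) (a (\<zeta> m)) * \<theta> d)"
    unfolding \<omega>_def
    by (rule infsum_cong) (simp add: slice_op_tensor a db pos_functional_scale[OF \<theta> d])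
  then show "\<omega> (ot a d) = uwf UNIV \<zeta> \<zeta> a * \<theta> d"
    by (simp add: uwf_def infsum_cmult_left')
qed

end

end

subsection \<open>Product states of the iterated system\<close>

interpretation sysf: htensor_full "tensor_sys :: 'h::hilbert_space \<Rightarrow> 'k::hilbert_space list ell2 \<Rightarrow> _"
  "powspace n" "syspowspace n" for n
  by unfold_locales

context
  fixes C :: "('k::hilbert_space \<Rightarrow> 'k) set"
  assumes C: "von_neumann_algebra UNIV C"
begin

lemma C_op_algebra: "op_algebra UNIV C"
proof -
  have "C \<subseteq> bop UNIV" "\<And>a. a \<in> C \<Longrightarrow> adj UNIV a \<in> C" "commutant UNIV (commutant UNIV C) = C"
    using C unfolding von_neumann_algebra_def by auto
  with op_algebra_double_commutant[OF hsub_UNIV, of C] show ?thesis by simp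
qed

lemma alg_pow_op_algebra: "op_algebra (powspace n) (alg_pow C n)"
  by (induction n) (auto simp: op_algebra_bop hsub_powspace intro: pow.vn_tensor_op_algebra C_op_algebra)

lemma alg_pow_double_commutant:
  "commutant (powspace n) (commutant (powspace n) (alg_pow C n)) = alg_pow C n"
proof (cases n)
  case 0
  then show ?thesis
    using subset_double_commutant[of "bop (powspace 0 :: 'k list ell2 set)" "powspace 0"]
    by (auto dest: commutant_bop)
next
  case (Suc m)
  then show ?thesis
    using pow.vn_tensor_double_commutant[OF alg_pow_op_algebra C_op_algebra] by simp
qed

lemma sys_alg_op_algebra:
  "op_algebra (syspowspace n) (sys_alg (bop (UNIV :: 'h::hilbert_space set)) C n)"
  unfolding sys_alg_def
  by (rule sys.vn_tensor_op_algebra[OF op_algebra_bop[OF hsub_UNIV] alg_pow_op_algebra])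

abbreviation sslice :: "nat \<Rightarrow> 'h::hilbert_space \<Rightarrow> 'h \<Rightarrow> (('h \<times> 'k list) ell2 \<Rightarrow> ('h \<times> 'k list) ell2) \<Rightarrow> _" where
  "sslice n \<equiv> slice tensor_sys (powspace n) (syspowspace n)"

text \<open>\<open>product_functional\<close> supplies a witness for the choice in
  \<open>product_state\<close>, and \<open>normal_on_eqI\<close> identifies the chosen state with
  it. The formula holds for every decomposition \<zeta> of \<sigma>.\<close>

lemma product_state_eq:
  fixes \<sigma> :: "('h::hilbert_space \<Rightarrow> 'h) \<Rightarrow> complex" and \<zeta> :: "nat \<Rightarrow> 'h"
  assumes \<sigma>: "normal_state UNIV (bop UNIV) \<sigma>" and \<theta>: "normal_state (powspace n) (alg_pow C n) \<theta>"
    and \<zeta>: "sqfam UNIV UNIV \<zeta>" "\<And>a. a \<in> bop UNIV \<Longrightarrow> \<sigma> a = uwf UNIV \<zeta> \<zeta> a"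
    and X: "X \<in> sys_alg (bop UNIV) C n"
  shows "((\<lambda>m. \<theta> (sslice n (\<zeta> m) (\<zeta> m) X)) has_sum product_state (bop UNIV) C n \<sigma> \<theta> X) UNIV"
proof -
  note N = alg_pow_op_algebra[of n] and NN = alg_pow_double_commutant[of n]
  have th: "pos_functional (powspace n) (alg_pow C n) \<theta>" and th1: "\<theta> (idop (powspace n)) = 1"
    using \<theta> unfolding normal_state_pos_functional[OF hsub_powspace N] by auto
  define \<omega> where "\<omega> X = (\<Sum>\<^sub>\<infinity>m. \<theta> (sslice n (\<zeta> m) (\<zeta> m) X))" for X
  note pf = sysf.product_functional[OF N NN th \<zeta>(1), folded \<omega>_def]
  have V: "vn_tensor tensor_sys UNIV (powspace n) (syspowspace n) (bop UNIV) (alg_pow C n)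
      = sys_alg (bop (UNIV :: 'h set)) C n"
    by (simp add: sys_alg_def)
  have idN: "idop (powspace n) \<in> alg_pow C n" by (rule op_algebra_idop[OF N])
  have s1: "\<sigma> (idop UNIV) = 1" using \<sigma> by (simp add: normal_state_def)
  have el: "\<omega> (sys_tensor n a d) = \<sigma> a * \<theta> d" if "a \<in> bop UNIV" "d \<in> alg_pow C n" for a d
    using pf(2)[OF that] \<zeta>(2)[OF that(1)] by (simp add: sys_tensor_def)
  have "\<omega> (idop (syspowspace n)) = 1"
    using el[OF bop_idop[OF hsub_UNIV] idN] by (simp add: sys_tensor_def sys.op_tensor_idop s1 th1)
  then have "normal_state (syspowspace n) (sys_alg (bop UNIV) C n) \<omega>"
    unfolding normal_state_pos_functional[OF hsub_syspowspace sys_alg_op_algebra]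
    using pf(1) by (simp add: V)
  then have ex: "\<exists>\<omega>. normal_state (syspowspace n) (sys_alg (bop UNIV) C n) \<omega>
     \<and> (\<forall>a\<in>bop UNIV. \<forall>d\<in>alg_pow C n. \<omega> (sys_tensor n a d) = \<sigma> a * \<theta> d)" using el by blast
  define \<psi> where "\<psi> = product_state (bop UNIV) C n \<sigma> \<theta>"
  have \<psi>: "normal_state (syspowspace n) (sys_alg (bop UNIV) C n) \<psi>"
    "\<And>a d. a \<in> bop UNIV \<Longrightarrow> d \<in> alg_pow C n \<Longrightarrow> \<psi> (sys_tensor n a d) = \<sigma> a * \<theta> d"
    using someI_ex[OF ex] unfolding \<psi>_def product_state_def by auto
  have "\<omega> X = \<psi> X"
  proof (rule sysf.normal_on_eqI[where f = \<omega> and g = \<psi>, OF N NN])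
    show "normal_on (syspowspace n) (vn_tensor tensor_sys UNIV (powspace n) (syspowspace n) (bop UNIV) (alg_pow C n)) \<omega>"
      by (rule pos_functional_normal[OF pf(1)])
    show "normal_on (syspowspace n) (vn_tensor tensor_sys UNIV (powspace n) (syspowspace n) (bop UNIV) (alg_pow C n)) \<psi>"
      unfolding V
      by (rule pos_functional_normal)
        (use \<psi>(1)[unfolded normal_state_pos_functional[OF hsub_syspowspace sys_alg_op_algebra]] in simp)
    show "\<omega> (sys.ot n a d) = \<psi> (sys.ot n a d)" if "a \<in> bop UNIV" "d \<in> alg_pow C n" for a d
      using el[OF that] \<psi>(2)[OF that] by (simp add: sys_tensor_def)
  qed (use X V in simp)
  moreover have "((\<lambda>m. \<theta> (sslice n (\<zeta> m) (\<zeta> m) X)) has_sum \<omega> X) UNIV"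
    by (rule pf(3)) (use X V in simp)
  ultimately show ?thesis by (simp add: \<psi>_def)
qed

end

section \<open>Iterates of the transition\<close>

lemma
  assumes S: "hsub S" and a: "a \<in> bop S"
  shows comp_idop: "a \<circ> idop S = a" and idop_comp: "idop S \<circ> a = a"
proof -
  note I = bop_idop[OF S]
  show "a \<circ> idop S = a"
    by (rule bop_eqI[OF S bop_comp[OF S a I] a]) simp
  show "idop S \<circ> a = a"
    by (rule bop_eqI[OF S bop_comp[OF S I a] a]) (simp add: bop_in[OF a])
qed

lemma
  assumes "normal_star_hom S M T N \<Phi>"
  shows nsh_in: "a \<in> M \<Longrightarrow> \<Phi> a \<in> N"
    and nsh_add: "a \<in> M \<Longrightarrow> b \<in> M \<Longrightarrow> \<Phi> (\<lambda>x. a x + b x) = (\<lambda>x. \<Phi> a x + \<Phi> b x)"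
    and nsh_scale: "a \<in> M \<Longrightarrow> \<Phi> (\<lambda>x. c *\<^sub>C a x) = (\<lambda>x. c *\<^sub>C \<Phi> a x)"
    and nsh_comp: "a \<in> M \<Longrightarrow> b \<in> M \<Longrightarrow> \<Phi> (a \<circ> b) = \<Phi> a \<circ> \<Phi> b"
    and nsh_adj: "a \<in> M \<Longrightarrow> \<Phi> (adj S a) = adj T (\<Phi> a)"
    and nsh_continuous: "continuous_map (subtopology (ultraweak S) M) (subtopology (ultraweak T) N) \<Phi>"
  using assms unfolding normal_star_hom_def by auto

lemma normal_star_hom_comp:
  assumes \<Phi>: "normal_star_hom S M T N \<Phi>" and \<Psi>: "normal_star_hom T N U P \<Psi>"
  shows "normal_star_hom S M U P (\<Psi> \<circ> \<Phi>)"
  unfolding normal_star_hom_def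
proof (intro conjI ballI allI)
  show "continuous_map (subtopology (ultraweak S) M) (subtopology (ultraweak U) P) (\<Psi> \<circ> \<Phi>)"
    by (rule continuous_map_compose[OF nsh_continuous[OF \<Phi>] nsh_continuous[OF \<Psi>]])
qed (auto simp: nsh_in[OF \<Phi>] nsh_in[OF \<Psi>] nsh_add[OF \<Phi>] nsh_add[OF \<Psi>] nsh_scale[OF \<Phi>] nsh_scale[OF \<Psi>]
    nsh_comp[OF \<Phi>] nsh_comp[OF \<Psi>] nsh_adj[OF \<Phi>] nsh_adj[OF \<Psi>])

text \<open>A detour through the topology: series functionals are continuous, continuity composes
  with \<Phi>, and a continuous linear functional is again a series.\<close>

lemma normal_on_comp:
  fixes S :: "'a::hilbert_space set" and T :: "'b::hilbert_space set"
  assumes S: "hsub S" and T: "hsub T" and M: "op_algebra S M" and N: "op_algebra T N"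
    and \<Phi>: "normal_star_hom S M T N \<Phi>" and \<omega>: "normal_on T N \<omega>"
    and lin: "\<And>a b. a \<in> N \<Longrightarrow> b \<in> N \<Longrightarrow> \<omega> (\<lambda>x. a x + b x) = \<omega> a + \<omega> b"
      "\<And>a c. a \<in> N \<Longrightarrow> \<omega> (\<lambda>x. c *\<^sub>C a x) = c * \<omega> a"
  shows "normal_on S M (\<lambda>a. \<omega> (\<Phi> a))"
proof (rule continuous_normal_on[OF S])
  show "M \<subseteq> bop S" using op_algebra_sub[OF M] by blast
  have Nb: "N \<subseteq> bop T" using op_algebra_sub[OF N] by blast
  show "continuous_map (subtopology (ultraweak S) M) euclidean (\<lambda>a. \<omega> (\<Phi> a))"
    using continuous_map_compose[OF nsh_continuous[OF \<Phi>] normal_on_continuous[OF T Nb \<omega>]]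
    by (simp add: o_def)
qed (simp_all add: op_algebra_zero[OF M] op_algebra_plus[OF M] op_algebra_scaled[OF M] nsh_add[OF \<Phi>]
    nsh_scale[OF \<Phi>] nsh_in[OF \<Phi>] lin)

lemma continuous_map_ultraweakI:
  fixes S :: "'a::hilbert_space set" and T :: "'b::hilbert_space set"
  assumes S: "hsub S" and T: "hsub T" and M: "M \<subseteq> bop S" and N: "N \<subseteq> bop T" and \<Psi>: "\<And>a. a \<in> M \<Longrightarrow> \<Psi> a \<in> N"
    and normal: "\<And>x y :: nat \<Rightarrow> 'b. sqfam T UNIV x \<Longrightarrow> sqfam T UNIV y \<Longrightarrow>
      normal_on S M (\<lambda>a. uwf UNIV x y (\<Psi> a))"
  shows "continuous_map (subtopology (ultraweak S) M) (subtopology (ultraweak T) N) \<Psi>"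
proof -
  have ts: "topspace (subtopology (ultraweak S) M) = M"
    using M by (auto simp: topspace_ultraweak[OF S])
  have "continuous_map (subtopology (ultraweak S) M) (ultraweak T) \<Psi>"
    unfolding ultraweak_eq[of T]
  proof (rule continuous_on_generated_topo)
    fix U assume "U \<in> uw_generators T"
    then obtain x y :: "nat \<Rightarrow> 'b" and W where U: "U = {a \<in> bop T. uwf UNIV x y a \<in> W}"
      and xy: "sqfam T UNIV x" "sqfam T UNIV y" and W: "open W"
      unfolding uw_generators_def by blast
    have "openin (subtopology (ultraweak S) M)
        {a \<in> topspace (subtopology (ultraweak S) M). uwf UNIV x y (\<Psi> a) \<in> W}"
      by (rule openin_continuous_map_preimage[OF normal_on_continuous[OF S M normal[OF xy]]])
        (use W in simp)
    moreover have "{a \<in> topspace (subtopology (ultraweak S) M). uwf UNIV x y (\<Psi> a) \<in> W}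
        = \<Psi> -` U \<inter> topspace (subtopology (ultraweak S) M)"
      unfolding ts U using \<Psi> N by auto
    ultimately show "openin (subtopology (ultraweak S) M) (\<Psi> -` U \<inter> topspace (subtopology (ultraweak S) M))"
      by simp
  next
    have "\<Union> (uw_generators T) = bop T"
      using topspace_ultraweak[OF T] unfolding ultraweak_eq topology_generated_by_topspace .
    then show "\<Psi> ` topspace (subtopology (ultraweak S) M) \<subseteq> \<Union> (uw_generators T)"
      using \<Psi> N unfolding ts by auto
  qed
  then show ?thesis
    using \<Psi> by (auto simp: continuous_map_in_subtopology ts)
qed

subsection \<open>Amplification of operators\<close>

lemma (in htensor) cinner_amplification:
  assumes D: "onb S D" and X: "X \<in> bop R" and u: "u \<in> T" and v: "v \<in> T"
  shows "((\<lambda>d. cinner (rcf (\<lambda>y x. \<tau> x y) R T d u) (X (rcf (\<lambda>y x. \<tau> x y) R T d v))) has_sum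
    cinner u (ot X (idop S) v)) D"
proof -
  obtain B where B: "B \<in> bmap T T" "\<And>x y. x \<in> R \<Longrightarrow> y \<in> S \<Longrightarrow> B (\<tau> x y) = \<tau> (X x) y"
    and hs: "((\<lambda>d. cinner (rcf (\<lambda>y x. \<tau> x y) R T d u) (X (rcf (\<lambda>y x. \<tau> x y) R T d v))) has_sum cinner u (B v)) D"
    using tensor_map_right[OF swap swap D bop_bmap[OF X]] u v by blast
  note I = bop_idop[OF hS]
  have "B v = ot X (idop S) v"
    by (rule tau_ext[OF hT B(1) bop_bmap[OF op_tensor_bop[OF X I]] _ v])
      (simp add: B(2) op_tensor_tau X I)
  with hs show ?thesis by simp
qed

text \<open>Splitting the vectors of T along an orthonormal basis of S, on which X \<otimes> 1 acts
  trivially, gives a series of vectors of R indexed by pairs.\<close>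

lemma (in htensor) amplification_normal:
  assumes M: "M \<subseteq> bop R" and x: "sqfam T UNIV (x :: nat \<Rightarrow> 'c)" and y: "sqfam T UNIV (y :: nat \<Rightarrow> 'c)"
  shows "normal_on R M (\<lambda>X. uwf UNIV x y (ot X (idop S)))"
proof -
  obtain D where D: "onb S D" using ex_onb[OF hS] by blast
  have on: "orthonormal D" "D \<subseteq> S" using D by (auto simp: onb_def)
  let ?c = "rcf (\<lambda>y x. \<tau> x y) R T"
  have sq: "sqfam R (UNIV \<times> D) (\<lambda>(i, d). ?c d (z i))" if z: "sqfam T UNIV z" for z :: "nat \<Rightarrow> 'c"
  proof -
    have zT: "z i \<in> T" for i using z by (simp add: sqfam_def)
    note B = htensor.rcf_Bessel[OF swap on zT]
    have "(\<lambda>(i, d). (norm (?c d (z i)))\<^sup>2) summable_on UNIV \<times> D"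
    proof (rule summable_on_SigmaI[where g = "\<lambda>i. (l2norm D (\<lambda>d. ?c d (z i)))\<^sup>2"])
      show "((\<lambda>d. case (i, d) of (i, d) \<Rightarrow> (norm (?c d (z i)))\<^sup>2) has_sum (l2norm D (\<lambda>d. ?c d (z i)))\<^sup>2) D" for i
        using B(1)[of i] by (simp add: sqfam_def l2norm_def infsum_nonneg)
      show "(\<lambda>i. (l2norm D (\<lambda>d. ?c d (z i)))\<^sup>2) summable_on UNIV"
      proof (rule summable_on_comparison_test)
        show "(\<lambda>i. (norm (z i))\<^sup>2) summable_on UNIV" using z by (simp add: sqfam_def)
        show "(l2norm D (\<lambda>d. ?c d (z i)))\<^sup>2 \<le> (norm (z i))\<^sup>2" for i
          by (intro power_mono B(2) l2norm_nonneg)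
      qed simp
    qed auto
    moreover have "?c d (z i) \<in> R" if "d \<in> D" for d i using B(1)[of i] that by (simp add: sqfam_def)
    ultimately show ?thesis by (auto simp: sqfam_def case_prod_unfold)
  qed
  show ?thesis
  proof (rule normal_onI[OF hR sq[OF x] sq[OF y] M])
    fix X assume "X \<in> M"
    then have X: "X \<in> bop R" using M by blast
    have "((\<lambda>i. cinner (x i) (ot X (idop S) (y i))) has_sum
        uwf (UNIV \<times> D) (\<lambda>(i, d). ?c d (x i)) (\<lambda>(i, d). ?c d (y i)) X) UNIV"
    proof (rule has_sum_SigmaD)
      show "((\<lambda>p. cinner ((\<lambda>(i, d). ?c d (x i)) p) (X ((\<lambda>(i, d). ?c d (y i)) p))) has_sum
          uwf (UNIV \<times> D) (\<lambda>(i, d). ?c d (x i)) (\<lambda>(i, d). ?c d (y i)) X) (UNIV \<times> D)"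
        unfolding uwf_def
        by (rule has_sum_infsum, rule uwf_summable_bmap(2)[OF sq[OF x] sq[OF y] bop_bmap[OF X]])
      show "((\<lambda>d. cinner ((\<lambda>(i, d). ?c d (x i)) (i, d)) (X ((\<lambda>(i, d). ?c d (y i)) (i, d)))) has_sum
          cinner (x i) (ot X (idop S) (y i))) D" for i
        using cinner_amplification[OF D X, of "x i" "y i"] x y by (simp add: sqfam_def)
    qed
    then show "uwf UNIV x y (ot X (idop S)) =
        uwf (UNIV \<times> D) (\<lambda>(i, d). ?c d (x i)) (\<lambda>(i, d). ?c d (y i)) X"
      by (simp add: uwf_def[of UNIV] infsumI)
  qed
qed

lemma hsub_orthogonal:
  assumes S: "hsub S" shows "hsub {v\<in>S. \<forall>u\<in>U. cinner u v = 0}"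
  unfolding hsub_def
proof (intro conjI ballI allI)
  show "closed {v\<in>S. \<forall>u\<in>U. cinner u v = 0}"
    unfolding closed_sequential_limits
  proof (intro allI impI, elim conjE)
    fix X l assume X: "\<forall>n. X n \<in> {v\<in>S. \<forall>u\<in>U. cinner u v = 0}" "X \<longlonglongrightarrow> l"
    have "cinner u l = 0" if "u \<in> U" for u
    proof -
      have "(\<lambda>n. cinner u (X n)) \<longlonglongrightarrow> cinner u l" by (intro tendsto_intros X)
      moreover have "(\<lambda>n. cinner u (X n)) = (\<lambda>n. 0)" using X(1) that by auto
      ultimately show ?thesis by (simp add: LIMSEQ_const_iff)
    qed
    moreover have "l \<in> S" by (rule hsub_lim[OF S _ X(2)]) (use X(1) in auto)
    ultimately show "l \<in> {v\<in>S. \<forall>u\<in>U. cinner u v = 0}" by auto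
  qed
qed (auto simp: hsub_zero[OF S] hsub_add[OF S] hsub_scale[OF S] cinner_add_right cinner_scaleC_right)

lemma op_tensor_assoc:
  fixes a :: "'h::hilbert_space \<Rightarrow> 'h" and d :: "'k::hilbert_space list ell2 \<Rightarrow> _"
  assumes a: "a \<in> bop UNIV" and d: "d \<in> bop (powspace n)" and c: "c \<in> bop UNIV"
  shows "sys.ot (Suc n) a (pow.ot n d c) = syspow.ot n (sys.ot n a d) c"
proof -
  note dc = pow.op_tensor_bop[OF d c] and ad = sys.op_tensor_bop[OF a d]
  note L = sys.op_tensor_bop[OF a dc]
  show ?thesis
  proof (rule syspow.op_tensor_unique[OF L, symmetric])
    fix v :: "('h \<times> 'k list) ell2" and k :: 'k assume v: "v \<in> syspowspace n"
    have "(sys.ot (Suc n) a (pow.ot n d c) \<circ> (\<lambda>v. tensor_syspow v k)) v = ((\<lambda>v. tensor_syspow v (c k)) \<circ> sys.ot n a d) v"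
    proof (rule sys.tau_ext[OF hsub_syspowspace _ _ _ v])
      show "sys.ot (Suc n) a (pow.ot n d c) \<circ> (\<lambda>v. tensor_syspow v k) \<in> bmap (syspowspace n) (syspowspace (Suc n))"
        by (rule bmap_comp[OF syspow.tau_bmap_left[OF UNIV_I] bop_bmap[OF L]])
      show "(\<lambda>v. tensor_syspow v (c k)) \<circ> sys.ot n a d \<in> bmap (syspowspace n) (syspowspace (Suc n))"
        by (rule bmap_comp[OF bop_bmap[OF ad] syspow.tau_bmap_left[OF UNIV_I]])
      fix x :: 'h and w :: "'k list ell2" assume w: "w \<in> powspace n"
      show "(sys.ot (Suc n) a (pow.ot n d c) \<circ> (\<lambda>v. tensor_syspow v k)) (tensor_sys x w) =
          ((\<lambda>v. tensor_syspow v (c k)) \<circ> sys.ot n a d) (tensor_sys x w)"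
        by (simp add: sys.op_tensor_tau a d w tensor_assoc[symmetric] sys.op_tensor_tau[OF a dc] pow.tau_in
            pow.op_tensor_tau[OF d c])
    qed
    then show "sys.ot (Suc n) a (pow.ot n d c) (tensor_syspow v k) = tensor_syspow (sys.ot n a d v) (c k)"
      by simp
  qed
qed

section \<open>The homomorphism \<Phi> \<otimes> id as an amplification\<close>

context
  fixes C :: "('k::hilbert_space \<Rightarrow> 'k) set"
  assumes C: "von_neumann_algebra UNIV C"
begin

lemma C_bop: "c \<in> C \<Longrightarrow> c \<in> bop UNIV"
  by (rule op_algebra_sub[OF C_op_algebra[OF C]])

text \<open>\<open>powspace 0\<close> is one-dimensional, so its operators are scalars, and the
  scalar is absorbed into c.\<close>

lemma elementary_pow_0:
  assumes "D \<in> pow.elementary 0 (bop (powspace 0)) C"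
  shows "\<exists>c\<in>C. D = first_copy c"
proof -
  obtain z c where D: "D = pow.ot 0 z c" and z: "z \<in> bop (powspace 0)" and c: "c \<in> C"
    using assms by (auto simp: pow.elementary_def)
  define r where "r = Rep_ell2 (z (ket [])) []"
  have zk: "z (ket []) = r *\<^sub>C ket []"
    unfolding r_def by (rule powspace_0) (rule bop_in[OF z ket_Nil])
  have zw: "z w = r *\<^sub>C w" if "w \<in> powspace 0" for w
    by (subst (1 2) powspace_0[OF that])
      (simp add: bop_scale[OF z ket_Nil] zk scaleC_scaleC mult.commute)
  have rc: "(\<lambda>x. r *\<^sub>C c x) \<in> C" by (rule op_algebra_scaled[OF C_op_algebra[OF C] c])
  have "D = first_copy (\<lambda>x. r *\<^sub>C c x)"
    unfolding D
  proof (rule pow.op_tensor_unique)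
    show "first_copy (\<lambda>x. r *\<^sub>C c x) \<in> bop (powspace (Suc 0))" by (rule first_copy_bop[OF C_bop[OF rc]])
    fix w :: "'k list ell2" and k assume w: "w \<in> powspace 0"
    show "first_copy (\<lambda>x. r *\<^sub>C c x) (tensor_pow w k) = tensor_pow (z w) (c k)"
      unfolding first_copy_def One_nat_def
      by (simp add: pow.op_tensor_tau bop_idop hsub_powspace C_bop[OF rc] w zw pow.tau_scale_left[OF w]
          pow.tau_scale_right[OF UNIV_I w])
  qed
  with rc show ?thesis by blast
qed

text \<open>The first tensor power is itself a double commutant, so \<open>sys_alg\<close> has more
  evident generators than the a \<otimes> c. An operator Z commuting with all a \<otimes> c commutes
  with 1 \<otimes> d for every d in the first power by
  \<open>commute_double_commutant_right\<close>, hence with all a \<otimes> d.\<close>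

lemma sys_alg_1_generated:
  "sys_alg (bop (UNIV :: 'h::hilbert_space set)) C (Suc 0) \<subseteq>
    commutant (syspowspace (Suc 0)) (commutant (syspowspace (Suc 0)) (one.elementary (bop UNIV) C))"
proof -
  note B = op_algebra_bop[OF hsub_UNIV, where 'a = 'h] and CC = C_op_algebra[OF C]
  have "commutant (syspowspace (Suc 0)) (one.elementary (bop (UNIV :: 'h set)) C) \<subseteq>
      commutant (syspowspace (Suc 0)) (sys.elementary (Suc 0) (bop UNIV) (alg_pow C (Suc 0)))"
  proof
    fix Z assume Z: "Z \<in> commutant (syspowspace (Suc 0)) (one.elementary (bop (UNIV :: 'h set)) C)"
    note Zb = commutant_bop[OF Z]
    note I = bop_idop[OF hsub_UNIV] and IP = bop_idop[OF hsub_powspace]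
    have one: "sys.ot (Suc 0) a (first_copy c) \<circ> Z = Z \<circ> sys.ot (Suc 0) a (first_copy c)"
      if "a \<in> bop UNIV" "c \<in> C" for a c
    proof -
      have "sys.ot (Suc 0) a (first_copy c) \<in> one.elementary (bop UNIV) C"
        using sys_tensor_first_copy[OF that(1) C_bop[OF that(2)]] that
        by (auto simp: sys_tensor_def one.elementary_def)
      from commutantD[OF Z this] show ?thesis by (simp add: fun_eq_iff)
    qed
    have right: "sys.ot (Suc 0) (idop UNIV) d \<circ> Z = Z \<circ> sys.ot (Suc 0) (idop UNIV) d"
      if "d \<in> alg_pow C (Suc 0)" for d
    proof (rule sys.commute_double_commutant_right[OF Zb])
      show "pow.elementary 0 (bop (powspace 0)) C \<subseteq> bop (powspace (Suc 0))"
        by (rule pow.elementary_bop[OF op_algebra_bop[OF hsub_powspace] CC])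
      show "d \<in> commutant (powspace (Suc 0)) (commutant (powspace (Suc 0)) (pow.elementary 0 (bop (powspace 0)) C))"
        using that by (simp add: pow.vn_tensor_eq)
      fix Y assume "Y \<in> pow.elementary 0 (bop (powspace 0)) C"
      then obtain c where "c \<in> C" "Y = first_copy c" using elementary_pow_0 by blast
      then show "sys.ot (Suc 0) (idop UNIV) Y \<circ> Z = Z \<circ> sys.ot (Suc 0) (idop UNIV) Y"
        using one[OF I] by simp
    qed
    have fid: "first_copy (idop UNIV :: 'k \<Rightarrow> 'k) = idop (powspace (Suc 0))"
      unfolding first_copy_def One_nat_def by (rule pow.op_tensor_idop)
    show "Z \<in> commutant (syspowspace (Suc 0)) (sys.elementary (Suc 0) (bop UNIV) (alg_pow C (Suc 0)))"
    proof (rule commutantI[OF Zb])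
      fix z v assume "z \<in> sys.elementary (Suc 0) (bop (UNIV :: 'h set)) (alg_pow C (Suc 0))"
      then obtain a d where z: "z = sys.ot (Suc 0) a d" and a: "a \<in> bop UNIV" and d: "d \<in> alg_pow C (Suc 0)"
        by (auto simp: sys.elementary_def)
      have db: "d \<in> bop (powspace (Suc 0))" by (rule op_algebra_sub[OF alg_pow_op_algebra[OF C] d])
      have "z = sys.ot (Suc 0) a (idop (powspace (Suc 0))) \<circ> sys.ot (Suc 0) (idop UNIV) d"
        unfolding z sys.op_tensor_comp[OF a IP I db]
        by (simp add: comp_idop[OF hsub_UNIV a] idop_comp[OF hsub_powspace db])
      then show "z (Z v) = Z (z v)"
        using right[OF d] one[OF a op_algebra_idop[OF CC]] by (simp add: fid fun_eq_iff)
    qed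
  qed
  from commutant_antimono[OF this] show ?thesis
    by (simp add: sys_alg_def sys.vn_tensor_eq)
qed

definition unital_hom :: "nat \<Rightarrow> (('h::hilbert_space \<Rightarrow> 'h) \<Rightarrow> ('h \<times> 'k list) ell2 \<Rightarrow> ('h \<times> 'k list) ell2) \<Rightarrow> bool" where
  "unital_hom n \<Phi> \<longleftrightarrow> normal_star_hom UNIV (bop UNIV) (syspowspace n) (sys_alg (bop UNIV) C n) \<Phi>
     \<and> \<Phi> (idop UNIV) = idop (syspowspace n)"

context
  fixes n and \<Phi> :: "('h::hilbert_space \<Rightarrow> 'h) \<Rightarrow> ('h \<times> 'k list) ell2 \<Rightarrow> ('h \<times> 'k list) ell2" and e :: 'h
  assumes \<Phi>: "unital_hom n \<Phi>" and e: "norm e = 1"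
begin

lemma Phi_star_hom: "normal_star_hom UNIV (bop UNIV) (syspowspace n) (sys_alg (bop UNIV) C n) \<Phi>"
  and Phi_idop: "\<Phi> (idop UNIV) = idop (syspowspace n)"
  using \<Phi> by (auto simp: unital_hom_def)

lemma Phi_bop: "a \<in> bop UNIV \<Longrightarrow> \<Phi> a \<in> bop (syspowspace n)"
  by (rule op_algebra_sub[OF sys_alg_op_algebra[OF C] nsh_in[OF Phi_star_hom]])

text \<open>Here normality of \<Phi> enters: for a representation that is not normal the images of
  the rank-one projections need not sum to 1.\<close>

lemma Phi_resolution:
  assumes u: "u \<in> syspowspace n" and v: "v \<in> syspowspace n"
  shows "((\<lambda>b. cinner u (\<Phi> (ketbra b b) v)) has_sum cinner u v) basis"
proof -
  note A = sys_alg_op_algebra[OF C, where 'h = 'h and n = n]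
  have sub: "sys_alg (bop (UNIV :: 'h set)) C n \<subseteq> bop (syspowspace n)" using op_algebra_sub[OF A] by blast
  have "normal_on (syspowspace n) (sys_alg (bop UNIV) C n) (\<lambda>a. cinner u (a v))"
    by (rule normal_onI[OF hsub_syspowspace sqfam_single[OF u, of "()"] sqfam_single[OF v] sub])
      (simp add: uwf_def)
  then have "normal_on UNIV (bop UNIV) (\<lambda>a. cinner u (\<Phi> a v))"
    by (rule normal_on_comp[OF hsub_UNIV hsub_syspowspace op_algebra_bop[OF hsub_UNIV] A Phi_star_hom])
      (simp_all add: cinner_add_right cinner_scaleC_right)
  then obtain x y :: "nat \<Rightarrow> 'h" where xy: "sqfam UNIV UNIV x" "sqfam UNIV UNIV y"
    and eq: "\<And>a. a \<in> bop UNIV \<Longrightarrow> cinner u (\<Phi> a v) = uwf UNIV x y a"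
    unfolding normal_on_def by blast
  have "((\<lambda>b. uwf UNIV x y (idop UNIV \<circ> ketbra b b)) has_sum uwf UNIV x y (idop UNIV)) basis"
    by (rule uwf_resolution_right[OF hsub_UNIV resolution_ketbra xy bop_idop[OF hsub_UNIV]])
  then show ?thesis
    unfolding comp_ketbra[OF bop_idop[OF hsub_UNIV]]
    by (simp add: eq[symmetric] ketbra_bop bop_idop Phi_idop v)
qed

lemma Phi_ketbra_comp: "\<Phi> (ketbra x y) (\<Phi> (ketbra x' y') v) = cinner y x' *\<^sub>C \<Phi> (ketbra x y') v"
proof -
  have "\<Phi> (ketbra x y) \<circ> \<Phi> (ketbra x' y') = (\<lambda>v. cinner y x' *\<^sub>C \<Phi> (ketbra x y') v)"
    unfolding nsh_comp[OF Phi_star_hom ketbra_bop ketbra_bop, symmetric] ketbra_comp_ketbra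
    by (rule nsh_scale[OF Phi_star_hom ketbra_bop])
  then show ?thesis by (simp add: fun_eq_iff)
qed

lemma cinner_unit: "cinner e e = 1"
  by (simp add: cinner_same e)

text \<open>The multiplicity space of the representation \<open>\<Phi>\<close>: all of \<open>H \<otimes> K\<^sup>n\<close> is \<open>H \<otimes> multspace\<close> by
  the map \<open>h \<otimes> g \<mapsto> \<Phi> |h\<rangle>\<langle>e| g\<close>, and \<open>\<Phi> a\<close> becomes \<open>a \<otimes> 1\<close>.\<close>

definition multspace :: "('h \<times> 'k list) ell2 set" where
  "multspace = {v \<in> syspowspace n. \<Phi> (ketbra e e) v = v}"

lemma Phi_ketbra_in: "v \<in> syspowspace n \<Longrightarrow> \<Phi> (ketbra x y) v \<in> syspowspace n"
  by (rule bop_in[OF Phi_bop[OF ketbra_bop]])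

lemma cinner_Phi_ketbra:
  "u \<in> syspowspace n \<Longrightarrow> v \<in> syspowspace n \<Longrightarrow> cinner (\<Phi> (ketbra x y) u) v = cinner u (\<Phi> (ketbra y x) v)"
  using cinner_adj_right[OF hsub_syspowspace Phi_bop[OF ketbra_bop], of u v x y]
    nsh_adj[OF Phi_star_hom ketbra_bop, of x y] by (simp add: adj_ketbra)

lemma multspace_sub: "g \<in> multspace \<Longrightarrow> g \<in> syspowspace n"
  by (simp add: multspace_def)

lemma hsub_multspace: "hsub multspace"
proof -
  let ?p = "\<Phi> (ketbra e e)"
  \<comment> \<open>A vector is fixed by the selfadjoint \<open>?p\<close> iff it is orthogonal to
    the range of \<open>?p\<close> - 1, and orthogonality is a closed condition.\<close>
  have "?p v = v \<longleftrightarrow> (\<forall>u\<in>(\<lambda>u. ?p u - u) ` syspowspace n. cinner u v = 0)" if v: "v \<in> syspowspace n" for v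
  proof
    assume "?p v = v"
    then show "\<forall>u\<in>(\<lambda>u. ?p u - u) ` syspowspace n. cinner u v = 0"
      using v by (auto simp: cinner_diff_left cinner_Phi_ketbra)
  next
    assume *: "\<forall>u\<in>(\<lambda>u. ?p u - u) ` syspowspace n. cinner u v = 0"
    define w where "w = ?p v - v"
    have w: "w \<in> syspowspace n" unfolding w_def by (intro hsub_diff[OF hsub_syspowspace] Phi_ketbra_in v)
    have "cinner (?p w - w) v = 0" using * w by blast
    then have "cinner w w = 0"
      using w v by (simp add: cinner_diff_left cinner_Phi_ketbra) (simp add: w_def cinner_diff_right)
    then show "?p v = v" by (simp add: cinner_eq_zero_iff w_def)
  qed
  then have M: "multspace = {v\<in>syspowspace n. \<forall>u\<in>(\<lambda>u. ?p u - u) ` syspowspace n. cinner u v = 0}"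
    unfolding multspace_def by blast
  show ?thesis unfolding M by (rule hsub_orthogonal[OF hsub_syspowspace])
qed

definition mtensor :: "'h \<Rightarrow> ('h \<times> 'k list) ell2 \<Rightarrow> ('h \<times> 'k list) ell2" where
  "mtensor h g = \<Phi> (ketbra h e) g"

text \<open>Inner products follow from the matrix unit relations, as \<Phi> |e\<rangle>\<langle>e|
  is the identity on \<open>multspace\<close>. Totality follows from
  \<open>Phi_resolution\<close>.\<close>

lemma htensor_mtensor: "htensor mtensor UNIV multspace (syspowspace n)"
proof
  show "mtensor x y \<in> syspowspace n" if "y \<in> multspace" for x y
    unfolding mtensor_def by (rule Phi_ketbra_in[OF multspace_sub[OF that]])
  show "cinner (mtensor x y) (mtensor x' y') = cinner x x' * cinner y y'"
    if "y \<in> multspace" "y' \<in> multspace" for x x' y y'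
  proof -
    have "cinner (mtensor x y) (mtensor x' y') = cinner y (\<Phi> (ketbra e x) (\<Phi> (ketbra x' e) y'))"
      unfolding mtensor_def by (intro cinner_Phi_ketbra Phi_ketbra_in multspace_sub that)
    also have "\<dots> = cinner x x' * cinner y y'"
      using that(2) by (simp add: Phi_ketbra_comp cinner_scaleC_right multspace_def)
    finally show ?thesis .
  qed
  fix z assume z: "z \<in> syspowspace n" "\<And>x y. x \<in> UNIV \<Longrightarrow> y \<in> multspace \<Longrightarrow> cinner (mtensor x y) z = 0"
  have "cinner z (\<Phi> (ketbra b b) z) = 0" for b
  proof -
    \<comment> \<open>This vector recovers \<Phi> |b\<rangle>\<langle>b| z as an elementary tensor,
      to which z is orthogonal.\<close>
    have "\<Phi> (ketbra e b) z \<in> multspace"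
      using z(1) by (simp add: multspace_def Phi_ketbra_in Phi_ketbra_comp cinner_unit)
    from z(2)[OF UNIV_I this, of b] have "cinner (\<Phi> (ketbra b b) z) z = 0"
      by (simp add: mtensor_def Phi_ketbra_comp cinner_unit)
    then show ?thesis using cinner_commute[of z] by simp
  qed
  with Phi_resolution[OF z(1) z(1)] have "((\<lambda>b. 0) has_sum cinner z z) (basis :: 'h set)" by simp
  then have "cinner z z = 0" using has_sum_unique[OF _ has_sum_0_simp] by blast
  then show "z = 0" by (simp add: cinner_eq_zero_iff)
qed (auto simp: hsub_multspace hsub_syspowspace)

interpretation m: htensor mtensor UNIV multspace "syspowspace n"
  by (rule htensor_mtensor)

text \<open>The same identification after tensoring with one more copy of \<open>K\<close>, which turns
  \<open>\<Phi> \<otimes> id\<close> into \<open>X \<mapsto> X \<otimes> 1\<close>.\<close>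

lemma mtensor_lift_exists:
  assumes "g \<in> multspace"
  shows "\<exists>W. W \<in> bmap (syspowspace (Suc 0)) (syspowspace (Suc n)) \<and>
    (\<forall>h k. W (tensor_one h k) = tensor_syspow (mtensor h g) k)"
  using tensor_map_right[OF one.swap syspow.swap onb_basis m.tau_bmap_left[OF assms]] by blast

text \<open>For fixed g, the extension of h \<otimes> k \<mapsto> (h \<otimes> g) \<otimes> k to all
  of H \<otimes> K. As a map of both arguments it moves the copy of K past the multiplicity
  space.\<close>

definition amp :: "('h \<times> 'k list) ell2 \<Rightarrow> ('h \<times> 'k list) ell2 \<Rightarrow> ('h \<times> 'k list) ell2" where
  "amp x g = (SOME W. W \<in> bmap (syspowspace (Suc 0)) (syspowspace (Suc n)) \<and>
    (\<forall>h k. W (tensor_one h k) = tensor_syspow (mtensor h g) k)) x"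

lemma amp_bmap: "g \<in> multspace \<Longrightarrow> (\<lambda>x. amp x g) \<in> bmap (syspowspace (Suc 0)) (syspowspace (Suc n))"
  and amp_tensor_one: "g \<in> multspace \<Longrightarrow> amp (tensor_one h k) g = tensor_syspow (mtensor h g) k"
  using someI_ex[OF mtensor_lift_exists, of g] unfolding amp_def by auto

lemma htensor_amp: "htensor amp (syspowspace (Suc 0)) multspace (syspowspace (Suc n))"
proof
  show in': "amp x g \<in> syspowspace (Suc n)" if "x \<in> syspowspace (Suc 0)" "g \<in> multspace" for x g
    using bmap_in[OF amp_bmap[OF that(2)] that(1)] .
  show "cinner (amp x g) (amp x' g') = cinner x x' * cinner g g'"
    if x: "x \<in> syspowspace (Suc 0)" "x' \<in> syspowspace (Suc 0)" and g: "g \<in> multspace" "g' \<in> multspace" for x x' g g'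
  proof -
    obtain B where B: "B \<in> bmap (syspowspace (Suc n)) (syspowspace (Suc 0))"
      and Bc: "\<And>x y. x \<in> syspowspace (Suc 0) \<Longrightarrow> y \<in> syspowspace (Suc n) \<Longrightarrow> cinner x (B y) = cinner (amp x g) y"
      using bmap_adjoint[OF hsub_syspowspace hsub_syspowspace amp_bmap[OF g(1)]] by blast
    have BB: "B \<circ> (\<lambda>x. amp x g') \<in> bmap (syspowspace (Suc 0)) (syspowspace (Suc 0))"
      by (rule bmap_comp[OF amp_bmap[OF g(2)] B])
    have sc: "(\<lambda>x. cinner g g' *\<^sub>C x) \<in> bmap (syspowspace (Suc 0)) (syspowspace (Suc 0))"
      by (rule bmapI[where M = "cmod (cinner g g')"])
        (auto simp: hsub_scale[OF hsub_syspowspace] scaleC_add_right scaleC_scaleC norm_scaleC mult.commute)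
    \<comment> \<open>The inner product formula says that \<open>amp\<close> at g', followed by the
      adjoint of \<open>amp\<close> at g, is a scalar. This is checked on elementary tensors and
      extended by \<open>tau_ext\<close>.\<close>
    have "(B \<circ> (\<lambda>x. amp x g')) x' = cinner g g' *\<^sub>C x'"
    proof (rule one.tau_ext[OF hsub_syspowspace BB sc _ x(2)])
      fix h :: 'h and k :: 'k
      have t1: "tensor_one h k \<in> syspowspace (Suc 0)" by (intro one.tau_in UNIV_I)
      show "(B \<circ> (\<lambda>x. amp x g')) (tensor_one h k) = cinner g g' *\<^sub>C tensor_one h k"
      proof (rule one.tau_eqI)
        show "(B \<circ> (\<lambda>x. amp x g')) (tensor_one h k) \<in> syspowspace (Suc 0)" by (rule bmap_in[OF BB t1])
        show "cinner g g' *\<^sub>C tensor_one h k \<in> syspowspace (Suc 0)" by (rule hsub_scale[OF hsub_syspowspace t1])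
        fix h' :: 'h and k' :: 'k
        have t2: "tensor_one h' k' \<in> syspowspace (Suc 0)" by (intro one.tau_in UNIV_I)
        show "cinner (tensor_one h' k') ((B \<circ> (\<lambda>x. amp x g')) (tensor_one h k)) =
            cinner (tensor_one h' k') (cinner g g' *\<^sub>C tensor_one h k)"
          using Bc[OF t2 in'[OF t1 g(2)]]
          by (simp add: amp_tensor_one g cinner_tensor_syspow m.cinner_tau one.cinner_tau cinner_scaleC_right)
      qed
    qed
    with Bc[OF x(1) in'[OF x(2) g(2)]] show ?thesis by (simp add: cinner_scaleC_right mult.commute)
  qed
  fix z assume z: "z \<in> syspowspace (Suc n)"
    "\<And>x g. x \<in> syspowspace (Suc 0) \<Longrightarrow> g \<in> multspace \<Longrightarrow> cinner (amp x g) z = 0"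
  show "z = 0"
  proof (rule syspow.total[OF z(1)])
    fix v :: "('h \<times> 'k list) ell2" and k assume v: "v \<in> syspowspace n"
    \<comment> \<open>The factor K is contracted with k first; the result is tested against the
      vectors \<open>mtensor h g\<close>.\<close>
    let ?c = "rcf (\<lambda>y x. tensor_syspow x y) (syspowspace n) (syspowspace (Suc n)) k z"
    have cc: "cinner v ?c = cinner (tensor_syspow v k) z" if "v \<in> syspowspace n" for v
      by (rule htensor.cinner_rcf[OF syspow.swap UNIV_I that z(1)])
    have "?c = 0"
    proof (rule m.total)
      show "?c \<in> syspowspace n" by (rule bmap_in[OF htensor.rcf_bmap[OF syspow.swap UNIV_I] z(1)])
      fix h g assume g: "g \<in> multspace"
      show "cinner (mtensor h g) ?c = 0"
        using z(2)[OF one.tau_in[OF UNIV_I UNIV_I] g, of h k] g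
        by (simp add: cc m.tau_in amp_tensor_one)
    qed
    with cc[OF v] show "cinner (tensor_syspow v k) z = 0" by simp
  qed
qed (auto simp: hsub_multspace hsub_syspowspace)

interpretation amp: htensor amp "syspowspace (Suc 0)" multspace "syspowspace (Suc n)"
  by (rule htensor_amp)

definition amplify :: "(('h \<times> 'k list) ell2 \<Rightarrow> ('h \<times> 'k list) ell2) \<Rightarrow> ('h \<times> 'k list) ell2 \<Rightarrow> ('h \<times> 'k list) ell2" where
  "amplify X = amp.ot X (idop multspace)"

text \<open>The property that \<open>tensor_id\<close> asks for; on the first factor it says that
  \<Phi> a acts on \<open>mtensor h g\<close> by applying a to h.\<close>

lemma amplify_one:
  assumes a: "a \<in> bop UNIV" and c: "c \<in> bop UNIV"
  shows "amplify (one.ot a c) = syspow.ot n (\<Phi> a) c"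
  unfolding amplify_def
proof (rule amp.op_tensor_unique)
  note pc = syspow.op_tensor_bop[OF Phi_bop[OF a] c] and ac = one.op_tensor_bop[OF a c]
  show "syspow.ot n (\<Phi> a) c \<in> bop (syspowspace (Suc n))" by (rule pc)
  fix x g :: "('h \<times> 'k list) ell2" assume x: "x \<in> syspowspace (Suc 0)" and g: "g \<in> multspace"
  have "(syspow.ot n (\<Phi> a) c \<circ> (\<lambda>x. amp x g)) x = ((\<lambda>x. amp x g) \<circ> one.ot a c) x"
  proof (rule one.tau_ext[OF hsub_syspowspace _ _ _ x])
    show "syspow.ot n (\<Phi> a) c \<circ> (\<lambda>x. amp x g) \<in> bmap (syspowspace (Suc 0)) (syspowspace (Suc n))"
      by (rule bmap_comp[OF amp_bmap[OF g] bop_bmap[OF pc]])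
    show "(\<lambda>x. amp x g) \<circ> one.ot a c \<in> bmap (syspowspace (Suc 0)) (syspowspace (Suc n))"
      by (rule bmap_comp[OF bop_bmap[OF ac] amp_bmap[OF g]])
    fix h k
    have "\<Phi> a \<circ> \<Phi> (ketbra h e) = \<Phi> (ketbra (a h) e)"
      unfolding nsh_comp[OF Phi_star_hom a ketbra_bop, symmetric] comp_ketbra[OF a] ..
    then have "\<Phi> a (mtensor h g) = mtensor (a h) g" by (simp add: mtensor_def fun_eq_iff)
    then show "(syspow.ot n (\<Phi> a) c \<circ> (\<lambda>x. amp x g)) (tensor_one h k) = ((\<lambda>x. amp x g) \<circ> one.ot a c) (tensor_one h k)"
      by (simp add: amp_tensor_one g one.op_tensor_tau a c syspow.op_tensor_tau[OF Phi_bop[OF a] c] m.tau_in)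
  qed
  then show "syspow.ot n (\<Phi> a) c (amp x g) = amp (one.ot a c x) (idop multspace g)" using g by simp
qed

text \<open>Let Z commute with all a \<otimes> (d \<otimes> c) = (a \<otimes> d) \<otimes> c. Then Z
  commutes with 1 \<otimes> c and, through a double commutant, with Y \<otimes> 1 for Y in A
  \<otimes> C_n, in particular for Y = \<Phi> a. So it commutes with the amplification of every a
  \<otimes> c and, through a second double commutant, with that of X.\<close>

lemma amplify_in:
  assumes X: "X \<in> sys_alg (bop UNIV) C (Suc 0)"
  shows "amplify X \<in> sys_alg (bop UNIV) C (Suc n)"
proof -
  note B = op_algebra_bop[OF hsub_UNIV, where 'a = 'h] and CC = C_op_algebra[OF C]
    and N = alg_pow_op_algebra[OF C]
  have Xb: "X \<in> bop (syspowspace (Suc 0))" by (rule op_algebra_sub[OF sys_alg_op_algebra[OF C] X])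
  have Lb: "amplify X \<in> bop (syspowspace (Suc n))"
    unfolding amplify_def by (rule amp.op_tensor_bop[OF Xb bop_idop[OF hsub_multspace]])
  have "amplify X \<in> commutant (syspowspace (Suc n)) (commutant (syspowspace (Suc n))
      (sys.elementary (Suc n) (bop UNIV) (alg_pow C (Suc n))))"
  proof (rule commutantI[OF Lb])
    fix Z v assume Z: "Z \<in> commutant (syspowspace (Suc n)) (sys.elementary (Suc n) (bop (UNIV :: 'h set)) (alg_pow C (Suc n)))"
    note Zb = commutant_bop[OF Z]
    have Zc: "syspow.ot n (sys.ot n a d) c \<circ> Z = Z \<circ> syspow.ot n (sys.ot n a d) c"
      if "a \<in> bop UNIV" "d \<in> alg_pow C n" "c \<in> C" for a d c
    proof -
      have "pow.ot n d c \<in> alg_pow C (Suc n)"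
        using pow.op_tensor_in_vn_tensor[OF N CC that(2,3)] by simp
      then have "sys.ot (Suc n) a (pow.ot n d c) \<in> sys.elementary (Suc n) (bop UNIV) (alg_pow C (Suc n))"
        using that by (auto simp: sys.elementary_def)
      from commutantD[OF Z this] show ?thesis
        using op_tensor_assoc[OF that(1) op_algebra_sub[OF N that(2)] C_bop[OF that(3)]]
        by (simp add: fun_eq_iff)
    qed
    have right: "syspow.ot n (idop (syspowspace n)) c \<circ> Z = Z \<circ> syspow.ot n (idop (syspowspace n)) c"
      if "c \<in> C" for c
      using Zc[OF bop_idop[OF hsub_UNIV] op_algebra_idop[OF N] that] by (simp add: sys.op_tensor_idop)
    have left: "syspow.ot n Y (idop UNIV) \<circ> Z = Z \<circ> syspow.ot n Y (idop UNIV)"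
      if "Y \<in> sys_alg (bop UNIV) C n" for Y
    proof (rule syspow.commute_double_commutant_left[OF Zb])
      show "sys.elementary n (bop (UNIV :: 'h set)) (alg_pow C n) \<subseteq> bop (syspowspace n)"
        by (rule sys.elementary_bop[OF B N])
      show "Y \<in> commutant (syspowspace n) (commutant (syspowspace n) (sys.elementary n (bop UNIV) (alg_pow C n)))"
        using that by (simp add: sys_alg_def sys.vn_tensor_eq)
      fix Y assume "Y \<in> sys.elementary n (bop (UNIV :: 'h set)) (alg_pow C n)"
      then show "syspow.ot n Y (idop UNIV) \<circ> Z = Z \<circ> syspow.ot n Y (idop UNIV)"
        using Zc op_algebra_idop[OF CC] by (auto simp: sys.elementary_def)
    qed
    have "amp.ot X (idop multspace) \<circ> Z = Z \<circ> amp.ot X (idop multspace)"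
    proof (rule amp.commute_double_commutant_left[OF Zb])
      show "one.elementary (bop (UNIV :: 'h set)) C \<subseteq> bop (syspowspace (Suc 0))"
        by (rule one.elementary_bop[OF B CC])
      show "X \<in> commutant (syspowspace (Suc 0)) (commutant (syspowspace (Suc 0)) (one.elementary (bop UNIV) C))"
        using sys_alg_1_generated X by blast
      fix Y assume "Y \<in> one.elementary (bop (UNIV :: 'h set)) C"
      then obtain a c where Y: "Y = one.ot a c" and a: "a \<in> bop UNIV" and c: "c \<in> C"
        by (auto simp: one.elementary_def)
      have cb: "c \<in> bop UNIV" by (rule C_bop[OF c])
      have "syspow.ot n (\<Phi> a) c = syspow.ot n (\<Phi> a) (idop UNIV) \<circ> syspow.ot n (idop (syspowspace n)) c"
        unfolding syspow.op_tensor_comp[OF Phi_bop[OF a] bop_idop[OF hsub_UNIV] bop_idop[OF hsub_syspowspace] cb]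
        by (simp add: comp_idop[OF hsub_syspowspace Phi_bop[OF a]] idop_comp[OF hsub_UNIV cb])
      then have "amplify Y = syspow.ot n (\<Phi> a) (idop UNIV) \<circ> syspow.ot n (idop (syspowspace n)) c"
        unfolding Y amplify_one[OF a cb] .
      then show "amp.ot Y (idop multspace) \<circ> Z = Z \<circ> amp.ot Y (idop multspace)"
        using left[OF nsh_in[OF Phi_star_hom a]] right[OF c] unfolding amplify_def by (simp add: fun_eq_iff)
    qed
    then show "Z (amplify X v) = amplify X (Z v)" by (simp add: amplify_def fun_eq_iff)
  qed
  then show ?thesis by (simp add: sys_alg_def sys.vn_tensor_eq)
qed

lemma amplify_star_hom:
  "normal_star_hom (syspowspace (Suc 0)) (sys_alg (bop UNIV) C (Suc 0))
    (syspowspace (Suc n)) (sys_alg (bop UNIV) C (Suc n)) amplify"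
proof -
  note I = bop_idop[OF hsub_multspace]
  note A1 = sys_alg_op_algebra[OF C, where 'h = 'h and n = "Suc 0"]
    and A2 = sys_alg_op_algebra[OF C, where 'h = 'h and n = "Suc n"]
  have s1: "X \<in> bop (syspowspace (Suc 0))" if "X \<in> sys_alg (bop (UNIV :: 'h set)) C (Suc 0)" for X
    by (rule op_algebra_sub[OF A1 that])
  have s2: "X \<in> bop (syspowspace (Suc n))" if "X \<in> sys_alg (bop (UNIV :: 'h set)) C (Suc n)" for X
    by (rule op_algebra_sub[OF A2 that])
  have II: "idop multspace \<circ> idop multspace = idop multspace"
    by (auto simp: idop_def fun_eq_iff)
  have aI: "adj multspace (idop multspace) = idop multspace"
    by (rule adj_unique[OF hsub_multspace I]) simp
  show ?thesis
    unfolding normal_star_hom_def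
  proof (intro conjI ballI allI)
    show "amplify ` sys_alg (bop UNIV) C (Suc 0) \<subseteq> sys_alg (bop UNIV) C (Suc n)" using amplify_in by blast
    fix a assume a: "a \<in> sys_alg (bop (UNIV :: 'h set)) C (Suc 0)"
    show "amplify (\<lambda>x. c *\<^sub>C a x) = (\<lambda>x. c *\<^sub>C amplify a x)" for c
      unfolding amplify_def by (rule amp.op_tensor_scale_left[OF s1[OF a] I])
    show "amplify (adj (syspowspace (Suc 0)) a) = adj (syspowspace (Suc n)) (amplify a)"
      unfolding amplify_def by (simp add: amp.op_tensor_adj s1 a I aI)
    fix b assume b: "b \<in> sys_alg (bop (UNIV :: 'h set)) C (Suc 0)"
    show "amplify (\<lambda>x. a x + b x) = (\<lambda>x. amplify a x + amplify b x)"
      unfolding amplify_def by (rule amp.op_tensor_add_left[OF s1[OF a] s1[OF b] I])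
    show "amplify (a \<circ> b) = amplify a \<circ> amplify b"
      unfolding amplify_def by (simp add: amp.op_tensor_comp s1 a b I II)
  next
    show "continuous_map (subtopology (ultraweak (syspowspace (Suc 0))) (sys_alg (bop UNIV) C (Suc 0)))
        (subtopology (ultraweak (syspowspace (Suc n))) (sys_alg (bop UNIV) C (Suc n))) amplify"
    proof (rule continuous_map_ultraweakI[OF hsub_syspowspace hsub_syspowspace])
      show "sys_alg (bop (UNIV :: 'h set)) C (Suc 0) \<subseteq> bop (syspowspace (Suc 0))" using s1 by blast
      then show "normal_on (syspowspace (Suc 0)) (sys_alg (bop UNIV) C (Suc 0)) (\<lambda>a. uwf UNIV x y (amplify a))"
        if "sqfam (syspowspace (Suc n)) UNIV x" "sqfam (syspowspace (Suc n)) UNIV y"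
        for x y :: "nat \<Rightarrow> ('h \<times> 'k list) ell2"
        unfolding amplify_def by (rule amp.amplification_normal[OF _ that])
      show "sys_alg (bop (UNIV :: 'h set)) C (Suc n) \<subseteq> bop (syspowspace (Suc n))" using s2 by blast
    qed (rule amplify_in)
  qed
qed

text \<open>\<open>amplify\<close> witnesses the choice in \<open>tensor_id\<close>. Evaluating the
  defining condition at 1 \<otimes> 1 gives unitality of whatever is chosen.\<close>

lemma tensor_id_props:
  "normal_star_hom (syspowspace (Suc 0)) (sys_alg (bop UNIV) C (Suc 0)) (syspowspace (Suc n))
     (sys_alg (bop UNIV) C (Suc n)) (tensor_id (bop UNIV) C n \<Phi>)"
  "tensor_id (bop UNIV) C n \<Phi> (idop (syspowspace (Suc 0))) = idop (syspowspace (Suc n))"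
proof -
  let ?P = "\<lambda>\<Psi>. normal_star_hom (syspowspace 1) (sys_alg (bop UNIV) C 1) (syspowspace (Suc n))
      (sys_alg (bop UNIV) C (Suc n)) \<Psi>
     \<and> (\<forall>a\<in>bop UNIV. \<forall>c\<in>C. \<Psi> (sys_tensor 1 a (first_copy c)) = syspow.ot n (\<Phi> a) c)"
  have "?P amplify"
    using amplify_star_hom amplify_one C_bop by (simp add: sys_tensor_first_copy[unfolded One_nat_def])
  then have T: "?P (tensor_id (bop UNIV) C n \<Phi>)" unfolding tensor_id_def by (rule someI[of ?P])
  then show "normal_star_hom (syspowspace (Suc 0)) (sys_alg (bop UNIV) C (Suc 0)) (syspowspace (Suc n))
     (sys_alg (bop UNIV) C (Suc n)) (tensor_id (bop UNIV) C n \<Phi>)" by simp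
  have IC: "idop UNIV \<in> C" by (rule op_algebra_idop[OF C_op_algebra[OF C]])
  have "sys_tensor 1 (idop UNIV :: 'h \<Rightarrow> 'h) (first_copy (idop UNIV :: 'k \<Rightarrow> 'k)) = idop (syspowspace (Suc 0))"
    by (subst sys_tensor_first_copy) (simp_all add: bop_idop one.op_tensor_idop)
  with T IC bop_idop[OF hsub_UNIV]
  show "tensor_id (bop UNIV) C n \<Phi> (idop (syspowspace (Suc 0))) = idop (syspowspace (Suc n))"
    by (metis Phi_idop syspow.op_tensor_idop)
qed

lemma unital_hom_step:
  assumes J: "unital_hom (Suc 0) J" shows "unital_hom (Suc n) (tensor_id (bop UNIV) C n \<Phi> \<circ> J)"
  using normal_star_hom_comp[OF _ tensor_id_props(1)] J tensor_id_props(2)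
  unfolding unital_hom_def by auto

end

text \<open>The unit vector e is the reference vector that cuts out the multiplicity space at every
  step of the recursion.\<close>

theorem unital_hom_iterate:
  fixes J :: "('h::hilbert_space \<Rightarrow> 'h) \<Rightarrow> ('h \<times> 'k list) ell2 \<Rightarrow> ('h \<times> 'k list) ell2" and e :: 'h
  assumes J: "transition (bop UNIV) C J" and e: "norm e = 1"
  shows "unital_hom (Suc n) (iterate (bop UNIV) C J (Suc n))"
proof (induction n)
  case 0
  show ?case using J by (simp add: transition_def unital_hom_def)
next
  case (Suc n)
  have "unital_hom (Suc 0) J" using J by (simp add: transition_def unital_hom_def)
  from unital_hom_step[OF Suc e this] show ?case by (simp only: iterate.simps)
qed

end

section \<open>Universal preparability\<close>

lemma norm_uwf_le:
  fixes x :: "nat \<Rightarrow> 'a::hilbert_space"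
  assumes x: "sqfam UNIV UNIV x" and a: "\<And>v. norm (a v) \<le> M * norm v" and M: "0 \<le> M"
  shows "cmod (uwf UNIV x x a) \<le> M * Re (uwf UNIV x x (idop UNIV))"
proof -
  have "uwf UNIV x x (idop UNIV) = (\<Sum>\<^sub>\<infinity>i. of_real ((norm (x i))\<^sup>2))"
    unfolding uwf_def by (simp add: cinner_same)
  also have "\<dots> = of_real (\<Sum>\<^sub>\<infinity>i. (norm (x i))\<^sup>2)"
    using x by (intro infsumI has_sum_of_real has_sum_infsum) (simp add: sqfam_def)
  also have "(\<Sum>\<^sub>\<infinity>i. (norm (x i))\<^sup>2) = l2norm UNIV x * l2norm UNIV x"
    by (simp add: l2norm_def infsum_nonneg)
  finally have E: "Re (uwf UNIV x x (idop UNIV)) = l2norm UNIV x * l2norm UNIV x"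
    by (simp del: idop_apply)
  show ?thesis unfolding E by (rule uwf_summable(3)[OF x x a M])
qed

lemma functional_bound:
  fixes \<omega> :: "('a::hilbert_space \<Rightarrow> 'a) \<Rightarrow> complex"
  assumes sep: "separable_space (euclidean :: 'a topology)" and \<omega>: "pos_functional UNIV (bop UNIV) \<omega>"
    and a: "a \<in> bop UNIV" "\<And>v. norm (a v) \<le> M * norm v" "0 \<le> M"
  shows "cmod (\<omega> a) \<le> M * Re (\<omega> (idop UNIV))"
proof -
  obtain w :: "nat \<Rightarrow> 'a" where w: "sqfam UNIV UNIV w" "\<And>a. a \<in> bop UNIV \<Longrightarrow> \<omega> a = uwf UNIV w w a"
    using pos_functional_decomposition[OF sep \<omega>] by blast
  show ?thesis using norm_uwf_le[OF w(1) a(2,3)] by (simp add: w(2) a(1) bop_idop)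
qed

text \<open>Written as a linear combination so that membership in \<open>bop\<close> follows from
  \<open>bop_plus\<close> and \<open>bop_scaled\<close>.\<close>

definition coproj :: "'a::complex_inner \<Rightarrow> 'a \<Rightarrow> 'a" where
  "coproj \<xi> = (\<lambda>v. idop UNIV v + (-1) *\<^sub>C ketbra \<xi> \<xi> v)"

lemma coproj_apply: "coproj \<xi> v = v - cinner \<xi> v *\<^sub>C \<xi>"
  by (simp add: coproj_def ketbra_def scaleC_minus1)

lemma coproj_bop: "coproj \<xi> \<in> bop UNIV"
  unfolding coproj_def by (intro bop_plus bop_scaled bop_idop ketbra_bop hsub_UNIV)

lemma coproj_projection:
  fixes \<xi> :: "'a::hilbert_space"
  assumes \<xi>: "norm \<xi> = 1"
  shows "adj UNIV (coproj \<xi>) \<circ> coproj \<xi> = coproj \<xi>"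
proof -
  have x: "cinner \<xi> \<xi> = 1" using \<xi> by (simp add: cinner_same)
  have "adj UNIV (coproj \<xi>) = coproj \<xi>"
  proof (rule adj_unique[OF hsub_UNIV coproj_bop])
    fix u v
    show "cinner (coproj \<xi> u) v = cinner u (coproj \<xi> v)"
      using cinner_commute[of u \<xi>]
      by (simp add: coproj_apply cinner_diff_left cinner_diff_right cinner_scaleC_left cinner_scaleC_right mult.commute)
  qed
  then show ?thesis
    by (simp add: fun_eq_iff coproj_apply cinner_diff_right cinner_scaleC_right x)
qed

lemma cinner_coproj:
  fixes \<xi> :: "'a::hilbert_space"
  assumes "norm \<xi> = 1"
  shows "cinner v (coproj \<xi> v) = of_real ((norm (coproj \<xi> v))\<^sup>2)"
proof -
  have "cinner v (coproj \<xi> v) = cinner v (adj UNIV (coproj \<xi>) (coproj \<xi> v))"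
    using coproj_projection[OF assms] by (metis comp_apply)
  also have "\<dots> = cinner (coproj \<xi> v) (coproj \<xi> v)"
    by (simp add: cinner_adj_right[OF hsub_UNIV coproj_bop])
  finally show ?thesis by (simp add: cinner_same)
qed

text \<open>Each vector w i of a decomposition of \<omega> splits into a multiple of \<xi> and q i
  orthogonal to it. The i-th error has three terms of modulus at most M * norm (w i) * norm (q i),
  which explains the 3; Cauchy-Schwarz over i gives the two square roots.\<close>

lemma concentration:
  fixes \<omega> :: "('a::hilbert_space \<Rightarrow> 'a) \<Rightarrow> complex"
  assumes sep: "separable_space (euclidean :: 'a topology)" and \<omega>: "pos_functional UNIV (bop UNIV) \<omega>"
    and a: "a \<in> bop UNIV" "\<And>v. norm (a v) \<le> M * norm v" "0 \<le> M" and \<xi>: "norm \<xi> = 1"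
  shows "cmod (\<omega> a - \<omega> (idop UNIV) * cinner \<xi> (a \<xi>))
    \<le> 3 * M * (sqrt (Re (\<omega> (idop UNIV))) * sqrt (Re (\<omega> (coproj \<xi>))))"
proof -
  obtain w :: "nat \<Rightarrow> 'a" where w: "sqfam UNIV UNIV w" "\<And>a. a \<in> bop UNIV \<Longrightarrow> \<omega> a = uwf UNIV w w a"
    using pos_functional_decomposition[OF sep \<omega>] by blast
  define q where "q i = coproj \<xi> (w i)" for i
  define c where "c i = cinner \<xi> (w i)" for i
  have wq: "w i = c i *\<^sub>C \<xi> + q i" for i by (simp add: q_def c_def coproj_apply)
  have q: "sqfam UNIV UNIV q"
    unfolding q_def by (rule sqfam_image[OF w(1) bop_bmap[OF coproj_bop]])
  have wsq: "(\<lambda>i. (norm (w i))\<^sup>2) summable_on UNIV" and qsq: "(\<lambda>i. (norm (q i))\<^sup>2) summable_on UNIV"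
    using w(1) q by (auto simp: sqfam_def)
  have lw: "l2norm UNIV w = sqrt (Re (\<omega> (idop UNIV)))"
  proof -
    have "((\<lambda>i. complex_of_real ((norm (w i))\<^sup>2)) has_sum of_real (\<Sum>\<^sub>\<infinity>i. (norm (w i))\<^sup>2)) UNIV"
      by (intro has_sum_of_real has_sum_infsum wsq)
    then have "\<omega> (idop UNIV) = of_real (\<Sum>\<^sub>\<infinity>i. (norm (w i))\<^sup>2)"
      unfolding w(2)[OF bop_idop[OF hsub_UNIV]] uwf_def by (intro infsumI) (simp add: cinner_same)
    then show ?thesis by (simp add: l2norm_def)
  qed
  have lq: "l2norm UNIV q = sqrt (Re (\<omega> (coproj \<xi>)))"
  proof -
    have "((\<lambda>i. complex_of_real ((norm (q i))\<^sup>2)) has_sum of_real (\<Sum>\<^sub>\<infinity>i. (norm (q i))\<^sup>2)) UNIV"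
      by (intro has_sum_of_real has_sum_infsum qsq)
    then have "\<omega> (coproj \<xi>) = of_real (\<Sum>\<^sub>\<infinity>i. (norm (q i))\<^sup>2)"
      unfolding w(2)[OF coproj_bop] uwf_def by (intro infsumI) (simp add: cinner_coproj[OF \<xi>] q_def)
    then show ?thesis by (simp add: l2norm_def)
  qed
  define f where "f i = cinner (w i) (a (w i)) - cinner (w i) (w i) * cinner \<xi> (a \<xi>)" for i
  have f: "cmod (f i) \<le> 3 * M * (norm (w i) * norm (q i))" for i
  proof -
    have xx: "cinner \<xi> \<xi> = 1" using \<xi> by (simp add: cinner_same)
    have xq: "cinner \<xi> (q i) = 0" by (simp add: q_def coproj_apply cinner_diff_right cinner_scaleC_right xx)
    have qw: "cinner (q i) (w i) = of_real ((norm (q i))\<^sup>2)"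
      using cinner_coproj[OF \<xi>, of "w i"] cinner_commute[of "q i" "w i"] by (simp add: q_def)
    have ww: "cinner (w i) (w i) = cnj (c i) * c i + of_real ((norm (q i))\<^sup>2)"
      by (subst (1) wq) (simp add: cinner_add_left cinner_scaleC_left qw c_def)
    have aw: "a (w i) = c i *\<^sub>C a \<xi> + a (q i)"
      by (subst wq) (simp add: bop_add[OF a(1)] bop_scale[OF a(1)])
    have "cinner (w i) (a (w i)) = cinner (w i) (a (q i)) + c i * cinner (w i) (a \<xi>)"
      by (simp add: aw cinner_add_right cinner_scaleC_right)
    also have "cinner (w i) (a \<xi>) = cnj (c i) * cinner \<xi> (a \<xi>) + cinner (q i) (a \<xi>)"
      by (subst wq) (simp add: cinner_add_left cinner_scaleC_left)
    finally have fi: "f i = cinner (w i) (a (q i)) + c i * cinner (q i) (a \<xi>) - of_real ((norm (q i))\<^sup>2) * cinner \<xi> (a \<xi>)"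
      by (simp add: f_def ww algebra_simps)
    have cw: "cmod (c i) \<le> norm (w i)" using Cauchy_Schwarz[of \<xi> "w i"] \<xi> by (simp add: c_def)
    have ax: "norm (a \<xi>) \<le> M" using a(2)[of \<xi>] \<xi> by simp
    have "(norm (w i))\<^sup>2 = (cmod (c i))\<^sup>2 + (norm (q i))\<^sup>2"
      by (subst wq) (simp add: norm_add_sq norm_scaleC cinner_scaleC_left xq \<xi>)
    then have "(norm (q i))\<^sup>2 \<le> (norm (w i))\<^sup>2" by simp
    then have qw': "norm (q i) \<le> norm (w i)" by (rule power2_le_imp_le) simp
    have t1: "cmod (cinner (w i) (a (q i))) \<le> norm (w i) * (M * norm (q i))"
      by (rule order_trans[OF Cauchy_Schwarz]) (intro mult_left_mono a(2) norm_ge_zero)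
    have t2: "cmod (c i * cinner (q i) (a \<xi>)) \<le> norm (w i) * (norm (q i) * M)"
      unfolding norm_mult
      by (intro mult_mono cw order_trans[OF Cauchy_Schwarz] mult_left_mono ax) auto
    have t3: "cmod (of_real ((norm (q i))\<^sup>2) * cinner \<xi> (a \<xi>)) \<le> (norm (w i) * norm (q i)) * M"
    proof -
      have "(norm (q i))\<^sup>2 \<le> norm (w i) * norm (q i)"
        unfolding power2_eq_square by (intro mult_right_mono qw') simp
      moreover have "cmod (cinner \<xi> (a \<xi>)) \<le> M"
        using Cauchy_Schwarz[of \<xi> "a \<xi>"] ax \<xi> by simp
      ultimately have "(norm (q i))\<^sup>2 * cmod (cinner \<xi> (a \<xi>)) \<le> (norm (w i) * norm (q i)) * M"
        by (intro mult_mono) auto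
      then show ?thesis by (simp add: norm_mult norm_power)
    qed
    have "cmod (f i) \<le> cmod (cinner (w i) (a (q i))) + cmod (c i * cinner (q i) (a \<xi>))
        + cmod (of_real ((norm (q i))\<^sup>2) * cinner \<xi> (a \<xi>))"
      unfolding fi by (intro order_trans[OF norm_triangle_ineq4] add_right_mono norm_triangle_ineq)
    also have "\<dots> \<le> 3 * M * (norm (w i) * norm (q i))" using t1 t2 t3 by (simp add: algebra_simps)
    finally show ?thesis .
  qed
  note sp = sqfam_product[OF w(1) q]
  have s: "(\<lambda>i. 3 * M * (norm (w i) * norm (q i))) summable_on UNIV"
    by (intro summable_on_cmult_right sp(1))
  have fs: "(\<lambda>i. cmod (f i)) summable_on UNIV"
    by (rule summable_on_comparison_test[OF s]) (auto intro: f)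
  have idb: "idop UNIV \<in> bop (UNIV :: 'a set)" by (rule bop_idop[OF hsub_UNIV])
  have "(f has_sum (\<omega> a - \<omega> (idop UNIV) * cinner \<xi> (a \<xi>))) UNIV"
  proof -
    have s1: "((\<lambda>i. cinner (w i) (a (w i))) has_sum \<omega> a) UNIV"
      unfolding w(2)[OF a(1)] uwf_def
      by (rule has_sum_infsum, rule uwf_summable_bmap(2)[OF w(1) w(1) bop_bmap[OF a(1)]])
    have s2: "((\<lambda>i. cinner (w i) (w i)) has_sum \<omega> (idop UNIV)) UNIV"
      using has_sum_infsum[OF uwf_summable_bmap(2)[OF w(1) w(1) bop_bmap[OF idb]]]
      by (simp add: w(2)[OF idb] uwf_def)
    have "((\<lambda>i. cinner (w i) (a (w i)) + cinner (w i) (w i) * (- cinner \<xi> (a \<xi>))) has_sum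
        (\<omega> a + \<omega> (idop UNIV) * (- cinner \<xi> (a \<xi>)))) UNIV"
      by (intro has_sum_add s1 has_sum_cmult_left s2)
    then show ?thesis by (simp add: f_def[abs_def])
  qed
  then have "cmod (\<omega> a - \<omega> (idop UNIV) * cinner \<xi> (a \<xi>)) = cmod (\<Sum>\<^sub>\<infinity>i. f i)" by (simp add: infsumI)
  also have "\<dots> \<le> (\<Sum>\<^sub>\<infinity>i. cmod (f i))" by (rule norm_infsum_bound[OF fs])
  also have "\<dots> \<le> (\<Sum>\<^sub>\<infinity>i. 3 * M * (norm (w i) * norm (q i)))" by (rule infsum_mono[OF fs s f])
  also have "\<dots> \<le> 3 * M * (l2norm UNIV w * l2norm UNIV q)"
    unfolding infsum_cmult_right' by (intro mult_left_mono sp(2)) (use a(3) in simp)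
  finally show ?thesis by (simp add: lw lq)
qed

text \<open>The parallelogram law gives N (u + v) \<le> 2 N u + 2 N v. Together with the bound
  uniform in k this lets a limit point inherit the convergence.\<close>

lemma vanishing_subspace:
  fixes N :: "nat \<Rightarrow> 'a::complex_inner \<Rightarrow> real"
  assumes nonneg: "\<And>k u. 0 \<le> N k u" and bound: "\<And>k u. N k u \<le> (norm u)\<^sup>2"
    and par: "\<And>k u v. N k (u + v) + N k (u - v) = 2 * N k u + 2 * N k v"
    and scale: "\<And>k c u. N k (c *\<^sub>C u) = (cmod c)\<^sup>2 * N k u"
  shows "hsub {u. (\<lambda>k. N k u) \<longlonglongrightarrow> 0}"
  unfolding hsub_def
proof (intro conjI ballI allI)
  have N0: "N k 0 = 0" for k using bound[of k 0] nonneg[of k 0] by simp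
  then show "0 \<in> {u. (\<lambda>k. N k u) \<longlonglongrightarrow> 0}" by simp
  have le: "N k (u + v) \<le> 2 * N k u + 2 * N k v" for k u v
    using par[of k u v] nonneg[of k "u - v"] by linarith
  show "u + v \<in> {u. (\<lambda>k. N k u) \<longlonglongrightarrow> 0}"
    if "u \<in> {u. (\<lambda>k. N k u) \<longlonglongrightarrow> 0}" "v \<in> {u. (\<lambda>k. N k u) \<longlonglongrightarrow> 0}" for u v
  proof -
    have "(\<lambda>k. 2 * N k u + 2 * N k v) \<longlonglongrightarrow> 2 * 0 + 2 * 0" using that by (intro tendsto_intros) auto
    then have "(\<lambda>k. 2 * N k u + 2 * N k v) \<longlonglongrightarrow> 0" by simp
    then have "(\<lambda>k. N k (u + v)) \<longlonglongrightarrow> 0"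
      by (rule tendsto_sandwich[OF _ _ tendsto_const, rotated 2]) (auto simp: nonneg le)
    then show ?thesis by simp
  qed
  show "c *\<^sub>C u \<in> {u. (\<lambda>k. N k u) \<longlonglongrightarrow> 0}" if "u \<in> {u. (\<lambda>k. N k u) \<longlonglongrightarrow> 0}" for u c
    using that by (auto simp: scale intro: tendsto_mult_right_zero)
  show "closed {u. (\<lambda>k. N k u) \<longlonglongrightarrow> 0}"
    unfolding closed_sequential_limits
  proof (intro allI impI, elim conjE)
    fix X l assume X: "\<forall>n. X n \<in> {u. (\<lambda>k. N k u) \<longlonglongrightarrow> 0}" "X \<longlonglongrightarrow> l"
    have "(\<lambda>k. N k l) \<longlonglongrightarrow> 0"
    proof (rule LIMSEQ_I)
      fix r :: real assume r: "0 < r"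
      have "(\<lambda>n. (norm (l - X n))\<^sup>2) \<longlonglongrightarrow> (norm (l - l))\<^sup>2" by (intro tendsto_intros X)
      then have "(\<lambda>n. (norm (l - X n))\<^sup>2) \<longlonglongrightarrow> 0" by simp
      \<comment> \<open>The inequality doubles both terms, so each may use up r / 4.\<close>
      from LIMSEQ_D[OF this, of "r / 4"] r obtain n where n: "(norm (l - X n))\<^sup>2 < r / 4" by auto
      have "(\<lambda>k. N k (X n)) \<longlonglongrightarrow> 0" using X(1) by simp
      from LIMSEQ_D[OF this, of "r / 4"] r obtain K where K: "\<And>k. k \<ge> K \<Longrightarrow> N k (X n) < r / 4"
        using nonneg by auto
      show "\<exists>no. \<forall>k\<ge>no. norm (N k l - 0) < r"
      proof (intro exI allI impI)
        fix k assume "k \<ge> K"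
        then show "norm (N k l - 0) < r"
          using le[of k "X n" "l - X n"] bound[of k "l - X n"] K[of k] n nonneg[of k l] by simp
      qed
    qed
    then show "l \<in> {u. (\<lambda>k. N k u) \<longlonglongrightarrow> 0}" by simp
  qed
qed

lemma tannery:
  fixes f :: "nat \<Rightarrow> nat \<Rightarrow> complex"
  assumes "\<And>m. (\<lambda>k. f m k) \<longlonglongrightarrow> g m" "\<And>m k. cmod (f m k) \<le> B m" "summable B"
  shows "(\<lambda>k. \<Sum>m. f m k) \<longlonglongrightarrow> (\<Sum>m. g m)"
  using tannerys_theorem[of f g sequentially B] assms by (simp add: case_prod_unfold)

lemma normal_state_convex:
  fixes S :: "'a::hilbert_space set" and \<theta> :: "'j \<Rightarrow> ('a \<Rightarrow> 'a) \<Rightarrow> complex"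
  assumes J: "finite J" and \<theta>: "\<And>j. j \<in> J \<Longrightarrow> normal_state S M (\<theta> j)"
    and w: "\<And>j. j \<in> J \<Longrightarrow> 0 \<le> w j" "(\<Sum>j\<in>J. w j) = 1"
  shows "normal_state S M (\<lambda>d. \<Sum>j\<in>J. of_real (w j) * \<theta> j d)"
  unfolding normal_state_def
proof (intro conjI ballI allI)
  note t = \<theta>[unfolded normal_state_def]
  show "(\<Sum>j\<in>J. of_real (w j) * \<theta> j (\<lambda>x. a x + b x)) =
      (\<Sum>j\<in>J. of_real (w j) * \<theta> j a) + (\<Sum>j\<in>J. of_real (w j) * \<theta> j b)" if "a \<in> M" "b \<in> M" for a b
    unfolding sum.distrib[symmetric] by (rule sum.cong) (use t that in \<open>auto simp: distrib_left\<close>)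
  show "(\<Sum>j\<in>J. of_real (w j) * \<theta> j (\<lambda>x. c *\<^sub>C a x)) = c * (\<Sum>j\<in>J. of_real (w j) * \<theta> j a)" if "a \<in> M" for a c
    unfolding sum_distrib_left by (rule sum.cong) (use t that in auto)
  show "(\<Sum>j\<in>J. of_real (w j) * \<theta> j (adj S a \<circ> a)) \<in> \<real>\<^sub>\<ge>\<^sub>0" if a: "a \<in> M" for a
  proof -
    have sum_pos: "sum f J \<in> \<real>\<^sub>\<ge>\<^sub>0" if "\<And>j. j \<in> J \<Longrightarrow> f j \<in> \<real>\<^sub>\<ge>\<^sub>0" for f :: "'j \<Rightarrow> complex"
      using J that by (induction J rule: finite_induct) (auto intro: nonneg_Reals_add_I)
    show ?thesis
      by (rule sum_pos, rule nonneg_Reals_mult_I) (use t a w(1) in auto)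
  qed
  have "(\<Sum>j\<in>J. of_real (w j) * \<theta> j (idop S)) = (\<Sum>j\<in>J. complex_of_real (w j))"
    by (rule sum.cong) (use t in auto)
  then show "(\<Sum>j\<in>J. of_real (w j) * \<theta> j (idop S)) = 1"
    using w(2) by (metis of_real_1 of_real_sum)
  show "continuous_map (subtopology (ultraweak S) M) euclidean (\<lambda>d. \<Sum>j\<in>J. of_real (w j) * \<theta> j d)"
  proof (rule continuous_map_sum[OF J])
    fix j assume "j \<in> J"
    then have "continuous_map (subtopology (ultraweak S) M) euclidean (\<theta> j)" using t by blast
    moreover have "continuous_map euclidean euclidean (\<lambda>z::complex. of_real (w j) * z)"
      by (simp add: continuous_intros)
    ultimately show "continuous_map (subtopology (ultraweak S) M) euclidean (\<lambda>d. of_real (w j) * \<theta> j d)"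
      using continuous_map_compose[of _ euclidean "\<theta> j" euclidean "\<lambda>z. of_real (w j) * z"] by (simp add: o_def)
  qed
qed

section \<open>Product states pulled back along a homomorphism\<close>

context
  fixes C :: "('k::hilbert_space \<Rightarrow> 'k) set"
  assumes sep: "separable_space (euclidean :: 'h::hilbert_space topology)"
    and C: "von_neumann_algebra UNIV C"
begin

text \<open>The functional \<open>(\<omega>\<^sub>u \<otimes> \<theta>) \<circ> \<Phi>\<close>, for a not necessarily normalised vector \<open>u\<close>.\<close>

definition pulled :: "nat \<Rightarrow> (('h \<Rightarrow> 'h) \<Rightarrow> ('h \<times> 'k list) ell2 \<Rightarrow> ('h \<times> 'k list) ell2)
    \<Rightarrow> (('k list ell2 \<Rightarrow> 'k list ell2) \<Rightarrow> complex) \<Rightarrow> 'h \<Rightarrow> ('h \<Rightarrow> 'h) \<Rightarrow> complex" where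
  "pulled n \<Phi> \<theta> u a = \<theta> (slice tensor_sys (powspace n) (syspowspace n) u u (\<Phi> a))"

context
  fixes n \<Phi> \<theta>
  assumes \<Phi>: "unital_hom C n (\<Phi> :: ('h \<Rightarrow> 'h) \<Rightarrow> _)" and \<theta>: "normal_state (powspace n) (alg_pow C n) \<theta>"
begin

lemma pulled_star_hom: "normal_star_hom UNIV (bop UNIV) (syspowspace n) (sys_alg (bop UNIV) C n) \<Phi>"
  using \<Phi> by (simp add: unital_hom_def[OF C])

lemma theta_pos_functional: "pos_functional (powspace n) (alg_pow C n) \<theta>"
  using \<theta> unfolding normal_state_pos_functional[OF hsub_powspace alg_pow_op_algebra[OF C]] by simp

lemma pulled_functional: "pos_functional UNIV (bop UNIV) (pulled n \<Phi> \<theta> u)"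
proof -
  note A = sys_alg_op_algebra[OF C, where 'h = 'h and n = n] and B = op_algebra_bop[OF hsub_UNIV, where 'a = 'h]
  have pf: "pos_functional (syspowspace n) (sys_alg (bop UNIV) C n) (\<lambda>X. \<theta> (sys.sl n u u X))"
    unfolding sys_alg_def
    by (rule sysf.theta_slice_functional[OF alg_pow_op_algebra[OF C] alg_pow_double_commutant[OF C] theta_pos_functional])
  have nrm: "normal_on UNIV (bop UNIV) (\<lambda>a. \<theta> (sys.sl n u u (\<Phi> a)))"
    by (rule normal_on_comp[OF hsub_UNIV hsub_syspowspace B A pulled_star_hom pos_functional_normal[OF pf]])
      (simp_all add: pos_functional_add[OF pf] pos_functional_scale[OF pf])
  show ?thesis
    unfolding pos_functional_def pulled_def
  proof (intro conjI ballI allI nrm)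
    fix a assume a: "a \<in> bop (UNIV :: 'h set)"
    note Pa = nsh_in[OF pulled_star_hom a]
    show "\<theta> (sys.sl n u u (\<Phi> (\<lambda>x. c *\<^sub>C a x))) = c * \<theta> (sys.sl n u u (\<Phi> a))" for c
      using pos_functional_scale[OF pf Pa] nsh_scale[OF pulled_star_hom a] by simp
    have "\<Phi> (adj UNIV a \<circ> a) = adj (syspowspace n) (\<Phi> a) \<circ> \<Phi> a"
      by (simp add: nsh_comp[OF pulled_star_hom] nsh_adj[OF pulled_star_hom] a adj_bop)
    then show "\<theta> (sys.sl n u u (\<Phi> (adj UNIV a \<circ> a))) \<in> \<real>\<^sub>\<ge>\<^sub>0"
      using pos_functional_pos[OF pf Pa] by simp
    fix b assume b: "b \<in> bop (UNIV :: 'h set)"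
    show "\<theta> (sys.sl n u u (\<Phi> (\<lambda>x. a x + b x))) = \<theta> (sys.sl n u u (\<Phi> a)) + \<theta> (sys.sl n u u (\<Phi> b))"
      using pos_functional_add[OF pf Pa nsh_in[OF pulled_star_hom b]] nsh_add[OF pulled_star_hom a b] by simp
  qed
qed

lemma pulled_idop: "pulled n \<Phi> \<theta> u (idop UNIV) = of_real ((norm u)\<^sup>2)"
proof -
  have I: "idop (powspace n) \<in> alg_pow C n" by (rule op_algebra_idop[OF alg_pow_op_algebra[OF C]])
  have "\<Phi> (idop UNIV) = sys.ot n (idop UNIV) (idop (powspace n))"
    using \<Phi> by (simp add: unital_hom_def[OF C] sys.op_tensor_idop)
  then have "pulled n \<Phi> \<theta> u (idop UNIV) = \<theta> (\<lambda>y. cinner u u *\<^sub>C idop (powspace n) y)"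
    unfolding pulled_def
    by (simp add: sys.slice_op_tensor[OF UNIV_I UNIV_I bop_idop[OF hsub_UNIV] bop_idop[OF hsub_powspace]])
  also have "\<dots> = cinner u u"
    using \<theta> by (simp add: pos_functional_scale[OF theta_pos_functional I] normal_state_def)
  finally show ?thesis by (simp add: cinner_same)
qed

lemma pulled_bound:
  assumes "a \<in> bop UNIV" "\<And>v. norm (a v) \<le> M * norm v" "0 \<le> M"
  shows "cmod (pulled n \<Phi> \<theta> u a) \<le> M * (norm u)\<^sup>2"
  using functional_bound[OF sep pulled_functional assms, of u] by (simp add: pulled_idop)

text \<open>The functional is the diagonal of a sesquilinear form in the two vectors of the
  slice.\<close>

lemma pulled_parallelogram:
  assumes a: "a \<in> bop UNIV"
  shows "pulled n \<Phi> \<theta> (u + v) a + pulled n \<Phi> \<theta> (u - v) a = 2 * pulled n \<Phi> \<theta> u a + 2 * pulled n \<Phi> \<theta> v a"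
proof -
  define L where "L u v = \<theta> (sys.sl n u v (\<Phi> a))" for u v
  note Xb = op_algebra_sub[OF sys_alg_op_algebra[OF C] nsh_in[OF pulled_star_hom a]]
  have N: "sys.sl n u v (\<Phi> a) \<in> alg_pow C n" for u v
    using nsh_in[OF pulled_star_hom a] unfolding sys_alg_def
    by (rule sysf.slice_N[OF alg_pow_op_algebra[OF C] alg_pow_double_commutant[OF C] theta_pos_functional])
  have la: "L (u + u') v = L u v + L u' v" for u u' v
    unfolding L_def sys.slice_add_left[OF Xb UNIV_I UNIV_I UNIV_I] by (rule pos_functional_add[OF theta_pos_functional N N])
  have ra: "L u (v + v') = L u v + L u v'" for u v v'
    unfolding L_def sys.slice_add_right[OF Xb UNIV_I UNIV_I UNIV_I] by (rule pos_functional_add[OF theta_pos_functional N N])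
  have ls: "L (- u) v = - L u v" for u v
    unfolding L_def scaleC_minus1[of u, symmetric] sys.slice_scale_left[OF Xb UNIV_I UNIV_I]
    using pos_functional_scale[OF theta_pos_functional N, where c = "cnj (-1)"] by simp
  have rs: "L u (- v) = - L u v" for u v
    unfolding L_def scaleC_minus1[of v, symmetric] sys.slice_scale_right[OF Xb UNIV_I UNIV_I]
    using pos_functional_scale[OF theta_pos_functional N, where c = "-1"] by simp
  have "L (u + v) (u + v) + L (u + - v) (u + - v) = 2 * L u u + 2 * L v v"
    by (simp only: la ra ls rs) simp
  then show ?thesis by (simp add: pulled_def L_def)
qed

lemma pulled_scale:
  assumes a: "a \<in> bop UNIV"
  shows "pulled n \<Phi> \<theta> (c *\<^sub>C u) a = of_real ((cmod c)\<^sup>2) * pulled n \<Phi> \<theta> u a"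
proof -
  note Xb = op_algebra_sub[OF sys_alg_op_algebra[OF C] nsh_in[OF pulled_star_hom a]]
  have N: "sys.sl n u v (\<Phi> a) \<in> alg_pow C n" for u v
    using nsh_in[OF pulled_star_hom a] unfolding sys_alg_def
    by (rule sysf.slice_N[OF alg_pow_op_algebra[OF C] alg_pow_double_commutant[OF C] theta_pos_functional])
  have "sys.sl n (c *\<^sub>C u) (c *\<^sub>C u) (\<Phi> a) = (\<lambda>y. (cnj c * c) *\<^sub>C sys.sl n u u (\<Phi> a) y)"
    by (simp add: sys.slice_scale_left[OF Xb] sys.slice_scale_right[OF Xb] scaleC_scaleC mult.commute)
  then have "pulled n \<Phi> \<theta> (c *\<^sub>C u) a = (cnj c * c) * pulled n \<Phi> \<theta> u a"
    by (simp only: pulled_def pos_functional_scale[OF theta_pos_functional N])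
  also have "cnj c * c = of_real ((cmod c)\<^sup>2)" unfolding complex_norm_square by (rule mult.commute)
  finally show ?thesis .
qed

lemma product_state_pulled:
  assumes "normal_state UNIV (bop UNIV) \<sigma>" "sqfam UNIV UNIV (\<zeta> :: nat \<Rightarrow> 'h)"
    "\<And>a. a \<in> bop UNIV \<Longrightarrow> \<sigma> a = uwf UNIV \<zeta> \<zeta> a" and "a \<in> bop UNIV"
  shows "((\<lambda>m. pulled n \<Phi> \<theta> (\<zeta> m) a) has_sum product_state (bop UNIV) C n \<sigma> \<theta> (\<Phi> a)) UNIV"
  unfolding pulled_def by (rule product_state_eq[OF C]) (use assms \<theta> nsh_in[OF pulled_star_hom assms(4)] in simp_all)

end

lemma pos_projection:
  fixes \<omega> :: "('h \<Rightarrow> 'h) \<Rightarrow> complex"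
  assumes "pos_functional UNIV (bop UNIV) \<omega>" "norm \<xi> = 1"
  shows "\<omega> (coproj \<xi>) = of_real (Re (\<omega> (coproj \<xi>)))" "0 \<le> Re (\<omega> (coproj \<xi>))"
  using pos_functional_pos[OF assms(1) coproj_bop[of \<xi>]]
  by (auto simp: coproj_projection[OF assms(2)] complex_nonneg_Reals_iff complex_eq_iff)

section \<open>Limits along preparing sequences\<close>

context
  fixes n :: "nat \<Rightarrow> nat" and \<Phi> :: "nat \<Rightarrow> ('h \<Rightarrow> 'h) \<Rightarrow> ('h \<times> 'k list) ell2 \<Rightarrow> ('h \<times> 'k list) ell2"
    and \<phi> :: "('h \<Rightarrow> 'h) \<Rightarrow> complex"
  assumes \<Phi>: "\<And>k. unital_hom C (n k) (\<Phi> k)"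
    and \<phi>: "normal_state UNIV (bop UNIV) \<phi>" and faithful: "faithful UNIV (bop UNIV) \<phi>"
begin

text \<open>The vectors \<open>u\<close> for which \<open>(\<omega>\<^sub>u \<otimes> \<theta>\<^sub>k) \<circ> \<Phi>\<^sub>k\<close> loses all mass outside \<open>\<xi>\<close> form a closed subspace.
  It contains the vectors of a decomposition of \<open>\<phi>\<close>, hence is everything because \<open>\<phi>\<close> is faithful.\<close>

lemma mass_vanishes:
  assumes \<theta>: "\<And>k. normal_state (powspace (n k)) (alg_pow C (n k)) (\<theta> k)" and \<xi>: "norm \<xi> = 1"
    and lim: "(\<lambda>k. product_state (bop UNIV) C (n k) \<phi> (\<theta> k) (\<Phi> k (coproj \<xi>))) \<longlonglongrightarrow> 0"
  shows "(\<lambda>k. Re (pulled (n k) (\<Phi> k) (\<theta> k) u (coproj \<xi>))) \<longlonglongrightarrow> 0"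
proof -
  have pphi: "pos_functional UNIV (bop UNIV) \<phi>"
    using \<phi> unfolding normal_state_pos_functional[OF hsub_UNIV op_algebra_bop[OF hsub_UNIV]] by simp
  obtain z :: "nat \<Rightarrow> 'h" where z: "sqfam UNIV UNIV z" "\<And>a. a \<in> bop UNIV \<Longrightarrow> \<phi> a = uwf UNIV z z a"
    using pos_functional_decomposition[OF sep pphi] by blast
  define N where "N k u = Re (pulled (n k) (\<Phi> k) (\<theta> k) u (coproj \<xi>))" for k u
  note pp = pulled_functional[OF \<Phi> \<theta>]
  have nonneg: "0 \<le> N k u" for k u unfolding N_def by (rule pos_projection(2)[OF pp \<xi>])
  have x1: "cinner \<xi> \<xi> = 1" using \<xi> by (simp add: cinner_same)
  have cb: "norm (coproj \<xi> v) \<le> 1 * norm v" for v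
  proof -
    have "(norm (coproj \<xi> v))\<^sup>2 = Re (cinner v (coproj \<xi> v))" by (simp add: cinner_coproj[OF \<xi>])
    also have "\<dots> \<le> norm v * norm (coproj \<xi> v)"
      using complex_Re_le_cmod[of "cinner v (coproj \<xi> v)"] Cauchy_Schwarz[of v "coproj \<xi> v"] by linarith
    finally show ?thesis by (cases "norm (coproj \<xi> v) = 0") (auto simp: power2_eq_square)
  qed
  have bound: "N k u \<le> (norm u)\<^sup>2" for k u
    using pulled_bound[OF \<Phi> \<theta> coproj_bop cb, of k u] complex_Re_le_cmod[of "pulled (n k) (\<Phi> k) (\<theta> k) u (coproj \<xi>)"]
    by (simp add: N_def)
  have par: "N k (u + v) + N k (u - v) = 2 * N k u + 2 * N k v" for k u v
    using arg_cong[OF pulled_parallelogram[OF \<Phi> \<theta> coproj_bop, of k u v \<xi>], of Re] by (simp add: N_def)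
  have sc: "N k (c *\<^sub>C u) = (cmod c)\<^sup>2 * N k u" for k c u
    using arg_cong[OF pulled_scale[OF \<Phi> \<theta> coproj_bop, of k c u \<xi>], of Re]
    by (simp add: N_def del: of_real_power)
  have G: "hsub {u. (\<lambda>k. N k u) \<longlonglongrightarrow> 0}" by (rule vanishing_subspace[OF nonneg bound par sc])
  have zG: "z m \<in> {u. (\<lambda>k. N k u) \<longlonglongrightarrow> 0}" for m
  proof -
    have hs: "((\<lambda>m. N k (z m)) has_sum Re (product_state (bop UNIV) C (n k) \<phi> (\<theta> k) (\<Phi> k (coproj \<xi>)))) UNIV" for k
      unfolding N_def by (rule has_sum_Re[OF product_state_pulled[OF \<Phi> \<theta> \<phi> z coproj_bop]])
    \<comment> \<open>One term of a nonnegative series is at most its sum, and the sums tend to 0 by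
      hypothesis.\<close>
    have le: "N k (z m) \<le> Re (product_state (bop UNIV) C (n k) \<phi> (\<theta> k) (\<Phi> k (coproj \<xi>)))" for k
      using finite_sum_le_has_sum[OF hs, of "{m}"] nonneg by simp
    have "(\<lambda>k. Re (product_state (bop UNIV) C (n k) \<phi> (\<theta> k) (\<Phi> k (coproj \<xi>)))) \<longlonglongrightarrow> 0"
      using tendsto_Re[OF lim] by simp
    then have "(\<lambda>k. N k (z m)) \<longlonglongrightarrow> 0"
      by (rule tendsto_sandwich[OF _ _ tendsto_const, rotated 2]) (auto simp: nonneg le)
    then show ?thesis by simp
  qed
  have "{u. (\<lambda>k. N k u) \<longlonglongrightarrow> 0} = UNIV"
  proof (rule hsub_eq_UNIV[OF G])
    fix x assume x: "\<And>g. g \<in> {u. (\<lambda>k. N k u) \<longlonglongrightarrow> 0} \<Longrightarrow> cinner g x = 0"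
    \<comment> \<open>\<phi> sees the square of |x\<rangle>\<langle>x| only through these inner
      products, so faithfulness forces x = 0.\<close>
    have zx: "cinner x (z m) = 0" for m using x[OF zG, of m] cinner_commute[of x "z m"] by simp
    have "adj UNIV (ketbra x x) \<circ> ketbra x x \<in> bop UNIV"
      by (intro bop_comp adj_bop ketbra_bop hsub_UNIV)
    then have "\<phi> (adj UNIV (ketbra x x) \<circ> ketbra x x) = uwf UNIV z z (adj UNIV (ketbra x x) \<circ> ketbra x x)" by (rule z(2))
    also have "\<dots> = 0" by (simp add: uwf_def adj_ketbra, simp add: ketbra_def zx)
    finally have "ketbra x x = (\<lambda>_. 0)" using faithful ketbra_bop unfolding faithful_def by blast
    from fun_cong[OF this, of x] have "cinner x x *\<^sub>C x = 0" by (simp add: ketbra_def)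
    then have "norm (cinner x x *\<^sub>C x) = 0" by simp
    then show "x = 0" by (simp add: norm_scaleC cinner_same)
  qed
  then show ?thesis unfolding N_def by blast
qed

text \<open>\<open>concentration\<close> applies with total mass \<open>(norm u)\<^sup>2\<close> for
  every k, and the mass outside \<xi> tends to 0 by \<open>mass_vanishes\<close>.\<close>

lemma pulled_converges:
  assumes \<theta>: "\<And>k. normal_state (powspace (n k)) (alg_pow C (n k)) (\<theta> k)" and \<xi>: "norm \<xi> = 1"
    and prep: "\<And>a. a \<in> bop UNIV \<Longrightarrow>
      (\<lambda>k. product_state (bop UNIV) C (n k) \<phi> (\<theta> k) (\<Phi> k a)) \<longlonglongrightarrow> vector_state \<xi> a"
    and a: "a \<in> bop UNIV"
  shows "(\<lambda>k. pulled (n k) (\<Phi> k) (\<theta> k) u a) \<longlonglongrightarrow> of_real ((norm u)\<^sup>2) * vector_state \<xi> a"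
proof -
  obtain M where M: "M \<ge> 0" "\<And>v. norm (a v) \<le> M * norm v"
    using bmap_bound[OF bop_bmap[OF a]] by (metis UNIV_I)
  have x1: "cinner \<xi> \<xi> = 1" using \<xi> by (simp add: cinner_same)
  have "vector_state \<xi> (coproj \<xi>) = 0"
    by (simp add: vector_state_def coproj_apply cinner_diff_right cinner_scaleC_right x1)
  then have lim: "(\<lambda>k. Re (pulled (n k) (\<Phi> k) (\<theta> k) u (coproj \<xi>))) \<longlonglongrightarrow> 0"
    using mass_vanishes[OF \<theta> \<xi>] prep[OF coproj_bop, of \<xi>] by simp
  have "(\<lambda>k. 3 * M * (sqrt ((norm u)\<^sup>2) * sqrt (Re (pulled (n k) (\<Phi> k) (\<theta> k) u (coproj \<xi>)))))
      \<longlonglongrightarrow> 3 * M * (sqrt ((norm u)\<^sup>2) * sqrt 0)"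
    by (intro tendsto_intros lim)
  then have R: "(\<lambda>k. 3 * M * (sqrt ((norm u)\<^sup>2) * sqrt (Re (pulled (n k) (\<Phi> k) (\<theta> k) u (coproj \<xi>))))) \<longlonglongrightarrow> 0"
    by simp
  have "(\<lambda>k. pulled (n k) (\<Phi> k) (\<theta> k) u a - of_real ((norm u)\<^sup>2) * vector_state \<xi> a) \<longlonglongrightarrow> 0"
  proof (rule Lim_null_comparison[OF always_eventually R], rule allI)
    fix k
    show "cmod (pulled (n k) (\<Phi> k) (\<theta> k) u a - of_real ((norm u)\<^sup>2) * vector_state \<xi> a)
        \<le> 3 * M * (sqrt ((norm u)\<^sup>2) * sqrt (Re (pulled (n k) (\<Phi> k) (\<theta> k) u (coproj \<xi>))))"
      using concentration[OF sep pulled_functional[OF \<Phi> \<theta>] a M(2,1) \<xi>, of k u]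
      by (simp add: pulled_idop[OF \<Phi> \<theta>] vector_state_def)
  qed
  then show ?thesis by (simp add: LIM_zero_cancel)
qed

text \<open>Dominated convergence twice: over the components of \<rho> for a fixed vector u, then
  over the components of \<sigma>. The dominating bound M times the squared norm of u is uniform in
  k and in the preparing state. The mixture depends on \<rho> alone, which makes it
  universal.\<close>

lemma universal_approximation:
  fixes \<Theta> :: "'h \<Rightarrow> nat \<Rightarrow> ('k list ell2 \<Rightarrow> 'k list ell2) \<Rightarrow> complex"
  assumes \<Theta>: "\<And>\<xi> k. norm \<xi> = 1 \<Longrightarrow> normal_state (powspace (n k)) (alg_pow C (n k)) (\<Theta> \<xi> k)"
    and prep: "\<And>\<xi> a. norm \<xi> = 1 \<Longrightarrow> a \<in> bop UNIV \<Longrightarrow>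
      (\<lambda>k. product_state (bop UNIV) C (n k) \<phi> (\<Theta> \<xi> k) (\<Phi> k a)) \<longlonglongrightarrow> vector_state \<xi> a"
    and e: "norm (e :: 'h) = 1" and \<rho>: "normal_state UNIV (bop UNIV) \<rho>"
  shows "\<exists>\<theta>. (\<forall>k. normal_state (powspace (n k)) (alg_pow C (n k)) (\<theta> k)) \<and>
    (\<forall>\<sigma> a. normal_state UNIV (bop UNIV) \<sigma> \<longrightarrow> a \<in> bop UNIV \<longrightarrow>
      (\<lambda>k. product_state (bop UNIV) C (n k) \<sigma> (\<theta> k) (\<Phi> k a)) \<longlonglongrightarrow> \<rho> a)"
proof -
  have decomp: "\<exists>z :: nat \<Rightarrow> 'h. sqfam UNIV UNIV z \<and> (\<forall>a\<in>bop UNIV. \<sigma> a = uwf UNIV z z a)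
      \<and> (\<lambda>i. (norm (z i))\<^sup>2) sums 1" if \<sigma>: "normal_state UNIV (bop UNIV) \<sigma>" for \<sigma>
  proof -
    have p: "pos_functional UNIV (bop UNIV) \<sigma>" and s1: "\<sigma> (idop UNIV) = 1"
      using \<sigma> unfolding normal_state_pos_functional[OF hsub_UNIV op_algebra_bop[OF hsub_UNIV]] by simp_all
    obtain z :: "nat \<Rightarrow> 'h" where z: "sqfam UNIV UNIV z" "\<And>a. a \<in> bop UNIV \<Longrightarrow> \<sigma> a = uwf UNIV z z a"
      using pos_functional_decomposition[OF sep p] by blast
    have "(\<lambda>i. (norm (z i))\<^sup>2) summable_on UNIV" using z(1) by (simp add: sqfam_def)
    then have hs: "((\<lambda>i. (norm (z i))\<^sup>2) has_sum (\<Sum>\<^sub>\<infinity>i. (norm (z i))\<^sup>2)) UNIV" by (rule has_sum_infsum)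
    have "\<sigma> (idop UNIV) = of_real (\<Sum>\<^sub>\<infinity>i. (norm (z i))\<^sup>2)"
      unfolding z(2)[OF bop_idop[OF hsub_UNIV]] uwf_def
      using has_sum_of_real[OF hs] by (intro infsumI) (simp add: cinner_same)
    then have "(\<Sum>\<^sub>\<infinity>i. (norm (z i))\<^sup>2) = 1" using s1 by simp
    with hs have "(\<lambda>i. (norm (z i))\<^sup>2) sums 1" by (metis has_sum_imp_sums)
    with z show ?thesis by blast
  qed
  obtain r :: "nat \<Rightarrow> 'h" where r: "sqfam UNIV UNIV r" "\<And>a. a \<in> bop UNIV \<Longrightarrow> \<rho> a = uwf UNIV r r a"
    and r1: "(\<lambda>i. (norm (r i))\<^sup>2) sums 1" using decomp[OF \<rho>] by blast
  define \<mu> where "\<mu> j = (norm (r j))\<^sup>2" for j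
  \<comment> \<open>If r j is 0 its weight is 0 as well, and any unit vector will do.\<close>
  define \<xi> where "\<xi> j = (if r j = 0 then e else of_real (inverse (norm (r j))) *\<^sub>C r j)" for j
  have \<xi>: "norm (\<xi> j) = 1" for j by (simp add: \<xi>_def e norm_scaleC norm_inverse)
  have \<mu>0: "0 \<le> \<mu> j" for j by (simp add: \<mu>_def)
  have \<mu>1: "\<mu> sums 1" using r1 by (simp add: \<mu>_def[abs_def])
  have \<mu>\<xi>: "of_real (\<mu> j) * vector_state (\<xi> j) a = cinner (r j) (a (r j))" if "a \<in> bop UNIV" for a j
    using bmap_zero[OF hsub_UNIV bop_bmap[OF that]]
    by (simp add: \<mu>_def \<xi>_def vector_state_def bop_scale[OF that] cinner_scaleC_left cinner_scaleC_right
        power2_eq_square field_simps)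
  \<comment> \<open>The weight missing from the first k components; it is given to e.\<close>
  define rest where "rest k = 1 - (\<Sum>j<k. \<mu> j)" for k
  have rest0: "0 \<le> rest k" for k
    using sum_le_suminf[of \<mu> "{..<k}"] \<mu>1 \<mu>0 by (simp add: rest_def sums_iff)
  have restlim: "rest \<longlonglongrightarrow> 0"
  proof -
    have "(\<lambda>k. 1 - (\<Sum>j<k. \<mu> j)) \<longlonglongrightarrow> 1 - 1"
      by (intro tendsto_diff tendsto_const) (use \<mu>1 in \<open>simp add: sums_def\<close>)
    then show ?thesis by (simp add: rest_def[abs_def])
  qed
  \<comment> \<open>At step k the indices below k carry the components of \<rho>, and index k
    carries e with the missing weight, so the weights sum to 1.\<close>
  define w where "w k j = (if j < k then \<mu> j else rest k)" for k j
  define x where "x k j = (if j < k then \<xi> j else e)" for k j :: nat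
  have split: "(\<Sum>j\<le>k. F (w k j) (x k j)) = (\<Sum>j<k. F (\<mu> j) (\<xi> j)) + F (rest k) e"
    for k and F :: "real \<Rightarrow> 'h \<Rightarrow> 'c::comm_monoid_add"
    by (simp add: w_def x_def flip: lessThan_Suc_atMost)
  define \<theta> where "\<theta> k = (\<lambda>d. \<Sum>j\<le>k. of_real (w k j) * \<Theta> (x k j) k d)" for k
  have \<theta>: "normal_state (powspace (n k)) (alg_pow C (n k)) (\<theta> k)" for k
    unfolding \<theta>_def
  proof (rule normal_state_convex)
    show "(\<Sum>j\<le>k. w k j) = 1" using split[of "\<lambda>l _. l" k] by (simp add: rest_def)
  qed (auto simp: w_def x_def \<mu>0 rest0 \<xi> e intro!: \<Theta>)
  have conv: "(\<lambda>k. product_state (bop UNIV) C (n k) \<sigma> (\<theta> k) (\<Phi> k a)) \<longlonglongrightarrow> \<rho> a"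
    if \<sigma>: "normal_state UNIV (bop UNIV) \<sigma>" and a: "a \<in> bop UNIV" for \<sigma> a
  proof -
    obtain \<zeta> :: "nat \<Rightarrow> 'h" where \<zeta>: "sqfam UNIV UNIV \<zeta>" "\<And>a. a \<in> bop UNIV \<Longrightarrow> \<sigma> a = uwf UNIV \<zeta> \<zeta> a"
      and \<zeta>1: "(\<lambda>i. (norm (\<zeta> i))\<^sup>2) sums 1" using decomp[OF \<sigma>] by blast
    obtain M where M: "M \<ge> 0" "\<And>v. norm (a v) \<le> M * norm v"
      using bmap_bound[OF bop_bmap[OF a]] by (metis UNIV_I)
    define L where "L u y k = pulled (n k) (\<Phi> k) (\<Theta> y k) u a" for u y k
    have Lb: "cmod (L u y k) \<le> M * (norm u)\<^sup>2" if "norm y = 1" for u y k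
      unfolding L_def by (rule pulled_bound[OF \<Phi> \<Theta>[OF that] a M(2,1)])
    have Llim: "(\<lambda>k. L u y k) \<longlonglongrightarrow> of_real ((norm u)\<^sup>2) * vector_state y a" if "norm y = 1" for u y
      unfolding L_def by (rule pulled_converges[OF \<Theta>[OF that] that prep[OF that] a])
    have \<theta>L: "pulled (n k) (\<Phi> k) (\<theta> k) u a = (\<Sum>j<k. of_real (\<mu> j) * L u (\<xi> j) k) + of_real (rest k) * L u e k" for u k
      unfolding pulled_def[of _ _ "\<theta> k"] \<theta>_def
      using split[of "\<lambda>l y. of_real l * L u y k" k] by (simp add: L_def pulled_def)
    have \<rho>s: "(\<lambda>j. cinner (r j) (a (r j))) sums \<rho> a"
      unfolding r(2)[OF a] uwf_def
      by (rule has_sum_imp_sums[OF has_sum_infsum], rule uwf_summable_bmap(2)[OF r(1) r(1) bop_bmap[OF a]])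
    have lim1: "(\<lambda>k. pulled (n k) (\<Phi> k) (\<theta> k) u a) \<longlonglongrightarrow> of_real ((norm u)\<^sup>2) * \<rho> a" for u
    proof -
      \<comment> \<open>Truncation at j < k turns the sum of varying length into a series over all
        j, as dominated convergence demands; for fixed j it is eventually invisible.\<close>
      define f where "f j k = (if j < k then of_real (\<mu> j) * L u (\<xi> j) k else 0)" for j k
      have "(\<lambda>k. \<Sum>j. f j k) \<longlonglongrightarrow> (\<Sum>j. of_real (\<mu> j) * (of_real ((norm u)\<^sup>2) * vector_state (\<xi> j) a))"
      proof (rule tannery)
        show "(\<lambda>k. f j k) \<longlonglongrightarrow> of_real (\<mu> j) * (of_real ((norm u)\<^sup>2) * vector_state (\<xi> j) a)" for j
        proof (rule Lim_transform_eventually)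
          show "(\<lambda>k. of_real (\<mu> j) * L u (\<xi> j) k) \<longlonglongrightarrow> of_real (\<mu> j) * (of_real ((norm u)\<^sup>2) * vector_state (\<xi> j) a)"
            by (intro tendsto_mult tendsto_const Llim \<xi>)
          show "\<forall>\<^sub>F k in sequentially. of_real (\<mu> j) * L u (\<xi> j) k = f j k"
            using eventually_gt_at_top[of j] by (rule eventually_mono) (simp add: f_def)
        qed
        show "cmod (f j k) \<le> \<mu> j * (M * (norm u)\<^sup>2)" for j k
          using mult_left_mono[OF Lb[OF \<xi>, of u j k] \<mu>0[of j]] \<mu>0[of j] M(1) by (simp add: f_def norm_mult)
        show "summable (\<lambda>j. \<mu> j * (M * (norm u)\<^sup>2))" using \<mu>1 by (intro summable_mult2) (simp add: sums_iff)
      qed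
      moreover have "(\<Sum>j. f j k) = (\<Sum>j<k. of_real (\<mu> j) * L u (\<xi> j) k)" for k
        by (subst suminf_finite[of "{..<k}"]) (auto simp: f_def)
      moreover have "(\<Sum>j. of_real (\<mu> j) * (of_real ((norm u)\<^sup>2) * vector_state (\<xi> j) a)) = of_real ((norm u)\<^sup>2) * \<rho> a"
      proof -
        have "(\<lambda>j. of_real ((norm u)\<^sup>2) * cinner (r j) (a (r j))) sums (of_real ((norm u)\<^sup>2) * \<rho> a)"
          by (rule sums_mult[OF \<rho>s])
        then show ?thesis
          unfolding \<mu>\<xi>[OF a, symmetric] by (intro sums_unique[symmetric]) (simp add: mult.left_commute)
      qed
      moreover have "(\<lambda>k. of_real (rest k) * L u e k) \<longlonglongrightarrow> of_real 0 * (of_real ((norm u)\<^sup>2) * vector_state e a)"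
        by (intro tendsto_mult tendsto_of_real restlim Llim e)
      ultimately have "(\<lambda>k. (\<Sum>j<k. of_real (\<mu> j) * L u (\<xi> j) k) + of_real (rest k) * L u e k)
          \<longlonglongrightarrow> of_real ((norm u)\<^sup>2) * \<rho> a + 0" by (intro tendsto_add) simp_all
      then show ?thesis by (simp add: \<theta>L)
    qed
    have "(\<lambda>k. \<Sum>m. pulled (n k) (\<Phi> k) (\<theta> k) (\<zeta> m) a) \<longlonglongrightarrow> (\<Sum>m. of_real ((norm (\<zeta> m))\<^sup>2) * \<rho> a)"
    proof (rule tannery[OF lim1])
      show "cmod (pulled (n k) (\<Phi> k) (\<theta> k) (\<zeta> m) a) \<le> M * (norm (\<zeta> m))\<^sup>2" for m k
        by (rule pulled_bound[OF \<Phi> \<theta> a M(2,1)])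
      show "summable (\<lambda>m. M * (norm (\<zeta> m))\<^sup>2)" using \<zeta>1 by (intro summable_mult) (simp add: sums_iff)
    qed
    moreover have "(\<Sum>m. pulled (n k) (\<Phi> k) (\<theta> k) (\<zeta> m) a) = product_state (bop UNIV) C (n k) \<sigma> (\<theta> k) (\<Phi> k a)" for k
      by (rule sums_unique[symmetric, OF has_sum_imp_sums[OF product_state_pulled[OF \<Phi> \<theta> \<sigma> \<zeta> a]]])
    moreover have "(\<Sum>m. of_real ((norm (\<zeta> m))\<^sup>2) * \<rho> a) = \<rho> a"
      using sums_mult2[OF sums_of_real[OF \<zeta>1], of "\<rho> a"] by (simp add: sums_iff)
    ultimately show ?thesis by simp
  qed
  show ?thesis using \<theta> conv by blast
qed

end

end

theorem theorem2p9:
  fixes C :: "('k::hilbert_space \<Rightarrow> 'k) set"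
    and J :: "('h::hilbert_space \<Rightarrow> 'h) \<Rightarrow> ('h \<times> 'k list) ell2 \<Rightarrow> ('h \<times> 'k list) ell2"
  assumes "separable_space (euclidean :: 'h topology)"
    and "separable_space (euclidean :: 'k topology)"
    and "von_neumann_algebra UNIV C"
    and "transition (bop UNIV) C J"
    and "\<exists>\<phi>. normal_state UNIV (bop UNIV) \<phi> \<and> faithful UNIV (bop UNIV) \<phi> \<and>
           (\<exists>s :: 'h \<Rightarrow> 'k prep_seq.
              (\<forall>\<xi>. norm \<xi> = 1 \<longrightarrow> preparing (bop UNIV) C J \<phi> (vector_state \<xi>) (s \<xi>)) \<and>
              (\<forall>\<xi> \<eta>. norm \<xi> = 1 \<longrightarrow> norm \<eta> = 1 \<longrightarrow> compatible (s \<xi>) (s \<eta>)))"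
  shows "\<exists>s :: (('h \<Rightarrow> 'h) \<Rightarrow> complex) \<Rightarrow> 'k prep_seq.
           (\<forall>\<rho>. normal_state UNIV (bop UNIV) \<rho> \<longrightarrow>
              universally_preparing (bop UNIV) C J \<rho> (s \<rho>)) \<and>
           (\<forall>\<rho> \<rho>'. normal_state UNIV (bop UNIV) \<rho> \<longrightarrow> normal_state UNIV (bop UNIV) \<rho>' \<longrightarrow>
              compatible (s \<rho>) (s \<rho>'))"
proof -
  obtain \<phi> and s :: "'h \<Rightarrow> 'k prep_seq" where \<phi>: "normal_state UNIV (bop UNIV) \<phi>" "faithful UNIV (bop UNIV) \<phi>"
    and prep: "\<And>\<xi>. norm \<xi> = 1 \<Longrightarrow> preparing (bop UNIV) C J \<phi> (vector_state \<xi>) (s \<xi>)"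
    and comp: "\<And>\<xi> \<eta>. norm \<xi> = 1 \<Longrightarrow> norm \<eta> = 1 \<Longrightarrow> compatible (s \<xi>) (s \<eta>)"
    using assms(5) by metis
  \<comment> \<open>On the zero space the identity is the zero operator, so no functional is
    normalised.\<close>
  have "\<exists>v :: 'h. v \<noteq> 0"
  proof (rule ccontr)
    assume "\<nexists>v :: 'h. v \<noteq> 0"
    then have "idop UNIV = (\<lambda>v :: 'h. 0 *\<^sub>C idop UNIV v)" by (auto simp: fun_eq_iff)
    then have "\<phi> (idop UNIV) = 0 * \<phi> (idop UNIV)"
      using \<phi>(1) bop_idop[OF hsub_UNIV] unfolding normal_state_def by metis
    then show False using \<phi>(1) by (simp add: normal_state_def)
  qed
  then obtain v :: 'h where "v \<noteq> 0" by blast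
  then have e: "norm (of_real (inverse (norm v)) *\<^sub>C v) = 1" by (simp add: norm_scaleC norm_inverse)
  define e where "e = of_real (inverse (norm v)) *\<^sub>C v"
  have e: "norm e = 1" using e by (simp add: e_def)
  define n where "n = fst (s e)"
  \<comment> \<open>Compatibility: the lengths do not depend on \<xi>, so the preparing states of
    different vectors can be mixed on one algebra.\<close>
  have n: "fst (s \<xi>) = n" if "norm \<xi> = 1" for \<xi>
    using comp[OF that e] by (auto simp: compatible_def n_def)
  have n1: "n k \<ge> 1" for k using prep[OF e] by (simp add: preparing_def n_def)
  define \<Phi> where "\<Phi> k = iterate (bop UNIV) C J (n k)" for k
  \<comment> \<open>n k \<ge> 1 excludes the undefined iterate 0.\<close>
  have \<Phi>: "unital_hom C (n k) (\<Phi> k)" for k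
    using unital_hom_iterate[OF assms(3,4) e, of "n k - 1"] n1[of k] by (simp add: \<Phi>_def)
  have "\<forall>\<rho>. \<exists>\<theta>. normal_state UNIV (bop UNIV) \<rho> \<longrightarrow>
    (\<forall>k. normal_state (powspace (n k)) (alg_pow C (n k)) (\<theta> k)) \<and>
    (\<forall>\<sigma> a. normal_state UNIV (bop UNIV) \<sigma> \<longrightarrow> a \<in> bop UNIV \<longrightarrow>
      (\<lambda>k. product_state (bop UNIV) C (n k) \<sigma> (\<theta> k) (\<Phi> k a)) \<longlonglongrightarrow> \<rho> a)"
    (is "\<forall>\<rho>. \<exists>\<theta>. _ \<longrightarrow> ?P \<rho> \<theta>")
  proof (intro allI)
    fix \<rho> :: "('h \<Rightarrow> 'h) \<Rightarrow> complex"
    have "\<exists>\<theta>. ?P \<rho> \<theta>" if "normal_state UNIV (bop UNIV) \<rho>"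
      by (rule universal_approximation[where \<Theta> = "\<lambda>\<xi>. snd (s \<xi>)", OF assms(1,3) \<Phi> \<phi> _ _ e that])
        (use prep n in \<open>auto simp: preparing_def \<Phi>_def\<close>)
    then show "\<exists>\<theta>. normal_state UNIV (bop UNIV) \<rho> \<longrightarrow> ?P \<rho> \<theta>" by blast
  qed
  from choice[OF this] obtain \<theta> where \<theta>: "\<And>\<rho>. normal_state UNIV (bop UNIV) \<rho> \<Longrightarrow>
    (\<forall>k. normal_state (powspace (n k)) (alg_pow C (n k)) (\<theta> \<rho> k)) \<and>
    (\<forall>\<sigma> a. normal_state UNIV (bop UNIV) \<sigma> \<longrightarrow> a \<in> bop UNIV \<longrightarrow>
      (\<lambda>k. product_state (bop UNIV) C (n k) \<sigma> (\<theta> \<rho> k) (\<Phi> k a)) \<longlonglongrightarrow> \<rho> a)" by auto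
  show ?thesis
    \<comment> \<open>All \<rho> share the lengths n, which makes the new sequences
      compatible.\<close>
    by (rule exI[of _ "\<lambda>\<rho>. (n, \<theta> \<rho>)"])
      (use n1 \<theta> in \<open>auto simp: universally_preparing_def preparing_def compatible_def \<Phi>_def\<close>)
qed

end
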